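(* Assume the setup (I)--(IV) described in the context, with the sets $S=\bigcup_{i\in I}S_i$, knots $\xi^{(i)}_k$, parameters $c_j>0$, generators $g_j$, index sets $I_j$, $J_i$, bijections $\varphi_i:J_i\to\mathbb{Z}$, constant $N\in\mathbb{N}$, coefficients $a^{(i)}_{k,n}$, and functions $h_j$. Suppose that $$\sum_{j\in J}c_j^{-1/2}\hat g_j(\gamma)=\chi_S(\gamma)\qquad\text{for a.e. }\gamma\in\mathbb{R}.$$ Suppose further that for each $j\in J$ (with $I_j\neq\emptyset$) $c_j\le 1/M_j$, where, writing $i_+=\max I_j$ and $i_-=\min I_j$, $$M_j=\max\Bigl\{\xi^{(i_+)}_{\varphi_{i_+}(j)+2N}-\xi^{(i_-)}_{\varphi_{i_-}(j)},\ \ \xi^{(i_+)}_{\varphi_{i_+}(j)+N}-\xi^{(i_-)}_{\varphi_{i_-}(j)-N}\Bigr\},$$ and that $\{a^{(i)}_{k,n}\}_{k\in\mathbb{Z},\,n\in\{-N+1,\dots,N-1\},\,i\in I}$ is a bounded sequence satisfying $$a^{(i)}_{\varphi_i(j),0}=1\quad\text{and}\quad\left(\frac{c_{\varphi_i^{-1}(\varphi_i(j)+n)}}{c_j}\right)^{1/2}a^{(i)}_{\varphi_i(j),n}+\left(\frac{c_j}{c_{\varphi_i^{-1}(\varphi_i(j)+n)}}\right)^{1/2}a^{(i)}_{\varphi_i(j)+n,-n}=2$$ for all $n\in\{1,\dots,N-1\}$, $j\in J_i$ and $i\in I$. Then $\{T_{c_jk}g_j\}_{k\in\mathbb{Z},\,j\in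 J}$ and $\{T_{c_jk}h_j\}_{k\in\mathbb{Z},\,j\in J}$ are a pair of dual frames for $\check L^2(S)$.
   Context: $T_cf(x)=f(x-c)$; $\hat f(\gamma)=\int_{\mathbb{R}}f(x)e^{-2\pi i\gamma x}\,dx$ (extended to $L^2(\mathbb{R})$). For measurable $S\subset\mathbb{R}$, $\check L^2(S)=\{f\in L^2(\mathbb{R}):\operatorname{supp}\hat f\subset S\}$, i.e. the closed subspace of those $f$ whose Fourier transform vanishes a.e. outside $S$. $J$ is a countable index set. Setup. (I) $S=\bigcup_{i\in I}S_i\subset\mathbb{R}$ is an at most countable union of disjoint intervals, $I\subset\mathbb{Z}$, written $S_i=(\alpha_i,\beta_i]$, where $\alpha_i=-\infty$ is allowed, and $\beta_i=\infty$ is allowed (in which case $S_i=(\alpha_i,\infty)$; $S_i=\mathbb{R}$ if both are infinite). The ordering is such that $\beta_i\le\alpha_{i'}$ whenever $i<i'$. For each $i\in I$ there is a sequence of knots $\{\xi^{(i)}_k\}_{k\in\mathbb{Z}}\subset S_i$ with $\lim_{k\to-\infty}\xi^{(i)}_k=\alpha_i$, $\lim_{k\to\infty}\xi^{(i)}_k=\beta_i$, and $\xi^{(i)}_k\le\xi^{(i)}_{k+1}$ for all $k\in\mathbb{Z}$. (II) For each $j\in J$, $c_j>0$ and $g_j\in L^2(\mathbb{R})$ is such that $\hat g_j$ is a bounded, real-valued function with compact support in a finite union of the sets $S_i$, $i\in I$. Moreover $\sup_{j\in J}\|c_j^{-1/2}\hat g_j\|_\infty<\infty$. (III) For $j\in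 J$ let $I_j=\{i\in I:\hat g_j\neq0\text{ on }S_i\}$ (meaning $\hat g_j$ is not a.e. zero on $S_i$). For each $i\in I$ fix an index set $J_i\subset J$ with $\{j\in J:\hat g_j\neq0\text{ on }S_i\}\subset J_i$. There are bijections $\varphi_i:J_i\to\mathbb{Z}$, $i\in I$, and a number $N\in\mathbb{N}$ such that for each $j\in J$ $$\operatorname{supp}\hat g_j\subset\bigcup_{i\in I_j}\bigl[\xi^{(i)}_{\varphi_i(j)},\,\xi^{(i)}_{\varphi_i(j)+N}\bigr].$$ (IV) $\{a^{(i)}_{k,n}\}_{i\in I,\,k\in\mathbb{Z},\,n\in\{-N+1,\dots,N-1\}}$ are scalars, and $h_j\in\check L^2(S)$, $j\in J$, is defined by $$\hat h_j(\gamma)=\begin{cases}\sum_{n=-N+1}^{N-1}a^{(i)}_{\varphi_i(j),n}\,\hat g_{\varphi_i^{-1}(\varphi_i(j)+n)}(\gamma)&\gamma\in S_i,\ i\in I_j,\\ 0&\gamma\in S_i,\ i\notin I_j,\end{cases}$$ and $\hat h_j=0$ outside $S$. Two systems $\{f_k\}$, $\{\tilde f_k\}$ in a Hilbert space $\mathcal{H}$ are dual frames for $\mathcal{H}$ if both are frames for $\mathcal{H}$ and $f=\sum_k\langle f,\tilde f_k\rangle f_k$ for all $f\in\mathcal{H}$. *)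

theory Defs
  imports "HOL-Analysis.Analysis"
begin

section \<open>The Hilbert space of square-integrable functions on the line\<close>

text \<open>Elements of $L^2(\mathbb{R})$ are represented by Borel functions; equality in
  $L^2(\mathbb{R})$ is equality almost everywhere, i.e. vanishing of the norm of the difference.\<close>

definition L2 :: "(real \<Rightarrow> complex) set" where
  "L2 = {f. f \<in> borel_measurable lborel \<and> integrable lborel (\<lambda>x. (norm (f x))\<^sup>2)}"

definition L2_inner :: "(real \<Rightarrow> complex) \<Rightarrow> (real \<Rightarrow> complex) \<Rightarrow> complex" where
  "L2_inner f g = (LINT x|lborel. f x * cnj (g x))"

definition L2_norm :: "(real \<Rightarrow> complex) \<Rightarrow> real" where
  "L2_norm f = sqrt (LINT x|lborel. (norm (f x))\<^sup>2)"

text \<open>Frames are indexed by unordered sets, so series converge unconditionally (in norm).\<close>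

definition has_L2_sum :: "('k \<Rightarrow> real \<Rightarrow> complex) \<Rightarrow> 'k set \<Rightarrow> (real \<Rightarrow> complex) \<Rightarrow> bool" where
  "has_L2_sum u K f \<longleftrightarrow>
     ((\<lambda>F. L2_norm (\<lambda>x. f x - (\<Sum>k\<in>F. u k x))) \<longlongrightarrow> 0) (finite_subsets_at_top K)"

definition translate :: "real \<Rightarrow> (real \<Rightarrow> complex) \<Rightarrow> real \<Rightarrow> complex" where
  "translate c f = (\<lambda>x. f (x - c))"


section \<open>The Fourier transform\<close>

definition fourier :: "(real \<Rightarrow> complex) \<Rightarrow> real \<Rightarrow> complex" where
  "fourier f \<gamma> = (LINT x|lborel. f x * cis (- 2 * pi * \<gamma> * x))"

text \<open>The continuous extension of the Fourier transform from $L^1\cap L^2$ to $L^2$: the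
  $L^2$-limit of the transforms of the truncations of \<open>f\<close> to \<open>{-n..n}\<close>, which lie in
  $L^1\cap L^2$. It is determined up to a null set, so \<open>fourier_L2 f\<close> is a chosen representative
  and only its almost-everywhere properties are meaningful.\<close>

definition fourier_L2 :: "(real \<Rightarrow> complex) \<Rightarrow> real \<Rightarrow> complex" where
  "fourier_L2 f = (SOME F. F \<in> L2 \<and>
     (\<lambda>n::nat. L2_norm (\<lambda>\<gamma>. F \<gamma> - fourier (\<lambda>x. indicator {- real n..real n} x * f x) \<gamma>))
        \<longlonglongrightarrow> 0)"

definition vanishes_on :: "(real \<Rightarrow> complex) \<Rightarrow> real set \<Rightarrow> bool" where
  "vanishes_on F A \<longleftrightarrow> (AE \<gamma> in lborel. \<gamma> \<in> A \<longrightarrow> F \<gamma> = 0)"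

text \<open>$\check L^2(S)$. For \<open>S\<close> not closed, the condition that the transform vanishes almost
  everywhere outside \<open>S\<close> is weaker than its closed support lying in \<open>S\<close>; in general only the former gives
  a closed subspace.\<close>

definition L2_check :: "real set \<Rightarrow> (real \<Rightarrow> complex) set" where
  "L2_check S = {f \<in> L2. vanishes_on (fourier_L2 f) (- S)}"


section \<open>Frames in subspaces of \<open>L2\<close>\<close>

definition is_frame :: "(real \<Rightarrow> complex) set \<Rightarrow> 'k set \<Rightarrow> ('k \<Rightarrow> real \<Rightarrow> complex) \<Rightarrow> bool" where
  "is_frame H K u \<longleftrightarrow>
     (\<forall>k\<in>K. u k \<in> H) \<and>
     (\<exists>A>0. \<exists>B>0. \<forall>f\<in>H.
        (\<lambda>k. (norm (L2_inner f (u k)))\<^sup>2) summable_on K \<and>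
        A * (L2_norm f)\<^sup>2 \<le> (\<Sum>\<^sub>\<infinity>k\<in>K. (norm (L2_inner f (u k)))\<^sup>2) \<and>
        (\<Sum>\<^sub>\<infinity>k\<in>K. (norm (L2_inner f (u k)))\<^sup>2) \<le> B * (L2_norm f)\<^sup>2)"

definition dual_frames ::
  "(real \<Rightarrow> complex) set \<Rightarrow> 'k set \<Rightarrow> ('k \<Rightarrow> real \<Rightarrow> complex) \<Rightarrow> ('k \<Rightarrow> real \<Rightarrow> complex) \<Rightarrow> bool"
where
  "dual_frames H K u v \<longleftrightarrow>
     is_frame H K u \<and> is_frame H K v \<and>
     (\<forall>f\<in>H. has_L2_sum (\<lambda>k x. L2_inner f (v k) * u k x) K f)"


section \<open>Intervals and knots\<close>

text \<open>The interval $(\alpha,\beta]$, read as $(\alpha,\infty)$ if $\beta=\infty$.\<close>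

definition half_open :: "ereal \<Rightarrow> ereal \<Rightarrow> real set" where
  "half_open \<alpha> \<beta> = {x. \<alpha> < ereal x \<and> ereal x \<le> \<beta>}"

text \<open>The set $I_j$ for \<open>G\<close> the Fourier transform of \<open>g j\<close> and \<open>P i\<close> the interval $S_i$.\<close>

definition active :: "int set \<Rightarrow> (int \<Rightarrow> real set) \<Rightarrow> (real \<Rightarrow> complex) \<Rightarrow> int set" where
  "active I P G = {i \<in> I. \<not> vanishes_on G (P i)}"

text \<open>The number $M_j$, where \<open>A\<close> is $I_j$ and \<open>m i\<close> is $\varphi_i(j)$.\<close>

definition knot_span :: "(int \<Rightarrow> int \<Rightarrow> real) \<Rightarrow> nat \<Rightarrow> int set \<Rightarrow> (int \<Rightarrow> int) \<Rightarrow> real" where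
  "knot_span \<xi> N A m =
     max (\<xi> (Max A) (m (Max A) + 2 * int N) - \<xi> (Min A) (m (Min A)))
         (\<xi> (Max A) (m (Max A) + int N) - \<xi> (Min A) (m (Min A) - int N))"

end

theory Submission
  imports Defs
begin

text \<open>Write \<open>G j\<close> and \<open>H j\<close> for the Fourier transforms of \<open>g j\<close> and \<open>h j\<close>. By Plancherel, the coefficients of \<open>f\<close>
  against the translates of \<open>h j\<close> are the Fourier coefficients, with frequency spacing \<open>c j\<close>, of the transform
  of \<open>f\<close> times the conjugate of \<open>H j\<close>. The bound on \<open>c j\<close> says that \<open>G j\<close> and \<open>H j\<close> do not overlap with
  translates of each other by nonzero multiples of \<open>1 / c j\<close>, so Parseval turns the sum over the translates of one
  generator into multiplication by \<open>G j * cnj (H j) / c j\<close>. Summing over \<open>j\<close>, it remains to see that these products add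
  up to 1 almost everywhere on \<open>S\<close>. At a fixed frequency in \<open>S i\<close>, order the generators in \<open>J i\<close> by \<open>\<phi> i\<close>: at most \<open>N\<close>
  consecutive values \<open>u k\<close> of the functions \<open>c j powr (- 1 / 2) * G j\<close> are nonzero, and the condition on the coefficients makes the sum of the products equal to the square of
  the sum of all \<open>u k\<close>, which is 1.\<close>

section \<open>The space \<open>L2\<close>\<close>

text \<open>What the bound on \<open>c j\<close> controls is the distance from the left end of one
  spectrum to the right end of the other, in both directions: the two entries of the maximum
  \<open>knot_span\<close>. Cutting the spectrum of \<open>h j\<close> at the right end of that of
  \<open>g j\<close> leaves two pieces of length at most \<open>1 / c j\<close>, enough for the
  mixed identity with \<open>g j\<close> and for a Bessel bound with an additional factor 2. A bound
  on the coefficients does not by itself bound the weights in the pairing condition, as the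
  quotients of the \<open>c j\<close> are not assumed bounded. The pairing repairs this: of a ratio
  and its inverse one is at most 1, and the other weight is 2 minus a bounded one. Both lower frame
  bounds come from duality: testing the weak expansion of \<open>f\<close> with \<open>f\<close>
  bounds the fourth power of its norm by the product of the two coefficient sums.\<close>

lemma borel_measurable_cnj [measurable (raw)]:
  "f \<in> borel_measurable M \<Longrightarrow> (\<lambda>x. cnj (f x)) \<in> borel_measurable M"
  by (rule measurable_compose[OF _ borel_measurable_continuous_onI]) (auto intro: continuous_intros)

lemma L2I: "f \<in> borel_measurable borel \<Longrightarrow> integrable lborel (\<lambda>x. (norm (f x))\<^sup>2) \<Longrightarrow> f \<in> L2"
  by (simp add: L2_def)

lemma L2_measurable: "f \<in> L2 \<Longrightarrow> f \<in> borel_measurable borel"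
  by (simp add: L2_def)

lemma L2_integrable: "f \<in> L2 \<Longrightarrow> integrable lborel (\<lambda>x. (norm (f x))\<^sup>2)"
  by (simp add: L2_def)

lemma L2_norm_nonneg [simp]: "0 \<le> L2_norm f"
  by (simp add: L2_norm_def)

lemma L2_norm_square: "(L2_norm f)\<^sup>2 = (LINT x|lborel. (norm (f x))\<^sup>2)"
  by (simp add: L2_norm_def)

lemma L2_norm_minus_commute: "L2_norm (\<lambda>x. f x - g x) = L2_norm (\<lambda>x. g x - f x)"
  by (simp add: L2_norm_def norm_minus_commute)

lemma L2_dominated:
  assumes "f \<in> borel_measurable borel" "g \<in> L2" "AE x in lborel. norm (f x) \<le> C * norm (g x)"
  shows "f \<in> L2"
proof (rule L2I)
  show "integrable lborel (\<lambda>x. (norm (f x))\<^sup>2)"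
  proof (rule Bochner_Integration.integrable_bound)
    show "integrable lborel (\<lambda>x. C\<^sup>2 * (norm (g x))\<^sup>2)"
      using L2_integrable[OF assms(2)] by simp
    show "AE x in lborel. norm ((norm (f x))\<^sup>2) \<le> norm (C\<^sup>2 * (norm (g x))\<^sup>2)"
      using assms(3)
    proof eventually_elim
      case (elim x)
      then have "(norm (f x))\<^sup>2 \<le> (C * norm (g x))\<^sup>2"
        by (intro power_mono) auto
      then show ?case by (simp add: power_mult_distrib)
    qed
  qed (use assms in measurable)
qed (use assms in simp)

lemma L2_norm_dominated:
  assumes "f \<in> borel_measurable borel" "g \<in> L2" "AE x in lborel. norm (f x) \<le> C * norm (g x)" "0 \<le> C"
  shows "L2_norm f \<le> C * L2_norm g"
proof -
  have "(L2_norm f)\<^sup>2 \<le> (LINT x|lborel. C\<^sup>2 * (norm (g x))\<^sup>2)"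
    unfolding L2_norm_square
  proof (rule integral_mono_AE)
    show "integrable lborel (\<lambda>x. (norm (f x))\<^sup>2)"
      using L2_dominated[OF assms(1-3)] L2_integrable by blast
    show "integrable lborel (\<lambda>x. C\<^sup>2 * (norm (g x))\<^sup>2)"
      using L2_integrable[OF assms(2)] by simp
    show "AE x in lborel. (norm (f x))\<^sup>2 \<le> C\<^sup>2 * (norm (g x))\<^sup>2"
      using assms(3)
    proof eventually_elim
      case (elim x)
      then have "(norm (f x))\<^sup>2 \<le> (C * norm (g x))\<^sup>2"
        by (intro power_mono) auto
      then show ?case by (simp add: power_mult_distrib)
    qed
  qed
  also have "\<dots> = (C * L2_norm g)\<^sup>2"
    by (simp add: power_mult_distrib L2_norm_square)
  finally show ?thesis
    using assms(4) by (simp add: power2_le_iff_abs_le)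
qed

lemma L2_add:
  assumes "f \<in> L2" "g \<in> L2" shows "(\<lambda>x. f x + g x) \<in> L2"
proof (rule L2I)
  show "integrable lborel (\<lambda>x. (norm (f x + g x))\<^sup>2)"
  proof (rule Bochner_Integration.integrable_bound)
    show "integrable lborel (\<lambda>x. 2 * (norm (f x))\<^sup>2 + 2 * (norm (g x))\<^sup>2)"
      using L2_integrable[OF assms(1)] L2_integrable[OF assms(2)] by simp
    show "AE x in lborel. norm ((norm (f x + g x))\<^sup>2) \<le> norm (2 * (norm (f x))\<^sup>2 + 2 * (norm (g x))\<^sup>2)"
    proof (rule AE_I2)
      fix x
      have "(norm (f x + g x))\<^sup>2 \<le> (norm (f x) + norm (g x))\<^sup>2"
        by (intro power_mono norm_triangle_ineq) auto
      also have "\<dots> \<le> 2 * (norm (f x))\<^sup>2 + 2 * (norm (g x))\<^sup>2"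
        using sum_squares_bound[of "norm (f x)" "norm (g x)"] by (simp add: power2_sum)
      finally show "norm ((norm (f x + g x))\<^sup>2) \<le> norm (2 * (norm (f x))\<^sup>2 + 2 * (norm (g x))\<^sup>2)"
        by simp
    qed
  qed (use assms[THEN L2_measurable] in measurable)
qed (use assms[THEN L2_measurable] in measurable)

lemma L2_zero [simp]: "(\<lambda>x. 0) \<in> L2"
  by (rule L2I) auto

lemma L2_mult_bounded:
  assumes "f \<in> L2" "m \<in> borel_measurable borel" "AE x in lborel. norm (m x) \<le> C"
  shows "(\<lambda>x. m x * f x) \<in> L2"
proof (rule L2_dominated[OF _ assms(1)])
  show "(\<lambda>x. m x * f x) \<in> borel_measurable borel"
    using assms L2_measurable by measurable
  show "AE x in lborel. norm (m x * f x) \<le> C * norm (f x)"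
    using assms(3) by eventually_elim (simp add: norm_mult mult_right_mono)
qed

lemma L2_cmult: "f \<in> L2 \<Longrightarrow> (\<lambda>x. z * f x) \<in> L2"
  by (rule L2_mult_bounded[where C = "norm z"]) auto

lemma L2_diff: "f \<in> L2 \<Longrightarrow> g \<in> L2 \<Longrightarrow> (\<lambda>x. f x - g x) \<in> L2"
  using L2_add[of f "\<lambda>x. - 1 * g x"] L2_cmult[of g "- 1"] by simp

lemma L2_sum: "(\<And>k. k \<in> F \<Longrightarrow> u k \<in> L2) \<Longrightarrow> (\<lambda>x. \<Sum>k\<in>F. z k * u k x) \<in> L2"
  by (induction F rule: infinite_finite_induct) (auto intro!: L2_add L2_cmult)

lemma L2_indicator: "f \<in> L2 \<Longrightarrow> A \<in> sets borel \<Longrightarrow> (\<lambda>x. indicator A x * f x) \<in> L2"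
  by (rule L2_mult_bounded[where C = 1]) (auto simp: indicator_def)

lemma L2_cnj: "f \<in> L2 \<Longrightarrow> (\<lambda>x. cnj (f x)) \<in> L2"
  by (auto simp: L2_def intro: borel_measurable_cnj)

lemma L2_integrable_mult:
  assumes "f \<in> L2" "g \<in> L2"
  shows "integrable lborel (\<lambda>x. f x * g x)"
proof (rule Bochner_Integration.integrable_bound)
  show "integrable lborel (\<lambda>x. (norm (f x))\<^sup>2 + (norm (g x))\<^sup>2)"
    using assms L2_integrable by auto
  show "AE x in lborel. norm (f x * g x) \<le> norm ((norm (f x))\<^sup>2 + (norm (g x))\<^sup>2)"
  proof (rule AE_I2)
    fix x
    have "2 * norm (f x) * norm (g x) \<le> (norm (f x))\<^sup>2 + (norm (g x))\<^sup>2"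
      by (rule sum_squares_bound)
    moreover have "0 \<le> norm (f x) * norm (g x)" by simp
    ultimately have "norm (f x) * norm (g x) \<le> (norm (f x))\<^sup>2 + (norm (g x))\<^sup>2"
      by linarith
    then show "norm (f x * g x) \<le> norm ((norm (f x))\<^sup>2 + (norm (g x))\<^sup>2)"
      by (simp add: norm_mult)
  qed
qed (use assms L2_measurable in measurable)

lemma L2_inner_integrable: "f \<in> L2 \<Longrightarrow> g \<in> L2 \<Longrightarrow> integrable lborel (\<lambda>x. f x * cnj (g x))"
  by (intro L2_integrable_mult L2_cnj)

lemma L2_inner_self: "L2_inner f f = of_real ((L2_norm f)\<^sup>2)"
  by (simp add: L2_inner_def L2_norm_square complex_norm_square[symmetric] flip: of_real_power)

lemma L2_inner_add_left:
  "f \<in> L2 \<Longrightarrow> f' \<in> L2 \<Longrightarrow> g \<in> L2 \<Longrightarrow> L2_inner (\<lambda>x. f x + f' x) g = L2_inner f g + L2_inner f' g"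
  by (simp add: L2_inner_def ring_distribs L2_inner_integrable)

lemma L2_inner_diff_left:
  "f \<in> L2 \<Longrightarrow> f' \<in> L2 \<Longrightarrow> g \<in> L2 \<Longrightarrow> L2_inner (\<lambda>x. f x - f' x) g = L2_inner f g - L2_inner f' g"
  by (simp add: L2_inner_def left_diff_distrib L2_inner_integrable)

lemma L2_inner_cmult_left: "L2_inner (\<lambda>x. z * f x) g = z * L2_inner f g"
  by (simp add: L2_inner_def mult.assoc)

lemma L2_inner_sum_left:
  assumes "\<And>k. k \<in> F \<Longrightarrow> u k \<in> L2" "g \<in> L2"
  shows "L2_inner (\<lambda>x. \<Sum>k\<in>F. z k * u k x) g = (\<Sum>k\<in>F. z k * L2_inner (u k) g)"
  using assms(1)
proof (induction F rule: infinite_finite_induct)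
  case (insert k F)
  then have "L2_inner (\<lambda>x. z k * u k x + (\<Sum>k\<in>F. z k * u k x)) g
    = z k * L2_inner (u k) g + (\<Sum>k\<in>F. z k * L2_inner (u k) g)"
    using assms(2) by (subst L2_inner_add_left) (auto intro!: L2_cmult L2_sum simp: L2_inner_cmult_left)
  with insert show ?case by simp
qed (auto simp: L2_inner_def)

lemma L2_inner_cnj: "L2_inner g f = cnj (L2_inner f g)"
  unfolding L2_inner_def by (simp add: mult.commute flip: Bochner_Integration.integral_cnj)

lemma L2_norm_cmult: "L2_norm (\<lambda>x. z * f x) = norm z * L2_norm f"
  by (simp add: L2_norm_def norm_mult power_mult_distrib real_sqrt_mult)

lemma L2_norm_cong_AE:
  assumes "f \<in> borel_measurable borel" "g \<in> borel_measurable borel" "AE x in lborel. f x = g x"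
  shows "L2_norm f = L2_norm g"
  unfolding L2_norm_def
  by (rule arg_cong[where f = sqrt], rule integral_cong_AE) (use assms in auto)

lemma L2_norm_eq_0_iff:
  assumes "f \<in> L2" shows "L2_norm f = 0 \<longleftrightarrow> (AE x in lborel. f x = 0)"
  using integral_nonneg_eq_0_iff_AE[OF L2_integrable[OF assms]] by (simp add: L2_norm_def)

lemma L2_Cauchy_Schwarz_abs:
  assumes "f \<in> L2" "g \<in> L2"
  shows "(LINT x|lborel. norm (f x) * norm (g x)) \<le> L2_norm f * L2_norm g"
proof (cases "L2_norm f = 0 \<or> L2_norm g = 0")
  case True
  then have "(LINT x|lborel. norm (f x) * norm (g x)) = integral\<^sup>L lborel (\<lambda>x::real. 0)"
    using assms L2_measurable by (intro integral_cong_AE) (auto simp: L2_norm_eq_0_iff)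
  with True show ?thesis by auto
next
  case False
  define p q where "p = L2_norm f" and "q = L2_norm g"
  have pq: "p > 0" "q > 0"
    using False L2_norm_nonneg[of f] L2_norm_nonneg[of g] by (auto simp: p_def q_def simp del: L2_norm_nonneg)
  \<comment> \<open>Arithmetic-geometric mean with weights balanced by the norms \<open>p\<close>
    and \<open>q\<close>: each of the two terms integrates to \<open>p * q / 2\<close>.\<close>
  have "(LINT x|lborel. norm (f x) * norm (g x))
     \<le> (LINT x|lborel. q / (2 * p) * (norm (f x))\<^sup>2 + p / (2 * q) * (norm (g x))\<^sup>2)"
  proof (rule integral_mono)
    show "integrable lborel (\<lambda>x. norm (f x) * norm (g x))"
      using integrable_norm[OF L2_integrable_mult[OF assms]] by (simp add: norm_mult)
    show "integrable lborel (\<lambda>x. q / (2 * p) * (norm (f x))\<^sup>2 + p / (2 * q) * (norm (g x))\<^sup>2)"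
      using assms L2_integrable by auto
    fix x
    have "2 * (q * norm (f x)) * (p * norm (g x)) \<le> (q * norm (f x))\<^sup>2 + (p * norm (g x))\<^sup>2"
      by (rule sum_squares_bound)
    then show "norm (f x) * norm (g x) \<le> q / (2 * p) * (norm (f x))\<^sup>2 + p / (2 * q) * (norm (g x))\<^sup>2"
      using pq by (simp add: field_simps power2_eq_square)
  qed
  also have "\<dots> = q / (2 * p) * p\<^sup>2 + p / (2 * q) * q\<^sup>2"
    using assms L2_integrable by (auto simp: p_def q_def L2_norm_square)
  also have "\<dots> = p * q"
    using pq by (simp add: field_simps power2_eq_square)
  finally show ?thesis by (simp add: p_def q_def)
qed

lemma L2_triangle:
  assumes "f \<in> L2" "g \<in> L2"
  shows "L2_norm (\<lambda>x. f x + g x) \<le> L2_norm f + L2_norm g"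
proof -
  have i: "integrable lborel (\<lambda>x. norm (f x) * norm (g x))"
    using integrable_norm[OF L2_integrable_mult[OF assms]] by (simp add: norm_mult)
  have "(L2_norm (\<lambda>x. f x + g x))\<^sup>2
    \<le> (LINT x|lborel. (norm (f x))\<^sup>2 + (norm (g x))\<^sup>2 + 2 * (norm (f x) * norm (g x)))"
    unfolding L2_norm_square
  proof (rule integral_mono)
    show "integrable lborel (\<lambda>x. (norm (f x + g x))\<^sup>2)"
      by (intro L2_integrable L2_add assms)
    show "integrable lborel (\<lambda>x. (norm (f x))\<^sup>2 + (norm (g x))\<^sup>2 + 2 * (norm (f x) * norm (g x)))"
      using i assms L2_integrable by auto
    fix x
    have "(norm (f x + g x))\<^sup>2 \<le> (norm (f x) + norm (g x))\<^sup>2"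
      by (intro power_mono norm_triangle_ineq) auto
    then show "(norm (f x + g x))\<^sup>2 \<le> (norm (f x))\<^sup>2 + (norm (g x))\<^sup>2 + 2 * (norm (f x) * norm (g x))"
      by (simp add: power2_sum)
  qed
  also have "\<dots> = (L2_norm f)\<^sup>2 + (L2_norm g)\<^sup>2 + 2 * (LINT x|lborel. norm (f x) * norm (g x))"
    using i assms L2_integrable by (auto simp: L2_norm_square)
  also have "\<dots> \<le> (L2_norm f + L2_norm g)\<^sup>2"
    using L2_Cauchy_Schwarz_abs[OF assms] by (simp add: power2_sum)
  finally show ?thesis
    by (rule power2_le_imp_le) simp
qed

lemma L2_triangle_diff:
  assumes "f \<in> L2" "g \<in> L2" "k \<in> L2"
  shows "L2_norm (\<lambda>x. f x - k x) \<le> L2_norm (\<lambda>x. f x - g x) + L2_norm (\<lambda>x. g x - k x)"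
  using L2_triangle[OF L2_diff[OF assms(1,2)] L2_diff[OF assms(2,3)]] by simp

lemma L2_norm_diff_ineq:
  assumes "f \<in> L2" "g \<in> L2"
  shows "\<bar>L2_norm f - L2_norm g\<bar> \<le> L2_norm (\<lambda>x. f x - g x)"
  using L2_triangle_diff[of f g "\<lambda>x. 0"] L2_triangle_diff[of g f "\<lambda>x. 0"] assms
  by (simp add: L2_norm_minus_commute[of g f])

lemma L2_norm_tendsto:
  assumes "\<And>n. F n \<in> L2" "f \<in> L2" "((\<lambda>n. L2_norm (\<lambda>x. f x - F n x)) \<longlongrightarrow> 0) net"
  shows "((\<lambda>n. L2_norm (F n)) \<longlongrightarrow> L2_norm f) net"
proof -
  have "((\<lambda>n. L2_norm (F n) - L2_norm f) \<longlongrightarrow> 0) net"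
    by (rule Lim_null_comparison[OF _ assms(3)])
      (use L2_norm_diff_ineq[OF assms(1,2)] in \<open>auto simp: L2_norm_minus_commute\<close>)
  then show ?thesis by (simp add: LIM_zero_iff)
qed

lemma L2_norm_tendsto_dominated:
  assumes "\<And>n::nat. f n \<in> borel_measurable borel" "g \<in> L2"
    "AE x in lborel. (\<lambda>n. f n x) \<longlonglongrightarrow> 0" "\<And>n. AE x in lborel. norm (f n x) \<le> norm (g x)"
  shows "(\<lambda>n. L2_norm (f n)) \<longlonglongrightarrow> 0"
proof -
  have "(\<lambda>n. LINT x|lborel. (norm (f n x))\<^sup>2) \<longlonglongrightarrow> integral\<^sup>L lborel (\<lambda>x::real. 0::real)"
  proof (rule integral_dominated_convergence)
    show "integrable lborel (\<lambda>x. (norm (g x))\<^sup>2)"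
      by (rule L2_integrable) fact
    show "AE x in lborel. (\<lambda>n. (norm (f n x))\<^sup>2) \<longlonglongrightarrow> 0"
      using assms(3)
    proof eventually_elim
      case (elim x)
      then have "(\<lambda>n. norm (f n x)) \<longlonglongrightarrow> 0" by (rule tendsto_norm_zero)
      then have "(\<lambda>n. (norm (f n x))\<^sup>2) \<longlonglongrightarrow> 0\<^sup>2" by (rule tendsto_power)
      then show ?case by simp
    qed
    show "AE x in lborel. norm ((norm (f n x))\<^sup>2) \<le> (norm (g x))\<^sup>2" for n
      using assms(4)[of n] by eventually_elim (simp add: power_mono)
  qed (use assms in auto)
  then have "(\<lambda>n. sqrt (LINT x|lborel. (norm (f n x))\<^sup>2)) \<longlonglongrightarrow> sqrt 0"
    by (intro tendsto_real_sqrt) simp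
  then show ?thesis by (simp add: L2_norm_def)
qed

text \<open>Expanding the squared norm of \<open>f + z * g\<close> and letting \<open>z\<close> run
  through the fourth roots of unity isolates the inner product. This upgrades norm identities for
  all combinations \<open>f + z * g\<close> to identities of inner products; the differences are
  written with \<open>(- 1) * g x\<close> to fit that shape.\<close>

lemma L2_polarization:
  assumes "f \<in> L2" "g \<in> L2"
  shows "4 * L2_inner f g
    = of_real ((L2_norm (\<lambda>x. f x + g x))\<^sup>2 - (L2_norm (\<lambda>x. f x + (- 1) * g x))\<^sup>2)
      + \<i> * of_real ((L2_norm (\<lambda>x. f x + \<i> * g x))\<^sup>2 - (L2_norm (\<lambda>x. f x + (- \<i>) * g x))\<^sup>2)"
proof -
  have *: "of_real ((L2_norm (\<lambda>x. f x + z * g x))\<^sup>2)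
    = L2_inner f f + z * cnj z * L2_inner g g + cnj z * L2_inner f g + z * cnj (L2_inner f g)" for z
  proof -
    let ?s = "\<lambda>x. f x + z * g x"
    have s: "?s \<in> L2" by (intro L2_add L2_cmult assms)
    have 1: "L2_inner k ?s = L2_inner k f + cnj z * L2_inner k g" if "k \<in> L2" for k
    proof -
      have "L2_inner k ?s = cnj (L2_inner ?s k)" by (rule L2_inner_cnj)
      also have "\<dots> = cnj (L2_inner f k) + cnj z * cnj (L2_inner g k)"
        using assms that by (simp add: L2_inner_add_left L2_cmult L2_inner_cmult_left)
      finally show ?thesis by (simp flip: L2_inner_cnj)
    qed
    have "of_real ((L2_norm ?s)\<^sup>2) = L2_inner f ?s + z * L2_inner g ?s"
      using assms s unfolding L2_inner_self[symmetric]
      by (subst L2_inner_add_left) (auto intro: L2_cmult simp: L2_inner_cmult_left)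
    also have "\<dots> = L2_inner f f + z * cnj z * L2_inner g g + cnj z * L2_inner f g + z * L2_inner g f"
      using 1 assms by (simp add: algebra_simps)
    finally show ?thesis by (simp flip: L2_inner_cnj)
  qed
  have 1: "of_real ((L2_norm (\<lambda>x. f x + g x))\<^sup>2)
    = L2_inner f f + L2_inner g g + L2_inner f g + cnj (L2_inner f g)"
    using *[of 1] by simp
  show ?thesis
    unfolding of_real_diff 1 * by (simp add: algebra_simps)
qed

lemma translate_in_L2:
  assumes "f \<in> L2" shows "translate t f \<in> L2"
proof (rule L2I)
  show "integrable lborel (\<lambda>x. (norm (translate t f x))\<^sup>2)"
    using lborel_integrable_real_affine[OF L2_integrable[OF assms], of 1 "- t"]
    by (simp add: translate_def)
qed (use L2_measurable[OF assms] in \<open>simp add: translate_def\<close>)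

lemma L2_norm_translate: "L2_norm (translate t f) = L2_norm f"
  using lborel_integral_real_affine[of 1 "\<lambda>x. (norm (f x))\<^sup>2" "- t"]
  by (simp add: L2_norm_def translate_def)

section \<open>Norm bounds from nonnegative integrals, and completeness\<close>

lemma L2_nn_norm_square:
  assumes "f \<in> L2"
  shows "(\<integral>\<^sup>+x. ennreal ((norm (f x))\<^sup>2) \<partial>lborel) = ennreal ((L2_norm f)\<^sup>2)"
  unfolding L2_norm_square
  by (rule nn_integral_eq_integral) (use L2_integrable[OF assms] in auto)

lemma L2_I_nn_integral:
  assumes "f \<in> borel_measurable borel" "(\<integral>\<^sup>+x. ennreal ((norm (f x))\<^sup>2) \<partial>lborel) \<le> ennreal (C\<^sup>2)" "0 \<le> C"
  shows "f \<in> L2" "L2_norm f \<le> C"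
proof -
  show f: "f \<in> L2"
  proof (rule L2I)
    show "integrable lborel (\<lambda>x. (norm (f x))\<^sup>2)"
      using assms by (intro integrableI_bounded) (auto simp: order.strict_trans1 top.not_eq_extremum)
  qed fact
  have "ennreal ((L2_norm f)\<^sup>2) \<le> ennreal (C\<^sup>2)"
    using assms(2) L2_nn_norm_square[OF f] by simp
  then show "L2_norm f \<le> C"
    using assms(3) by (simp add: power2_le_iff_abs_le)
qed

text \<open>Riesz-Fischer. A subsequence with rapidly decreasing differences converges almost
  everywhere, and Fatou's lemma makes the pointwise limit the norm limit of the whole sequence.
  Completeness is what makes the limit in the definition of \<open>fourier_L2\<close> exist.\<close>

lemma L2_complete:
  assumes F: "\<And>n::nat. F n \<in> L2"
    and Cauchy: "\<And>e. e > 0 \<Longrightarrow> \<exists>M. \<forall>m\<ge>M. \<forall>n\<ge>M. L2_norm (\<lambda>x. F m x - F n x) < e"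
  obtains f where "f \<in> L2" "(\<lambda>n. L2_norm (\<lambda>x. f x - F n x)) \<longlonglongrightarrow> 0"
proof -
  have "\<exists>M. \<forall>m\<ge>M. \<forall>n\<ge>M. L2_norm (\<lambda>x. F m x - F n x) < (1/2) ^ k" for k :: nat
    by (rule Cauchy) simp
  then obtain M where M: "\<And>k m n. m \<ge> M k \<Longrightarrow> n \<ge> M k \<Longrightarrow> L2_norm (\<lambda>x. F m x - F n x) < (1/2) ^ k"
    by metis
  \<comment> \<open>The partial sums of \<open>M\<close> lie above \<open>M k\<close> both at
    \<open>k\<close> and at \<open>Suc k\<close>, so consecutive members of the subsequence are
    within \<open>(1/2) ^ k\<close>; the summand \<open>k\<close> forces
    \<open>r k \<ge> k\<close>.\<close>
  define r where "r k = (\<Sum>i\<le>k. M i) + k" for k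
  have r_ge: "r k \<ge> M k" "r (Suc k) \<ge> M k" for k
    by (auto simp: r_def intro!: le_SucI trans_le_add1 member_le_sum)
  have r_lim: "r k \<ge> k" for k
    by (simp add: r_def)
  define G where "G k = F (r k)" for k
  define d where "d k x = G (Suc k) x - G k x" for k x
  have [measurable]: "F n \<in> borel_measurable borel" for n
    using F L2_measurable by blast
  have [measurable]: "G n \<in> borel_measurable borel" "d n \<in> borel_measurable borel" for n
    unfolding G_def d_def by auto
  have dL2: "d k \<in> L2" and dn: "L2_norm (d k) \<le> (1/2) ^ k" for k
    unfolding d_def G_def using M[OF r_ge(2,1)] by (auto intro!: L2_diff F simp: less_imp_le)
  \<comment> \<open>The squared norm of \<open>d k\<close> is at most the square of
    \<open>(1/2) ^ k\<close>, which leaves room for the weight \<open>2 ^ k\<close>. The weight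
    later yields summability of \<open>d k x\<close> itself from that of its squares.\<close>
  have "(\<integral>\<^sup>+x. (\<Sum>k. ennreal (2 ^ k * (norm (d k x))\<^sup>2)) \<partial>lborel)
    = (\<Sum>k. \<integral>\<^sup>+x. ennreal (2 ^ k * (norm (d k x))\<^sup>2) \<partial>lborel)"
    by (rule nn_integral_suminf) simp
  also have "\<dots> \<le> (\<Sum>k. ennreal ((1/2) ^ k))"
  proof (intro suminf_le)
    fix k
    have "(\<integral>\<^sup>+x. ennreal (2 ^ k * (norm (d k x))\<^sup>2) \<partial>lborel) = ennreal (2 ^ k * (L2_norm (d k))\<^sup>2)"
      using L2_nn_norm_square[OF dL2[of k]] by (simp add: ennreal_mult' nn_integral_cmult)
    also have "\<dots> \<le> ennreal (2 ^ k * ((1/2) ^ k)\<^sup>2)"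
      by (intro ennreal_leI mult_left_mono power_mono dn) auto
    also have "2 ^ k * ((1/2) ^ k)\<^sup>2 = ((1/2) ^ k :: real)"
      by (simp add: power2_eq_square power_mult_distrib[symmetric] flip: mult.assoc)
    finally show "(\<integral>\<^sup>+x. ennreal (2 ^ k * (norm (d k x))\<^sup>2) \<partial>lborel) \<le> ennreal ((1/2) ^ k)" .
  qed auto
  also have "\<dots> < \<infinity>"
    by (subst suminf_ennreal2) auto
  finally have "AE x in lborel. (\<Sum>k. ennreal (2 ^ k * (norm (d k x))\<^sup>2)) \<noteq> \<infinity>"
    by (intro nn_integral_noteq_infinite) auto
  then have conv: "AE x in lborel. convergent (\<lambda>k. G k x)"
  proof eventually_elim
    case (elim x)
    then have s: "summable (\<lambda>k. 2 ^ k * (norm (d k x))\<^sup>2)"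
      by (intro summable_suminf_not_top) auto
    have "summable (\<lambda>k. d k x)"
    proof (rule summable_comparison_test')
      show "summable (\<lambda>k. 2 ^ k * (norm (d k x))\<^sup>2 + (1/2) ^ k)"
        by (intro summable_add s summable_geometric) auto
      fix k
      \<comment> \<open>Applied to \<open>2 ^ k * norm (d k x)\<close> and divided by
        \<open>2 ^ k\<close>, this dominates \<open>norm (d k x)\<close> by the weighted square plus
        a geometric term.\<close>
      have "y \<le> y\<^sup>2 + 1" if "0 \<le> y" for y :: real
        using sum_squares_bound[of y 1] that by simp
      from this[of "2 ^ k * norm (d k x)"]
      have "2 ^ k * norm (d k x) \<le> (2 ^ k * norm (d k x))\<^sup>2 + 1"
        by simp
      then show "norm (d k x) \<le> 2 ^ k * (norm (d k x))\<^sup>2 + (1/2) ^ k"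
        by (simp add: field_simps power2_eq_square)
    qed
    then have "convergent (\<lambda>n. \<Sum>k<n. d k x)"
      by (simp add: summable_iff_convergent)
    moreover have "(\<Sum>k<n. d k x) = G n x - G 0 x" for n
      unfolding d_def by (rule sum_lessThan_telescope)
    ultimately have "convergent (\<lambda>n. G n x - G 0 x)" by simp
    then show ?case
      using convergent_add[OF _ convergent_const[of "G 0 x"]] by fastforce
  qed
  define f where "f x = lim (\<lambda>k. G k x)" for x
  have fm [measurable]: "f \<in> borel_measurable borel"
    unfolding f_def by measurable
  have lim: "AE x in lborel. (\<lambda>k. G k x) \<longlonglongrightarrow> f x"
    using conv by eventually_elim (simp add: f_def convergent_LIMSEQ_iff)
  \<comment> \<open>Fatou along the subsequence: for fixed \<open>n\<close> the norm of
    \<open>f - F n\<close> is controlled by the norms of \<open>G k - F n\<close>, which are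
    eventually below \<open>e\<close>.\<close>
  have *: "(\<lambda>x. f x - F n x) \<in> L2 \<and> L2_norm (\<lambda>x. f x - F n x) \<le> e"
    if "e > 0" and M: "\<And>m. m \<ge> M \<Longrightarrow> L2_norm (\<lambda>x. F m x - F n x) < e" for e M n
  proof -
    have "(\<integral>\<^sup>+x. ennreal ((norm (f x - F n x))\<^sup>2) \<partial>lborel)
      = (\<integral>\<^sup>+x. liminf (\<lambda>k. ennreal ((norm (G k x - F n x))\<^sup>2)) \<partial>lborel)"
    proof (rule nn_integral_cong_AE)
      show "AE x in lborel. ennreal ((norm (f x - F n x))\<^sup>2) = liminf (\<lambda>k. ennreal ((norm (G k x - F n x))\<^sup>2))"
        using lim
      proof eventually_elim
        case (elim x)
        then have "(\<lambda>k. ennreal ((norm (G k x - F n x))\<^sup>2)) \<longlonglongrightarrow> ennreal ((norm (f x - F n x))\<^sup>2)"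
          by (intro tendsto_ennrealI tendsto_intros)
        then show ?case by (intro lim_imp_Liminf[symmetric]) auto
      qed
    qed
    also have "\<dots> \<le> liminf (\<lambda>k. \<integral>\<^sup>+x. ennreal ((norm (G k x - F n x))\<^sup>2) \<partial>lborel)"
      by (rule nn_integral_liminf) simp
    also have "\<dots> \<le> liminf (\<lambda>k. ennreal (e\<^sup>2))"
    proof (rule Liminf_mono)
      show "\<forall>\<^sub>F k in sequentially. (\<integral>\<^sup>+x. ennreal ((norm (G k x - F n x))\<^sup>2) \<partial>lborel) \<le> ennreal (e\<^sup>2)"
        using eventually_ge_at_top[of M]
      proof eventually_elim
        case (elim k)
        then have "L2_norm (\<lambda>x. G k x - F n x) < e"
          unfolding G_def using r_lim[of k] by (intro M) simp
        moreover have "(\<integral>\<^sup>+x. ennreal ((norm (G k x - F n x))\<^sup>2) \<partial>lborel)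
          = ennreal ((L2_norm (\<lambda>x. G k x - F n x))\<^sup>2)"
          unfolding G_def by (rule L2_nn_norm_square) (intro L2_diff F)
        ultimately show ?case by (auto intro!: ennreal_leI power_mono)
      qed
    qed
    also have "\<dots> = ennreal (e\<^sup>2)"
      by (simp add: Liminf_const)
    finally show ?thesis
      using L2_I_nn_integral[of "\<lambda>x. f x - F n x" e] \<open>e > 0\<close> by simp
  qed
  have lim0: "(\<lambda>n. L2_norm (\<lambda>x. f x - F n x)) \<longlonglongrightarrow> 0"
  proof (rule LIMSEQ_I)
    fix e :: real assume "e > 0"
    then obtain M where "\<And>m n. m \<ge> M \<Longrightarrow> n \<ge> M \<Longrightarrow> L2_norm (\<lambda>x. F m x - F n x) < e / 2"
      using Cauchy[of "e / 2"] by auto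
    with *[of "e / 2" M] \<open>e > 0\<close> show "\<exists>no. \<forall>n\<ge>no. norm (L2_norm (\<lambda>x. f x - F n x) - 0) < e"
      by (intro exI[of _ M]) fastforce
  qed
  obtain M where "\<And>m n. m \<ge> M \<Longrightarrow> n \<ge> M \<Longrightarrow> L2_norm (\<lambda>x. F m x - F n x) < 1"
    using Cauchy[of 1] by auto
  with *[of 1 M M] have "(\<lambda>x. f x - F M x) \<in> L2" by auto
  from L2_add[OF this F[of M]] have "f \<in> L2" by simp
  with lim0 show ?thesis by (rule that[rotated])
qed

section \<open>Trigonometric polynomials and orthonormal systems\<close>

text \<open>Completing the square in the coefficients. If the \<open>z k\<close> are the inner
  products, the last sum vanishes and Bessel's inequality results; for any other \<open>z\<close>
  the formula says that the inner products give the best approximation.\<close>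

lemma L2_dist_square_orthonormal:
  assumes "f \<in> L2" "\<And>k. E k \<in> L2" "\<And>j k. L2_inner (E j) (E k) = (if j = k then 1 else 0)" "finite F"
  shows "(L2_norm (\<lambda>x. f x - (\<Sum>k\<in>F. z k * E k x)))\<^sup>2
    = (L2_norm f)\<^sup>2 - (\<Sum>k\<in>F. (norm (L2_inner f (E k)))\<^sup>2) + (\<Sum>k\<in>F. (norm (z k - L2_inner f (E k)))\<^sup>2)"
proof -
  let ?c = "\<lambda>k. L2_inner f (E k)" and ?s = "\<lambda>x. \<Sum>k\<in>F. z k * E k x"
  have s: "?s \<in> L2" by (intro L2_sum assms)
  have sE: "L2_inner ?s (E j) = z j" if "j \<in> F" for j
  proof -
    have "L2_inner ?s (E j) = (\<Sum>k\<in>F. z k * L2_inner (E k) (E j))"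
      by (rule L2_inner_sum_left) (use assms in auto)
    also have "\<dots> = (\<Sum>k\<in>F. if k = j then z k else 0)"
      by (rule sum.cong[OF refl]) (simp add: assms(3))
    finally show ?thesis using that assms(4) by simp
  qed
  have sg: "L2_inner g ?s = (\<Sum>k\<in>F. cnj (z k) * L2_inner g (E k))" if "g \<in> L2" for g
    using assms that by (subst L2_inner_cnj, subst L2_inner_sum_left) (auto simp flip: L2_inner_cnj)
  let ?r = "\<lambda>x. f x - ?s x"
  have r: "?r \<in> L2" by (intro L2_diff s assms)
  have rg: "L2_inner ?r g = L2_inner f g - L2_inner ?s g" if "g \<in> L2" for g
    by (rule L2_inner_diff_left) (use assms s that in auto)
  have "of_real ((L2_norm ?r)\<^sup>2) = L2_inner ?r ?r"
    by (simp add: L2_inner_self)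
  also have "\<dots> = L2_inner f ?r - L2_inner ?s ?r"
    by (rule rg[OF r])
  also have "\<dots> = cnj (L2_inner ?r f) - cnj (L2_inner ?r ?s)"
    by (simp flip: L2_inner_cnj)
  also have "\<dots> = cnj (L2_inner f f - cnj (L2_inner f ?s)) - cnj (L2_inner f ?s - L2_inner ?s ?s)"
    unfolding rg[OF assms(1)] rg[OF s] by (simp flip: L2_inner_cnj)
  also have "\<dots> = cnj (L2_inner f f) - (\<Sum>k\<in>F. cnj (z k) * ?c k) - cnj (\<Sum>k\<in>F. cnj (z k) * ?c k)
      + cnj (\<Sum>k\<in>F. cnj (z k) * z k)"
    unfolding sg[OF assms(1)] sg[OF s] using sE by (simp add: algebra_simps)
  also have "\<dots> = of_real ((L2_norm f)\<^sup>2) - (\<Sum>k\<in>F. cnj (z k) * ?c k + z k * cnj (?c k) - z k * cnj (z k))"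
    by (simp add: L2_inner_self sum.distrib sum_subtractf algebra_simps)
  also have "(\<Sum>k\<in>F. cnj (z k) * ?c k + z k * cnj (?c k) - z k * cnj (z k))
    = (\<Sum>k\<in>F. ?c k * cnj (?c k) - (z k - ?c k) * cnj (z k - ?c k))"
    by (rule sum.cong) (auto simp: algebra_simps)
  also have "\<dots> = of_real (\<Sum>k\<in>F. (norm (?c k))\<^sup>2 - (norm (z k - ?c k))\<^sup>2)"
    unfolding of_real_sum of_real_diff complex_norm_square ..
  finally have "of_real ((L2_norm ?r)\<^sup>2)
    = (of_real ((L2_norm f)\<^sup>2 - (\<Sum>k\<in>F. (norm (?c k))\<^sup>2 - (norm (z k - ?c k))\<^sup>2)) :: complex)"
    by (simp only: of_real_diff)
  then show ?thesis
    unfolding of_real_eq_iff by (simp add: sum_subtractf)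
qed

text \<open>The partial sums increase with the index set and stay below the squared norm by Bessel;
  one good approximation, with arbitrary coefficients \<open>z\<close>, shows that they come close
  to it.\<close>

lemma Parseval_of_dense:
  assumes "f \<in> L2" "\<And>k. E k \<in> L2" "\<And>j k. L2_inner (E j) (E k) = (if j = k then 1 else 0)"
    and dense: "\<And>e. e > 0 \<Longrightarrow> \<exists>F z. finite F \<and> L2_norm (\<lambda>x. f x - (\<Sum>k\<in>F. z k * E k x)) < e"
  shows "((\<lambda>k. (norm (L2_inner f (E k)))\<^sup>2) has_sum (L2_norm f)\<^sup>2) UNIV"
  unfolding has_sum_def tendsto_iff eventually_finite_subsets_at_top
proof (intro allI impI)
  fix e :: real assume "e > 0"
  then obtain F z where F: "finite F" and Fz: "L2_norm (\<lambda>x. f x - (\<Sum>k\<in>F. z k * E k x)) < sqrt e"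
    using dense[of "sqrt e"] by auto
  let ?S = "\<lambda>F. \<Sum>k\<in>F. (norm (L2_inner f (E k)))\<^sup>2"
  have "(L2_norm (\<lambda>x. f x - (\<Sum>k\<in>F. z k * E k x)))\<^sup>2 < (sqrt e)\<^sup>2"
    by (intro power_strict_mono Fz) auto
  moreover have "(\<Sum>k\<in>F. (norm (z k - L2_inner f (E k)))\<^sup>2) \<ge> 0"
    by (simp add: sum_nonneg)
  ultimately have lower: "(L2_norm f)\<^sup>2 - ?S F < e"
    using L2_dist_square_orthonormal[OF assms(1-3) F, of z] \<open>e > 0\<close> by simp
  show "\<exists>X. finite X \<and> X \<subseteq> UNIV \<and> (\<forall>Y. finite Y \<and> X \<subseteq> Y \<and> Y \<subseteq> UNIV \<longrightarrow> dist (?S Y) ((L2_norm f)\<^sup>2) < e)"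
  proof (intro exI[of _ F] conjI allI impI F)
    fix Y assume Y: "finite Y \<and> F \<subseteq> Y \<and> Y \<subseteq> UNIV"
    then have "?S F \<le> ?S Y" by (intro sum_mono2) auto
    moreover have "?S Y \<le> (L2_norm f)\<^sup>2"
      using L2_dist_square_orthonormal[OF assms(1-3), of Y "\<lambda>k. L2_inner f (E k)"] Y
        zero_le_power2[of "L2_norm (\<lambda>x. f x - (\<Sum>k\<in>Y. L2_inner f (E k) * E k x))"] by simp
    ultimately show "dist (?S Y) ((L2_norm f)\<^sup>2) < e"
      using lower by (simp add: dist_real_def)
  qed auto
qed

text \<open>The inductive form makes closure under products a double induction; a finite family of
  coefficients is recovered by \<open>trig_poly_coeffs\<close>.\<close>

inductive trig_poly :: "(real \<Rightarrow> complex) \<Rightarrow> bool" where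
  monom: "trig_poly (\<lambda>x. z * cis (2 * pi * of_int k * x))"
| add: "trig_poly p \<Longrightarrow> trig_poly q \<Longrightarrow> trig_poly (\<lambda>x. p x + q x)"

lemma trig_poly_mult:
  assumes "trig_poly p" "trig_poly q" shows "trig_poly (\<lambda>x. p x * q x)"
  using assms(1)
proof induction
  case (monom z k)
  from assms(2) show ?case
  proof induction
    case (monom w l)
    have "(\<lambda>x. z * cis (2 * pi * of_int k * x) * (w * cis (2 * pi * of_int l * x)))
      = (\<lambda>x. z * w * cis (2 * pi * of_int (k + l) * x))"
      by (auto simp: algebra_simps simp flip: cis_mult)
    then show ?case by (simp only: trig_poly.monom)
  next
    case (add p q)
    then show ?case by (simp add: ring_distribs trig_poly.add)
  qed
next
  case (add p q)
  then show ?case by (simp add: ring_distribs trig_poly.add)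
qed

lemma trig_poly_const: "trig_poly (\<lambda>x. z)"
  using trig_poly.monom[of z 0] by simp

lemma trig_poly_cmult: "trig_poly p \<Longrightarrow> trig_poly (\<lambda>x. z * p x)"
  by (intro trig_poly_mult trig_poly_const)

lemma trig_poly_cos: "trig_poly (\<lambda>x. of_real (cos (2 * pi * x)))"
proof -
  have "(\<lambda>x. of_real (cos (2 * pi * x))) =
    (\<lambda>x. 1/2 * cis (2 * pi * of_int 1 * x) + 1/2 * cis (2 * pi * of_int (- 1) * x))"
    by (auto simp: complex_eq_iff)
  then show ?thesis by (simp only: trig_poly.intros)
qed

lemma trig_poly_sin: "trig_poly (\<lambda>x. of_real (sin (2 * pi * x)))"
proof -
  have "(\<lambda>x. of_real (sin (2 * pi * x))) =
    (\<lambda>x. - \<i>/2 * cis (2 * pi * of_int 1 * x) + \<i>/2 * cis (2 * pi * of_int (- 1) * x))"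
    by (auto simp: complex_eq_iff)
  then show ?thesis by (simp only: trig_poly.intros)
qed

text \<open>A real-linear functional on the complex plane is determined by its values at 1 and
  \<open>\<i>\<close>, so on the unit circle it is a combination of cosine and sine. This links the
  real polynomials of Stone-Weierstrass to exponentials.\<close>

lemma trig_poly_real_polynomial_function:
  assumes "real_polynomial_function q"
  shows "trig_poly (\<lambda>x. of_real (q (cis (2 * pi * x))))"
  using assms
proof induction
  case (linear f)
  have *: "f z = Re z * f 1 + Im z * f \<i>" for z
  proof -
    have "f z = f (Re z *\<^sub>R 1 + Im z *\<^sub>R \<i>)"
      by (rule arg_cong[where f = f]) (auto simp: complex_eq_iff)
    with linear show ?thesis
      by (simp only: bounded_linear.linear linear_add linear_scale real_scaleR_def)
  qed
  have "(\<lambda>x. complex_of_real (f (cis (2 * pi * x))))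
    = (\<lambda>x. of_real (f 1) * of_real (cos (2 * pi * x)) + of_real (f \<i>) * of_real (sin (2 * pi * x)))"
    by (rule ext, subst *) (simp add: mult.commute)
  then show ?case
    by (simp only: trig_poly.add trig_poly_cmult trig_poly_cos trig_poly_sin)
next
  case (const c)
  then show ?case by (rule trig_poly_const)
qed (simp_all add: trig_poly.add trig_poly_mult)

lemma trig_poly_coeffs:
  assumes "trig_poly p"
  shows "\<exists>F z. finite F \<and> (\<forall>x. p x = (\<Sum>k\<in>F. z k * cis (2 * pi * of_int k * x)))"
proof -
  \<comment> \<open>The vanishing of \<open>z\<close> off \<open>F\<close> is carried through the
    induction so that both summands can be rewritten over \<open>F \<union> F'\<close>.\<close>
  from assms have "\<exists>F z. finite F \<and> (\<forall>k. k \<notin> F \<longrightarrow> z k = 0)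
    \<and> (\<forall>x. p x = (\<Sum>k\<in>F. z k * cis (2 * pi * of_int k * x)))"
  proof induction
    case (monom w l)
    show ?case
      by (intro exI[of _ "{l}"] exI[of _ "\<lambda>k. if k = l then w else 0"]) auto
  next
    case (add p q)
    from add.IH(1) obtain F z where F: "finite F" "\<And>k. k \<notin> F \<Longrightarrow> z k = 0"
      and p: "\<And>x. p x = (\<Sum>k\<in>F. z k * cis (2 * pi * of_int k * x))"
      by blast
    from add.IH(2) obtain F' z' where F': "finite F'" "\<And>k. k \<notin> F' \<Longrightarrow> z' k = 0"
      and q: "\<And>x. q x = (\<Sum>k\<in>F'. z' k * cis (2 * pi * of_int k * x))"
      by blast
    have p': "p x = (\<Sum>k\<in>F \<union> F'. z k * cis (2 * pi * of_int k * x))" for x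
      unfolding p by (rule sum.mono_neutral_left) (use F F' in auto)
    have q': "q x = (\<Sum>k\<in>F \<union> F'. z' k * cis (2 * pi * of_int k * x))" for x
      unfolding q by (rule sum.mono_neutral_left) (use F F' in auto)
    show ?case
      by (intro exI[of _ "F \<union> F'"] exI[of _ "\<lambda>k. z k + z' k"])
        (use F F' in \<open>auto simp: p' q' sum.distrib ring_distribs\<close>)
  qed
  then show ?thesis by blast
qed

text \<open>The condition \<open>g 0 = g 1\<close> lets \<open>g\<close> descend to the circle,
  where Stone-Weierstrass applies.\<close>

lemma trig_poly_approx_real:
  fixes g :: "real \<Rightarrow> real"
  assumes "continuous_on {0..1} g" "g 0 = g 1" "e > 0"
  obtains p where "trig_poly p" "\<And>x. x \<in> {0..1} \<Longrightarrow> norm (of_real (g x) - p x) < e"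
proof -
  let ?G = "g \<circ> (\<lambda>z. Arg2pi z / (2 * pi))"
  \<comment> \<open>The reflexive homotopy is a device for obtaining continuity of the induced map
    on the circle, across the jump of \<open>Arg2pi\<close>.\<close>
  have "homotopic_loops UNIV g g"
    using assms by (simp add: homotopic_loops_refl path_def pathfinish_def pathstart_def)
  then have "continuous_on (sphere 0 1) ?G"
    using homotopic_loops_imp_homotopic_circlemaps homotopic_with_imp_continuous by blast
  from Stone_Weierstrass_real_polynomial_function[OF compact_sphere this assms(3)]
  obtain q where q: "real_polynomial_function q" "\<And>z. z \<in> sphere 0 1 \<Longrightarrow> \<bar>?G z - q z\<bar> < e"
    by blast
  show thesis
  proof
    show "trig_poly (\<lambda>x. of_real (q (cis (2 * pi * x))))"
      by (rule trig_poly_real_polynomial_function) fact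
    fix x :: real assume x: "x \<in> {0..1}"
    \<comment> \<open>\<open>Arg2pi\<close> takes values in a half-open period, so the point
      \<open>x = 1\<close> is read as 0 and relies on \<open>g 0 = g 1\<close>.\<close>
    have "?G (cis (2 * pi * x)) = g x"
    proof (cases "x = 1")
      case True
      then show ?thesis
        using Arg2pi_of_real[of 1] assms(2) by simp
    next
      case False
      with x have "Arg2pi (cis (2 * pi * x)) = 2 * pi * x"
        unfolding cis_conv_exp by (subst Arg2pi_exp) auto
      then show ?thesis by simp
    qed
    with q(2)[of "cis (2 * pi * x)"] have "\<bar>g x - q (cis (2 * pi * x))\<bar> < e"
      by simp
    then show "norm (of_real (g x) - of_real (q (cis (2 * pi * x))) :: complex) < e"
      by (simp flip: of_real_diff)
  qed
qed

lemma trig_poly_approx: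
  fixes g :: "real \<Rightarrow> complex"
  assumes "continuous_on {0..1} g" "g 0 = g 1" "e > 0"
  obtains p where "trig_poly p" "\<And>x. x \<in> {0..1} \<Longrightarrow> norm (g x - p x) < e"
proof -
  obtain p where p: "trig_poly p" "\<And>x. x \<in> {0..1} \<Longrightarrow> norm (of_real (Re (g x)) - p x) < e / 2"
    by (rule trig_poly_approx_real[of "\<lambda>x. Re (g x)" "e / 2"])
      (use assms in \<open>auto intro!: continuous_intros\<close>)
  obtain q where q: "trig_poly q" "\<And>x. x \<in> {0..1} \<Longrightarrow> norm (of_real (Im (g x)) - q x) < e / 2"
    by (rule trig_poly_approx_real[of "\<lambda>x. Im (g x)" "e / 2"])
      (use assms in \<open>auto intro!: continuous_intros\<close>)
  show thesis
  proof
    show "trig_poly (\<lambda>x. p x + \<i> * q x)"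
      by (intro trig_poly.add trig_poly_cmult p q)
    fix x :: real assume x: "x \<in> {0..1}"
    have "g x - (p x + \<i> * q x) = (of_real (Re (g x)) - p x) + \<i> * (of_real (Im (g x)) - q x)"
      by (simp add: complex_eq_iff)
    then have "norm (g x - (p x + \<i> * q x))
      \<le> norm (of_real (Re (g x)) - p x) + norm (\<i> * (of_real (Im (g x)) - q x))"
      by (metis norm_triangle_ineq)
    then show "norm (g x - (p x + \<i> * q x)) < e"
      using p(2)[OF x] q(2)[OF x] by (simp add: norm_mult)
  qed
qed

text \<open>Extension by zero lets \<open>L2_inner\<close> on the line serve as the inner product of
  the unit interval.\<close>

definition unit_exp :: "int \<Rightarrow> real \<Rightarrow> complex" where
  "unit_exp k x = indicator {0..1} x * cis (2 * pi * of_int k * x)"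

lemma borel_measurable_cis [measurable (raw)]:
  "f \<in> borel_measurable M \<Longrightarrow> (\<lambda>x. cis (f x)) \<in> borel_measurable M"
  by (rule measurable_compose[OF _ borel_measurable_continuous_onI]) (auto intro: continuous_intros)

lemma L2_indicator_const:
  fixes a b :: real assumes "a \<le> b" shows "(\<lambda>x. indicator {a..b} x * z) \<in> L2"
proof (rule L2I)
  have "(\<lambda>x. (norm (indicator {a..b} x * z))\<^sup>2) = (\<lambda>x. (norm z)\<^sup>2 * indicator {a..b} x)"
    by (auto simp: indicator_def norm_mult power_mult_distrib)
  then show "integrable lborel (\<lambda>x. (norm (indicator {a..b} x * z))\<^sup>2)"
    using assms by (simp add: integrable_real_indicator)
qed simp

lemma unit_exp_L2: "unit_exp k \<in> L2"
  by (rule L2_dominated[OF _ L2_indicator_const[of 0 1 1], where C = 1])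
    (auto simp: unit_exp_def [abs_def] norm_mult)

lemma unit_exp_inner: "L2_inner (unit_exp j) (unit_exp k) = (if j = k then 1 else 0)"
proof -
  define m where "m = j - k"
  have *: "unit_exp j x * cnj (unit_exp k x) = indicator {0..1} x *\<^sub>R cis (2 * pi * of_int m * x)" for x
    by (auto simp: unit_exp_def m_def indicator_def cis_cnj cis_mult algebra_simps)
  show ?thesis
  proof (cases "j = k")
    case True
    then show ?thesis
      unfolding L2_inner_def * by (simp add: m_def)
  next
    case False
    then have m: "m \<noteq> 0" by (simp add: m_def)
    let ?F = "\<lambda>x. cis (2 * pi * of_int m * x) / (2 * pi * of_int m * \<i>)"
    have "(LINT x|lborel. indicator {0..1} x *\<^sub>R cis (2 * pi * of_int m * x)) = ?F 1 - ?F 0"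
    proof (rule integral_FTC_atLeastAtMost)
      fix x :: real
      have "(?F has_vector_derivative cis (2 * pi * of_int m * x)) (at x)"
        unfolding has_vector_derivative_def
        by (rule derivative_eq_intros refl)+ (use m in \<open>auto simp: scaleR_conv_of_real fun_eq_iff field_simps\<close>)
      then show "(?F has_vector_derivative cis (2 * pi * of_int m * x)) (at x within {0..1})"
        by (rule has_vector_derivative_at_within)
    qed (auto intro!: continuous_intros)
    also have "\<dots> = 0"
      using cis_multiple_2pi[of "of_int m"] by simp
    finally show ?thesis
      using False unfolding L2_inner_def * by simp
  qed
qed

section \<open>Parseval's identity for exponential systems on an interval\<close>

text \<open>The closed span of the exponentials contains its limits. Used twice: to pass from
  continuous to bounded functions, and from bounded to arbitrary square-integrable ones.\<close>

lemma unit_exp_dense_limit: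
  assumes "f \<in> L2" and g: "\<And>n::nat. g n \<in> L2" "(\<lambda>n. L2_norm (\<lambda>x. f x - g n x)) \<longlonglongrightarrow> 0"
    and dense: "\<And>n e. e > 0 \<Longrightarrow> \<exists>F z. finite F \<and> L2_norm (\<lambda>x. g n x - (\<Sum>k\<in>F. z k * unit_exp k x)) < e"
    and "e > 0"
  shows "\<exists>F z. finite F \<and> L2_norm (\<lambda>x. f x - (\<Sum>k\<in>F. z k * unit_exp k x)) < e"
proof -
  have "\<forall>\<^sub>F n in sequentially. L2_norm (\<lambda>x. f x - g n x) < e / 2"
    by (rule order_tendstoD[OF g(2)]) (use \<open>e > 0\<close> in simp)
  then obtain n where n: "L2_norm (\<lambda>x. f x - g n x) < e / 2"
    by (auto simp: eventually_sequentially)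
  obtain F z where F: "finite F" "L2_norm (\<lambda>x. g n x - (\<Sum>k\<in>F. z k * unit_exp k x)) < e / 2"
    using dense[of "e / 2" n] \<open>e > 0\<close> by auto
  have "L2_norm (\<lambda>x. f x - (\<Sum>k\<in>F. z k * unit_exp k x)) < e"
    using L2_triangle_diff[OF assms(1) g(1)[of n] L2_sum[of F unit_exp z]] n F(2) unit_exp_L2 by fastforce
  with F(1) show ?thesis by blast
qed

text \<open>On an interval of length 1 a uniform error bounds the error in norm.\<close>

lemma unit_exp_dense_continuous:
  assumes "continuous_on {0..1} g" "g 0 = g 1" "e > 0"
  shows "\<exists>F z. finite F \<and> L2_norm (\<lambda>x. indicator {0..1} x * g x - (\<Sum>k\<in>F. z k * unit_exp k x)) < e"
proof -
  obtain p where p: "trig_poly p" "\<And>x. x \<in> {0..1} \<Longrightarrow> norm (g x - p x) < e / 2"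
    by (rule trig_poly_approx[of g "e / 2"]) (use assms in auto)
  obtain F z where F: "finite F" "\<And>x. p x = (\<Sum>k\<in>F. z k * cis (2 * pi * of_int k * x))"
    using trig_poly_coeffs[OF p(1)] by blast
  have sum: "(\<Sum>k\<in>F. z k * unit_exp k x) = indicator {0..1} x * p x" for x
    by (simp add: unit_exp_def F(2) sum_distrib_left mult.left_commute)
  have pm: "p \<in> borel_measurable borel"
    unfolding F(2) by measurable
  have gm: "(\<lambda>x. indicator {0..1} x * g x) \<in> borel_measurable borel"
    using borel_measurable_continuous_on_indicator[OF _ assms(1)] by (simp add: scaleR_conv_of_real of_real_indicator)
  have "L2_norm (\<lambda>x. indicator {0..1} x * g x - indicator {0..1} x * p x) \<le> e / 2 * L2_norm (\<lambda>x. indicator {0..1} x * 1)"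
  proof (rule L2_norm_dominated)
    show "(\<lambda>x. indicator {0..1} x * g x - indicator {0..1} x * p x) \<in> borel_measurable borel"
      by (intro borel_measurable_diff gm) (use pm in measurable)
    show "(\<lambda>x. indicator {0..1} x * 1) \<in> L2"
      by (rule L2_indicator_const) simp
    show "AE x in lborel. norm (indicator {0..1} x * g x - indicator {0..1} x * p x)
        \<le> e / 2 * norm (indicator {0..1} x * 1 :: complex)"
      using p(2) by (intro AE_I2) (auto simp: less_imp_le split: split_indicator)
  qed (use assms(3) in simp)
  also have "L2_norm (\<lambda>x. indicator {0..1} x * 1) = 1"
  proof -
    have "(\<lambda>x::real. (norm (indicator {0..1} x * 1 :: complex))\<^sup>2) = indicator {0..1}"
      by (auto simp: indicator_def)
    then show ?thesis by (simp add: L2_norm_def)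
  qed
  finally have "L2_norm (\<lambda>x. indicator {0..1} x * g x - (\<Sum>k\<in>F. z k * unit_exp k x)) < e"
    unfolding sum using assms(3) by simp
  with F(1) show ?thesis by blast
qed

text \<open>Measurability supplies continuous functions converging almost everywhere. Two continuous
  corrections follow: one restores the uniform bound, for dominated convergence, the other makes the
  end values agree, for periodic approximation.\<close>

lemma bounded_measurable_continuous_approx:
  fixes f :: "real \<Rightarrow> complex"
  assumes f: "f \<in> borel_measurable borel" "\<And>x. norm (f x) \<le> C" "C > 0"
  obtains g :: "nat \<Rightarrow> real \<Rightarrow> complex" where "\<And>n. continuous_on UNIV (g n)" "\<And>n. g n 0 = 0" "\<And>n. g n 1 = 0"
    "\<And>n x. x \<in> {0..1} \<Longrightarrow> norm (g n x) \<le> C"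
    "AE x in lborel. x \<in> {0..1} \<longrightarrow> (\<lambda>n. g n x) \<longlonglongrightarrow> f x"
proof -
  have "f measurable_on UNIV"
    by (rule lebesgue_measurable_imp_measurable_on) (use f in \<open>auto intro: measurable_completion\<close>)
  then obtain N h where N: "negligible N" and h: "\<And>n. continuous_on UNIV (h n)"
    and lim: "\<And>x. x \<notin> N \<Longrightarrow> (\<lambda>n. h n x) \<longlonglongrightarrow> f x"
    unfolding measurable_on_def by auto
  \<comment> \<open>Radial retraction of the plane onto the disc of radius \<open>C\<close>; it
    fixes all values of \<open>f\<close>.\<close>
  define clip :: "complex \<Rightarrow> complex" where "clip w = of_real (C / max C (norm w)) * w" for w
  have clip_cont: "continuous_on UNIV clip"
    unfolding clip_def using f(3) by (intro continuous_intros) (auto simp: max_def)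
  have clip_le: "norm (clip w) \<le> C" for w
    using f(3) by (auto simp: clip_def norm_mult norm_divide max_def field_simps)
  have clip_id: "clip w = w" if "norm w \<le> C" for w
    using that f(3) by (auto simp: clip_def max_def)
  \<comment> \<open>A factor vanishing at 0 and 1 that equals 1 at each interior point once
    \<open>n\<close> is large.\<close>
  define cut where "cut n x = min 1 (real n * (x * (1 - x)))" for n and x :: real
  define g where "g n x = of_real (cut n x) * clip (h n x)" for n x
  show thesis
  proof
    show "continuous_on UNIV (g n)" for n
      unfolding g_def cut_def
      by (intro continuous_intros continuous_on_compose2[OF clip_cont] h) auto
    show "g n 0 = 0" "g n 1 = 0" for n
      by (auto simp: g_def cut_def)
    show "norm (g n x) \<le> C" if "x \<in> {0..1}" for n x
    proof -
      have "0 \<le> cut n x" "cut n x \<le> 1"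
        using that by (auto simp: cut_def)
      then have "cut n x * norm (clip (h n x)) \<le> 1 * C"
        using clip_le f(3) by (intro mult_mono) auto
      then show ?thesis using \<open>0 \<le> cut n x\<close> by (simp add: g_def norm_mult)
    qed
    have "AE x in lebesgue. x \<notin> N"
      using N by (simp add: negligible_iff_null_sets AE_not_in)
    then have "AE x in lborel. x \<notin> N"
      by (simp add: AE_completion_iff)
    then show "AE x in lborel. x \<in> {0..1} \<longrightarrow> (\<lambda>n. g n x) \<longlonglongrightarrow> f x"
      using AE_lborel_singleton[of 0] AE_lborel_singleton[of 1]
    proof (eventually_elim, intro impI)
      fix x :: real assume x: "x \<notin> N" "x \<noteq> 0" "x \<noteq> 1" "x \<in> {0..1}"
      have "isCont clip (f x)"
        using clip_cont by (simp add: continuous_on_eq_continuous_at)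
      then have "(\<lambda>n. clip (h n x)) \<longlonglongrightarrow> clip (f x)"
        by (rule isCont_tendsto_compose) (rule lim[OF x(1)])
      then have 1: "(\<lambda>n. clip (h n x)) \<longlonglongrightarrow> f x"
        using clip_id f(2) by simp
      have pos: "x * (1 - x) > 0"
        using x by simp
      then obtain m :: nat where "1 < real m * (x * (1 - x))"
        using reals_Archimedean3 by blast
      then have "cut n x = 1" if "n \<ge> m" for n
        using mult_right_mono[of "real m" "real n" "x * (1 - x)"] that pos by (simp add: cut_def)
      then have "(\<lambda>n. cut n x) \<longlonglongrightarrow> 1"
        by (intro tendsto_eventually eventually_sequentiallyI) auto
      then have "(\<lambda>n. of_real (cut n x) * clip (h n x)) \<longlonglongrightarrow> of_real 1 * f x"
        by (intro tendsto_mult tendsto_of_real 1)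
      then show "(\<lambda>n. g n x) \<longlonglongrightarrow> f x"
        by (simp add: g_def)
    qed
  qed
qed

lemma unit_exp_dense_bounded:
  assumes f: "f \<in> borel_measurable borel" "\<And>x. norm (f x) \<le> C" and "e > 0"
  shows "\<exists>F z. finite F \<and> L2_norm (\<lambda>x. indicator {0..1} x * f x - (\<Sum>k\<in>F. z k * unit_exp k x)) < e"
proof -
  have f1: "norm (f x) \<le> \<bar>C\<bar> + 1" for x
    using f(2)[of x] by linarith
  obtain g :: "nat \<Rightarrow> real \<Rightarrow> complex" where g: "\<And>n. continuous_on UNIV (g n)" "\<And>n. g n 0 = 0" "\<And>n. g n 1 = 0"
    "\<And>n x. x \<in> {0..1} \<Longrightarrow> norm (g n x) \<le> \<bar>C\<bar> + 1"
    "AE x in lborel. x \<in> {0..1} \<longrightarrow> (\<lambda>n. g n x) \<longlonglongrightarrow> f x"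
    by (rule bounded_measurable_continuous_approx[OF f(1) f1]) auto
  have [measurable]: "g n \<in> borel_measurable borel" "f \<in> borel_measurable borel" for n
    using g(1) f(1) by (auto intro: borel_measurable_continuous_onI)
  \<comment> \<open>Both \<open>f\<close> and \<open>g n\<close> are at most
    \<open>\<bar>C\<bar> + 1\<close> on the interval, hence the factor 2 for their difference; the
    added 1 makes the bound positive, as the retraction requires.\<close>
  let ?B = "\<lambda>x::real. indicator {0..1} x * of_real (2 * (\<bar>C\<bar> + 1)) :: complex"
  have B: "?B \<in> L2" by (rule L2_indicator_const) simp
  have dom: "(\<lambda>x. indicator {0..1} x * h x) \<in> L2"
    if [measurable]: "h \<in> borel_measurable borel" and h: "\<And>x. x \<in> {0..1} \<Longrightarrow> norm (h x) \<le> \<bar>C\<bar> + 1" for h :: "real \<Rightarrow> complex"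
  proof (rule L2_dominated[OF _ B, where C = 1])
    show "AE x in lborel. norm (indicator {0..1} x * h x) \<le> 1 * norm (indicator {0..1} x * of_real (2 * (\<bar>C\<bar> + 1)) :: complex)"
    proof (rule AE_I2)
      fix x :: real
      show "norm (indicator {0..1} x * h x) \<le> 1 * norm (indicator {0..1} x * of_real (2 * (\<bar>C\<bar> + 1)) :: complex)"
        unfolding norm_mult norm_of_real using h[of x] by (auto split: split_indicator)
    qed
  qed measurable
  have gL2: "(\<lambda>x. indicator {0..1} x * g n x) \<in> L2" for n
    by (rule dom) (use g(4) in auto)
  have fL2: "(\<lambda>x. indicator {0..1} x * f x) \<in> L2"
    by (rule dom) (use f1 in auto)
  show ?thesis
  proof (rule unit_exp_dense_limit[OF fL2 gL2 _ _ \<open>e > 0\<close>])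
    show "\<exists>F z. finite F \<and> L2_norm (\<lambda>x. indicator {0..1} x * g n x - (\<Sum>k\<in>F. z k * unit_exp k x)) < e" if "e > 0" for n e
      by (rule unit_exp_dense_continuous) (use g that in \<open>auto intro: continuous_on_subset\<close>)
    show "(\<lambda>n. L2_norm (\<lambda>x. indicator {0..1} x * f x - indicator {0..1} x * g n x)) \<longlonglongrightarrow> 0"
    proof (rule L2_norm_tendsto_dominated[OF _ B])
      show "AE x in lborel. (\<lambda>n. indicator {0..1} x * f x - indicator {0..1} x * g n x) \<longlonglongrightarrow> 0"
        using g(5)
      proof eventually_elim
        case (elim x)
        show ?case
        proof (cases "x \<in> {0..1}")
          case True
          with elim have "(\<lambda>n. f x - g n x) \<longlonglongrightarrow> f x - f x" by (intro tendsto_intros) auto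
          with True show ?thesis by simp
        qed simp
      qed
      show "AE x in lborel. norm (indicator {0..1} x * f x - indicator {0..1} x * g n x)
        \<le> norm (indicator {0..1} x * of_real (2 * (\<bar>C\<bar> + 1)) :: complex)" for n
      proof (rule AE_I2)
        fix x :: real
        show "norm (indicator {0..1} x * f x - indicator {0..1} x * g n x)
        \<le> norm (indicator {0..1} x * of_real (2 * (\<bar>C\<bar> + 1)) :: complex)"
        proof (cases "x \<in> {0..1}")
          case True
          have "norm (f x - g n x) \<le> norm (f x) + norm (g n x)" by (rule norm_triangle_ineq4)
          also have "\<dots> \<le> norm (of_real (2 * (\<bar>C\<bar> + 1)) :: complex)"
            using f1[of x] g(4)[OF True, of n] unfolding norm_of_real by simp
          finally show ?thesis using True by simp
        qed simp
      qed
    qed measurable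
  qed
qed

lemma unit_exp_dense:
  assumes f: "f \<in> L2" and "e > 0"
  shows "\<exists>F z. finite F \<and> L2_norm (\<lambda>x. indicator {0..1} x * f x - (\<Sum>k\<in>F. z k * unit_exp k x)) < e"
proof -
  have [measurable]: "f \<in> borel_measurable borel" by (rule L2_measurable) fact
  \<comment> \<open>Discarding large values keeps \<open>f\<close> as majorant, and at each point
    nothing is discarded once \<open>n\<close> reaches \<open>norm (f x)\<close>.\<close>
  define g where "g n x = indicator {x. norm (f x) \<le> real n} x * f x" for n x
  have [measurable]: "g n \<in> borel_measurable borel" for n
    unfolding g_def by measurable
  have fI: "(\<lambda>x. indicator {0..1} x * f x) \<in> L2"
    by (intro L2_indicator f) simp
  show ?thesis
  proof (rule unit_exp_dense_limit[OF fI _ _ _ \<open>e > 0\<close>])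
    show "(\<lambda>x. indicator {0..1} x * g n x) \<in> L2" for n
      by (rule L2_dominated[OF _ f, where C = 1]) (auto simp: g_def indicator_def)
    show "\<exists>F z. finite F \<and> L2_norm (\<lambda>x. indicator {0..1} x * g n x - (\<Sum>k\<in>F. z k * unit_exp k x)) < e" if "e > 0" for n e
      by (rule unit_exp_dense_bounded[where C = "real n"]) (use that in \<open>auto simp: g_def indicator_def\<close>)
    show "(\<lambda>n. L2_norm (\<lambda>x. indicator {0..1} x * f x - indicator {0..1} x * g n x)) \<longlonglongrightarrow> 0"
    proof (rule L2_norm_tendsto_dominated[OF _ f])
      show "AE x in lborel. (\<lambda>n. indicator {0..1} x * f x - indicator {0..1} x * g n x) \<longlonglongrightarrow> 0"
      proof (rule AE_I2)
        fix x
        obtain m :: nat where "norm (f x) \<le> real m"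
          using real_arch_simple by blast
        then have "indicator {0..1} x * f x - indicator {0..1} x * g n x = 0" if "n \<ge> m" for n
          using that by (simp add: g_def)
        then show "(\<lambda>n. indicator {0..1} x * f x - indicator {0..1} x * g n x) \<longlonglongrightarrow> 0"
          by (intro tendsto_eventually eventually_sequentiallyI)
      qed
    qed (auto simp: g_def indicator_def)
  qed
qed

lemma Parseval_unit:
  assumes "f \<in> L2" "\<And>x. x \<notin> {0..1} \<Longrightarrow> f x = 0"
  shows "((\<lambda>k. (norm (L2_inner f (unit_exp k)))\<^sup>2) has_sum (L2_norm f)\<^sup>2) UNIV"
proof (rule Parseval_of_dense)
  have "(\<lambda>x. indicator {0..1} x * f x) = f"
    using assms(2) by (auto simp: fun_eq_iff split: split_indicator)
  then show "\<exists>F z. finite F \<and> L2_norm (\<lambda>x. f x - (\<Sum>k\<in>F. z k * unit_exp k x)) < e" if "e > 0" for e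
    using unit_exp_dense[OF assms(1) that] by (simp only: fun_eq_iff)
qed (use assms unit_exp_L2 unit_exp_inner in auto)

text \<open>Unnormalised Fourier coefficients for the period \<open>1 / c\<close>. The exponent has
  a plus sign because they arise from inner products against translates, where the phase is
  conjugated.\<close>

definition exp_coeff :: "real \<Rightarrow> (real \<Rightarrow> complex) \<Rightarrow> int \<Rightarrow> complex" where
  "exp_coeff c f k = (LINT x|lborel. f x * cis (2 * pi * c * of_int k * x))"

text \<open>An affine change of variables leads to the unit interval. The left end \<open>s\<close>
  contributes only a phase, and the scaling accounts for the division by \<open>c\<close>.\<close>

lemma Parseval_exp_coeff:
  assumes c: "c > 0" and f: "f \<in> L2" and supp: "\<And>x. x \<notin> {s..s + 1 / c} \<Longrightarrow> f x = 0"
  shows "((\<lambda>k. (norm (exp_coeff c f k))\<^sup>2) has_sum (L2_norm f)\<^sup>2 / c) UNIV"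
proof -
  define g where "g y = f (s + 1 / c * y)" for y
  have fi: "integrable lborel (\<lambda>x. (norm (f x))\<^sup>2)"
    using f by (rule L2_integrable)
  have [measurable]: "f \<in> borel_measurable borel"
    using f by (rule L2_measurable)
  have g: "g \<in> L2"
  proof (rule L2I)
    show "integrable lborel (\<lambda>y. (norm (g y))\<^sup>2)"
      unfolding g_def using lborel_integrable_real_affine[OF fi, of "1 / c" s] c by simp
  next
    show "g \<in> borel_measurable borel" unfolding g_def by measurable
  qed
  have g0: "g y = 0" if "y \<notin> {0..1}" for y
    unfolding g_def using that c by (intro supp) (auto simp: field_simps)
  have gn: "(L2_norm g)\<^sup>2 = c * (L2_norm f)\<^sup>2"
    unfolding L2_norm_square
    using lborel_integral_real_affine[of "1 / c" "\<lambda>x. (norm (f x))\<^sup>2" s] c by (simp add: g_def)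
  have coeff: "L2_inner g (unit_exp k) = of_real c * cis (2 * pi * c * of_int k * s) * exp_coeff c f (- k)" for k
  proof -
    have "exp_coeff c f (- k) = of_real (1 / c) * (LINT y|lborel. g y * cis (2 * pi * c * of_int (- k) * (s + 1 / c * y)))"
      unfolding exp_coeff_def g_def
      using lborel_integral_real_affine[of "1 / c" "\<lambda>x. f x * cis (2 * pi * c * of_int (- k) * x)" s] c
      by (simp add: scaleR_conv_of_real)
    also have "(\<lambda>y. g y * cis (2 * pi * c * of_int (- k) * (s + 1 / c * y)))
      = (\<lambda>y. cis (- (2 * pi * c * of_int k * s)) * (g y * cnj (unit_exp k y)))"
    proof
      fix y
      show "g y * cis (2 * pi * c * of_int (- k) * (s + 1 / c * y))
        = cis (- (2 * pi * c * of_int k * s)) * (g y * cnj (unit_exp k y))"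
      proof (cases "y \<in> {0..1}")
        case True
        have "2 * pi * c * of_int (- k) * (s + 1 / c * y) = - (2 * pi * c * of_int k * s) + - (2 * pi * of_int k * y)"
          using c by (simp add: field_simps)
        then show ?thesis
          using True by (simp only: unit_exp_def cis_mult[symmetric]) (simp add: cis_cnj)
      qed (simp add: g0)
    qed
    also have "(LINT y|lborel. cis (- (2 * pi * c * of_int k * s)) * (g y * cnj (unit_exp k y)))
      = cis (- (2 * pi * c * of_int k * s)) * L2_inner g (unit_exp k)"
      by (simp add: L2_inner_def)
    finally show ?thesis
      using c by (simp add: cis_mult mult.assoc flip: mult.assoc[of "cis _"])
  qed
  have "((\<lambda>k. (norm (L2_inner g (unit_exp k)))\<^sup>2) has_sum (L2_norm g)\<^sup>2) UNIV"
    by (rule Parseval_unit[OF g g0])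
  then have "((\<lambda>k. c\<^sup>2 * (norm (exp_coeff c f (- k)))\<^sup>2) has_sum c * (L2_norm f)\<^sup>2) UNIV"
    using c by (simp add: coeff gn norm_mult power_mult_distrib)
  then have "((\<lambda>k. 1 / c\<^sup>2 * (c\<^sup>2 * (norm (exp_coeff c f (- k)))\<^sup>2)) has_sum 1 / c\<^sup>2 * (c * (L2_norm f)\<^sup>2)) UNIV"
    by (rule has_sum_cmult_right)
  then have "((\<lambda>k. (norm (exp_coeff c f (- k)))\<^sup>2) has_sum (L2_norm f)\<^sup>2 / c) UNIV"
    using c by (simp add: power2_eq_square)
  \<comment> \<open>The conjugation in \<open>L2_inner\<close> had reversed the index; the sum over
    all integers is invariant under this.\<close>
  then show ?thesis
    by (rule has_sum_reindex_bij_witness[of _ uminus uminus, THEN iffD1, rotated -1]) auto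
qed

lemma has_sum_diff:
  fixes a b :: "'b :: real_normed_vector"
  assumes "(f has_sum a) A" "(g has_sum b) A"
  shows "((\<lambda>x. f x - g x) has_sum (a - b)) A"
  using has_sum_add[OF assms(1), of "\<lambda>x. - g x" "- b"] assms(2) by (simp add: has_sum_uminus)

text \<open>On a bounded interval the exponential is itself square integrable, so the coefficient is
  an inner product and inherits its linearity.\<close>

lemma exp_coeff_inner:
  assumes "\<And>x. x \<notin> {s..t} \<Longrightarrow> f x = 0"
  shows "exp_coeff c f k = L2_inner f (\<lambda>x. indicator {s..t} x * cis (- (2 * pi * c * of_int k * x)))"
  unfolding exp_coeff_def L2_inner_def
  by (rule Bochner_Integration.integral_cong) (use assms in \<open>auto simp: indicator_def cis_cnj\<close>)

lemma L2_indicator_cis: "(\<lambda>x. indicator {s..t} x * cis (w * x)) \<in> L2" for s t w :: real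
proof (cases "s \<le> t")
  case True
  then show ?thesis
    by (intro L2_dominated[OF _ L2_indicator_const[of s t 1], where C = 1]) (auto simp: norm_mult)
qed simp

lemma exp_coeff_linear:
  assumes "f \<in> L2" "g \<in> L2" "\<And>x. x \<notin> {s..t} \<Longrightarrow> f x = 0" "\<And>x. x \<notin> {s..t} \<Longrightarrow> g x = 0"
  shows "exp_coeff c (\<lambda>x. f x + z * g x) k = exp_coeff c f k + z * exp_coeff c g k"
proof -
  have e: "(\<lambda>x. indicator {s..t} x * cis (- (2 * pi * c * of_int k * x))) \<in> L2"
    using L2_indicator_cis[of s t "- (2 * pi * c * of_int k)"] by simp
  have *: "exp_coeff c h k = L2_inner h (\<lambda>x. indicator {s..t} x * cis (- (2 * pi * c * of_int k * x)))"
    if "\<And>x. x \<notin> {s..t} \<Longrightarrow> h x = 0" for h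
    by (rule exp_coeff_inner) (rule that)
  have "exp_coeff c (\<lambda>x. f x + z * g x) k
    = L2_inner (\<lambda>x. f x + z * g x) (\<lambda>x. indicator {s..t} x * cis (- (2 * pi * c * of_int k * x)))"
    by (rule *) (simp add: assms)
  moreover have "exp_coeff c f k = L2_inner f (\<lambda>x. indicator {s..t} x * cis (- (2 * pi * c * of_int k * x)))"
    by (rule *) (rule assms(3))
  moreover have "exp_coeff c g k = L2_inner g (\<lambda>x. indicator {s..t} x * cis (- (2 * pi * c * of_int k * x)))"
    by (rule *) (rule assms(4))
  ultimately show ?thesis
    using e assms(1,2) by (simp add: L2_inner_add_left L2_cmult L2_inner_cmult_left)
qed

lemma complex_polarization:
  "4 * (a * cnj b) = of_real ((norm (a + b))\<^sup>2 - (norm (a + (- 1) * b))\<^sup>2)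
      + \<i> * of_real ((norm (a + \<i> * b))\<^sup>2 - (norm (a + (- \<i>) * b))\<^sup>2)"
  unfolding of_real_diff complex_norm_square by (simp add: algebra_simps)

text \<open>One common interval of length \<open>1 / c\<close> carries both functions, hence every
  \<open>f + z * g\<close>; polarization then applies to the coefficients and to the inner product
  alike.\<close>

lemma Parseval_exp_coeff_polarized:
  assumes c: "c > 0" and fg: "f \<in> L2" "g \<in> L2"
    and supp: "\<And>x. x \<notin> {s..s + 1 / c} \<Longrightarrow> f x = 0" "\<And>x. x \<notin> {s..s + 1 / c} \<Longrightarrow> g x = 0"
  shows "((\<lambda>k. exp_coeff c f k * cnj (exp_coeff c g k)) has_sum L2_inner f g / of_real c) UNIV"
proof -
  let ?a = "exp_coeff c f" and ?b = "exp_coeff c g"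
  have *: "((\<lambda>k. of_real ((norm (?a k + z * ?b k))\<^sup>2) :: complex) has_sum
      of_real ((L2_norm (\<lambda>x. f x + z * g x))\<^sup>2 / c)) UNIV" for z
  proof (rule has_sum_of_real)
    have "((\<lambda>k. (norm (exp_coeff c (\<lambda>x. f x + z * g x) k))\<^sup>2) has_sum (L2_norm (\<lambda>x. f x + z * g x))\<^sup>2 / c) UNIV"
      by (rule Parseval_exp_coeff[OF c, of _ s]) (use supp fg in \<open>auto intro!: L2_add L2_cmult\<close>)
    then show "((\<lambda>k. (norm (?a k + z * ?b k))\<^sup>2) has_sum (L2_norm (\<lambda>x. f x + z * g x))\<^sup>2 / c) UNIV"
      using exp_coeff_linear[OF fg supp] by simp
  qed
  have 1: "((\<lambda>k. of_real ((norm (?a k + ?b k))\<^sup>2) :: complex) has_sum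
      of_real ((L2_norm (\<lambda>x. f x + g x))\<^sup>2 / c)) UNIV"
    using *[of 1] by simp
  have "((\<lambda>k. of_real ((norm (?a k + ?b k))\<^sup>2) - of_real ((norm (?a k + (- 1) * ?b k))\<^sup>2)
      + \<i> * (of_real ((norm (?a k + \<i> * ?b k))\<^sup>2) - of_real ((norm (?a k + (- \<i>) * ?b k))\<^sup>2)))
    has_sum of_real ((L2_norm (\<lambda>x. f x + g x))\<^sup>2 / c) - of_real ((L2_norm (\<lambda>x. f x + (- 1) * g x))\<^sup>2 / c)
      + \<i> * (of_real ((L2_norm (\<lambda>x. f x + \<i> * g x))\<^sup>2 / c) - of_real ((L2_norm (\<lambda>x. f x + (- \<i>) * g x))\<^sup>2 / c))) UNIV"
    by (intro has_sum_add has_sum_diff has_sum_cmult_right 1 *)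
  then have "((\<lambda>k. 4 * (?a k * cnj (?b k))) has_sum
     (of_real ((L2_norm (\<lambda>x. f x + g x))\<^sup>2 - (L2_norm (\<lambda>x. f x + (- 1) * g x))\<^sup>2)
      + \<i> * of_real ((L2_norm (\<lambda>x. f x + \<i> * g x))\<^sup>2 - (L2_norm (\<lambda>x. f x + (- \<i>) * g x))\<^sup>2)) / of_real c) UNIV"
    unfolding complex_polarization by (simp only: of_real_diff of_real_divide add_divide_distrib[symmetric] diff_divide_distrib[symmetric] times_divide_eq_right)
  then have "((\<lambda>k. 1/4 * (4 * (?a k * cnj (?b k)))) has_sum 1/4 * (4 * L2_inner f g / of_real c)) UNIV"
    unfolding L2_polarization[OF fg, symmetric] by (rule has_sum_cmult_right)
  then show ?thesis by simp
qed

section \<open>The Fourier transform on \<open>L2\<close>\<close>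

lemma borel_measurable_fourier [measurable]:
  assumes [measurable]: "f \<in> borel_measurable borel" shows "fourier f \<in> borel_measurable borel"
proof -
  have "(\<lambda>\<gamma>. LINT x|lborel. f x * cis (- 2 * pi * \<gamma> * x)) \<in> borel_measurable borel"
    by (rule lborel.borel_measurable_lebesgue_integral) simp
  then show ?thesis by (simp add: fourier_def [abs_def])
qed

text \<open>The support fits into one period \<open>2 * R\<close> of the exponentials with spacing
  \<open>1 / (2 * R)\<close>. Modulating \<open>f\<close> by \<open>\<theta>\<close> shifts the
  points at which the transform is sampled and preserves the norm.\<close>

lemma fourier_shift_has_sum:
  assumes f: "f \<in> L2" and R: "R > 0" and supp: "\<And>x. x \<notin> {-R..R} \<Longrightarrow> f x = 0"
  shows "((\<lambda>k. (norm (fourier f (\<theta> + of_int k / (2 * R))))\<^sup>2) has_sum 2 * R * (L2_norm f)\<^sup>2) UNIV"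
proof -
  define g where "g x = cis (- 2 * pi * \<theta> * x) * f x" for x
  have g: "g \<in> L2"
    unfolding g_def by (rule L2_mult_bounded[OF f, where C = 1]) auto
  have gn: "L2_norm g = L2_norm f"
    by (simp add: L2_norm_def g_def norm_mult)
  have "((\<lambda>k. (norm (exp_coeff (1 / (2 * R)) g k))\<^sup>2) has_sum (L2_norm g)\<^sup>2 / (1 / (2 * R))) UNIV"
    by (rule Parseval_exp_coeff[OF _ g, of _ "-R"]) (use R supp in \<open>auto simp: g_def\<close>)
  then have "((\<lambda>k. (norm (exp_coeff (1 / (2 * R)) g (- k)))\<^sup>2) has_sum 2 * R * (L2_norm f)\<^sup>2) UNIV"
    by (subst has_sum_reindex_bij_betw[of uminus UNIV UNIV]) (auto simp: gn mult.commute intro: bij_uminus)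
  moreover have "exp_coeff (1 / (2 * R)) g (- k) = fourier f (\<theta> + of_int k / (2 * R))" for k
    unfolding exp_coeff_def fourier_def g_def
  proof (rule Bochner_Integration.integral_cong[OF refl])
    fix x
    have "- 2 * pi * (\<theta> + of_int k / (2 * R)) * x = - 2 * pi * \<theta> * x + 2 * pi * (1 / (2 * R)) * of_int (- k) * x"
      by (simp add: algebra_simps)
    then show "cis (- 2 * pi * \<theta> * x) * f x * cis (2 * pi * (1 / (2 * R)) * of_int (- k) * x)
      = f x * cis (- 2 * pi * (\<theta> + of_int k / (2 * R)) * x)"
      by (simp only: cis_mult[symmetric]) simp
  qed
  ultimately show ?thesis by simp
qed

text \<open>The cells are enumerated through \<open>int_decode\<close> because countable additivity
  of the integral is applied to sequences.\<close>

lemma UN_int_intervals: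
  fixes c :: real assumes "c > 0"
  shows "(\<Union>n. {of_int (int_decode n) * c ..< of_int (int_decode n) * c + c}) = UNIV"
proof -
  have "x \<in> (\<Union>n. {of_int (int_decode n) * c ..< of_int (int_decode n) * c + c})" for x
  proof (rule UN_I[of "int_encode \<lfloor>x / c\<rfloor>"])
    show "x \<in> {of_int (int_decode (int_encode \<lfloor>x / c\<rfloor>)) * c ..< of_int (int_decode (int_encode \<lfloor>x / c\<rfloor>)) * c + c}"
      using assms floor_divide_lower[of c x] floor_divide_upper[of c x] by (simp add: algebra_simps)
  qed simp
  then show ?thesis by blast
qed

lemma disjoint_int_intervals:
  fixes c :: real assumes "c > 0"
  shows "disjoint_family (\<lambda>n. {of_int (int_decode n) * c ..< of_int (int_decode n) * c + c})"
proof -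
  have eq: "of_int k = (of_int \<lfloor>x / c\<rfloor> :: real)" if "x \<in> {of_int k * c ..< of_int k * c + c}" for k x
  proof -
    have "of_int k \<le> x / c" "x / c < of_int k + 1"
      using that assms by (auto simp: field_simps)
    then show ?thesis by (simp add: floor_unique)
  qed
  have "int_decode m = int_decode n"
    if "x \<in> {of_int (int_decode m) * c ..< of_int (int_decode m) * c + c}"
      "x \<in> {of_int (int_decode n) * c ..< of_int (int_decode n) * c + c}" for x m n
    using eq[OF that(1)] eq[OF that(2)] by simp
  then show ?thesis
    unfolding disjoint_family_on_def using inj_int_decode by (metis (no_types, lifting) disjoint_iff injD)
qed

text \<open>Plancherel by periodization: on each coset \<open>\<theta> + \<int> / 2R\<close> the values of the transform
  are the Fourier coefficients of a modulation of \<open>f\<close>, so Parseval applies coset by coset.\<close>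

lemma Plancherel_compact:
  assumes f: "f \<in> L2" and R: "R > 0" and supp: "\<And>x. x \<notin> {-R..R} \<Longrightarrow> f x = 0"
  shows "fourier f \<in> L2" "L2_norm (fourier f) = L2_norm f"
proof -
  define c where "c = 1 / (2 * R)"
  have c: "c > 0" using R by (simp add: c_def)
  define B where "B n = {of_int (int_decode n) * c ..< of_int (int_decode n) * c + c}" for n
  have [measurable]: "f \<in> borel_measurable borel" using f by (rule L2_measurable)
  define F where "F \<gamma> = ennreal ((norm (fourier f \<gamma>))\<^sup>2)" for \<gamma>
  have [measurable]: "F \<in> borel_measurable borel"
    unfolding F_def by measurable
  have "(\<integral>\<^sup>+\<gamma>. F \<gamma> \<partial>lborel) = (\<integral>\<^sup>+\<gamma>\<in>(\<Union>n. B n). F \<gamma> \<partial>lborel)"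
    unfolding B_def UN_int_intervals[OF c] by simp
  also have "\<dots> = (\<Sum>n. \<integral>\<^sup>+\<gamma>\<in>B n. F \<gamma> \<partial>lborel)"
    by (rule nn_integral_disjoint_family) (use disjoint_int_intervals[OF c] in \<open>auto simp: B_def\<close>)
  also have "\<dots> = (\<Sum>n. \<integral>\<^sup>+\<theta>. F (\<theta> + of_int (int_decode n) * c) * indicator {0..<c} \<theta> \<partial>lborel)"
  proof (intro suminf_cong)
    fix n
    have "(\<integral>\<^sup>+\<gamma>\<in>B n. F \<gamma> \<partial>lborel)
      = (\<integral>\<^sup>+\<theta>. F (of_int (int_decode n) * c + 1 * \<theta>) * indicator (B n) (of_int (int_decode n) * c + 1 * \<theta>) \<partial>lborel)"
      by (subst nn_integral_real_affine[where c = 1 and t = "of_int (int_decode n) * c"]) (auto simp: B_def)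
    also have "\<dots> = (\<integral>\<^sup>+\<theta>. F (\<theta> + of_int (int_decode n) * c) * indicator {0..<c} \<theta> \<partial>lborel)"
      by (intro nn_integral_cong) (auto simp: B_def add.commute split: split_indicator)
    finally show "(\<integral>\<^sup>+\<gamma>\<in>B n. F \<gamma> \<partial>lborel) = (\<integral>\<^sup>+\<theta>. F (\<theta> + of_int (int_decode n) * c) * indicator {0..<c} \<theta> \<partial>lborel)" .
  qed
  also have "\<dots> = (\<integral>\<^sup>+\<theta>. (\<Sum>n. F (\<theta> + of_int (int_decode n) * c) * indicator {0..<c} \<theta>) \<partial>lborel)"
    by (rule nn_integral_suminf[symmetric]) measurable
  \<comment> \<open>The sampled sum has the same value for every \<open>\<theta>\<close>, so
    integrating over a cell of length \<open>c\<close> cancels the division by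
    \<open>c\<close>.\<close>
  also have "\<dots> = (\<integral>\<^sup>+\<theta>. ennreal ((L2_norm f)\<^sup>2 / c) * indicator {0..<c} \<theta> \<partial>lborel)"
  proof (rule nn_integral_cong)
    fix \<theta>
    have "((\<lambda>k. (norm (fourier f (\<theta> + of_int k * c)))\<^sup>2) has_sum (L2_norm f)\<^sup>2 / c) UNIV"
      using fourier_shift_has_sum[OF f R supp, of \<theta>] by (simp add: c_def field_simps)
    then have "((\<lambda>n. (norm (fourier f (\<theta> + of_int (int_decode n) * c)))\<^sup>2) has_sum (L2_norm f)\<^sup>2 / c) UNIV"
      by (subst has_sum_reindex_bij_betw[OF bij_int_decode, where f = "\<lambda>k. (norm (fourier f (\<theta> + of_int k * c)))\<^sup>2"])
    then have "(\<lambda>n. (norm (fourier f (\<theta> + of_int (int_decode n) * c)))\<^sup>2) sums ((L2_norm f)\<^sup>2 / c)"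
      by (rule has_sum_imp_sums)
    then have "(\<Sum>n. F (\<theta> + of_int (int_decode n) * c)) = ennreal ((L2_norm f)\<^sup>2 / c)"
      unfolding F_def by (intro suminf_ennreal_eq) auto
    then show "(\<Sum>n. F (\<theta> + of_int (int_decode n) * c) * indicator {0..<c} \<theta>)
      = ennreal ((L2_norm f)\<^sup>2 / c) * indicator {0..<c} \<theta>"
      by (auto split: split_indicator)
  qed
  also have "\<dots> = ennreal ((L2_norm f)\<^sup>2 / c) * ennreal c"
    using c by (simp add: nn_integral_cmult_indicator)
  also have "\<dots> = ennreal ((L2_norm f)\<^sup>2)"
    using c by (simp flip: ennreal_mult)
  finally have eq: "(\<integral>\<^sup>+\<gamma>. ennreal ((norm (fourier f \<gamma>))\<^sup>2) \<partial>lborel) = ennreal ((L2_norm f)\<^sup>2)"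
    by (simp add: F_def)
  show "fourier f \<in> L2"
    using L2_I_nn_integral(1)[of "fourier f" "L2_norm f"] eq by simp
  from L2_nn_norm_square[OF this] eq have "(L2_norm (fourier f))\<^sup>2 = (L2_norm f)\<^sup>2"
    by simp
  then show "L2_norm (fourier f) = L2_norm f"
    by simp
qed

text \<open>On this class the integral defining \<open>fourier\<close> converges absolutely and is
  isometric; the truncations \<open>cutoff n f\<close> make it dense.\<close>

definition compact_L2 :: "(real \<Rightarrow> complex) set" where
  "compact_L2 = {f \<in> L2. \<exists>R. \<forall>x. x \<notin> {-R..R} \<longrightarrow> f x = 0}"

lemma compact_L2_D: "f \<in> compact_L2 \<Longrightarrow> f \<in> L2"
  by (simp add: compact_L2_def)

lemma compact_L2_E:
  assumes "f \<in> compact_L2"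
  obtains R where "R > 0" "\<And>x. x \<notin> {-R..R} \<Longrightarrow> f x = 0"
proof -
  obtain R where R: "\<And>x. x \<notin> {-R..R} \<Longrightarrow> f x = 0"
    using assms by (auto simp: compact_L2_def)
  show thesis
    by (rule that[of "max R 1"], simp, rule R) auto
qed

lemma fourier_compact_L2:
  assumes "f \<in> compact_L2" shows "fourier f \<in> L2" "L2_norm (fourier f) = L2_norm f"
proof -
  obtain R where R: "R > 0" "\<And>x. x \<notin> {-R..R} \<Longrightarrow> f x = 0"
    using compact_L2_E[OF assms] by blast
  show "fourier f \<in> L2"
    by (rule Plancherel_compact(1)[OF compact_L2_D[OF assms] R])
  show "L2_norm (fourier f) = L2_norm f"
    by (rule Plancherel_compact(2)[OF compact_L2_D[OF assms] R])
qed

lemma compact_L2_add_cmult: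
  assumes "f \<in> compact_L2" "g \<in> compact_L2"
  shows "(\<lambda>x. f x + z * g x) \<in> compact_L2"
proof -
  obtain R where R: "\<And>x. x \<notin> {-R..R} \<Longrightarrow> f x = 0" using assms(1) by (auto simp: compact_L2_def)
  obtain R' where R': "\<And>x. x \<notin> {-R'..R'} \<Longrightarrow> g x = 0" using assms(2) by (auto simp: compact_L2_def)
  have "f x + z * g x = 0" if "x \<notin> {- max R R'..max R R'}" for x
  proof -
    have "f x = 0" by (rule R) (use that in auto)
    moreover have "g x = 0" by (rule R') (use that in auto)
    ultimately show ?thesis by simp
  qed
  moreover have "(\<lambda>x. f x + z * g x) \<in> L2"
    by (intro L2_add L2_cmult compact_L2_D assms)
  ultimately show ?thesis
    unfolding compact_L2_def by blast
qed

lemma integrable_compact_L2_cis: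
  assumes "f \<in> compact_L2" shows "integrable lborel (\<lambda>x. f x * cis (w * x))"
proof -
  obtain R where R: "\<And>x. x \<notin> {-R..R} \<Longrightarrow> f x = 0" using assms by (auto simp: compact_L2_def)
  have "integrable lborel (\<lambda>x. f x * (indicator {-R..R} x * cis (w * x)))"
    by (intro L2_integrable_mult compact_L2_D assms L2_indicator_cis)
  also have "(\<lambda>x. f x * (indicator {-R..R} x * cis (w * x))) = (\<lambda>x. f x * cis (w * x))"
    using R by (auto simp: fun_eq_iff split: split_indicator)
  finally show ?thesis .
qed

lemma fourier_add_cmult:
  assumes "f \<in> compact_L2" "g \<in> compact_L2"
  shows "fourier (\<lambda>x. f x + z * g x) \<gamma> = fourier f \<gamma> + z * fourier g \<gamma>"
proof -
  have "integrable lborel (\<lambda>x. f x * cis (- 2 * pi * \<gamma> * x))" "integrable lborel (\<lambda>x. g x * cis (- 2 * pi * \<gamma> * x))"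
    by (intro integrable_compact_L2_cis assms)+
  then show ?thesis
    by (simp add: fourier_def distrib_right mult.assoc)
qed

lemma fourier_diff:
  assumes "f \<in> compact_L2" "g \<in> compact_L2"
  shows "(\<lambda>\<gamma>. fourier f \<gamma> - fourier g \<gamma>) = fourier (\<lambda>x. f x - g x)" "(\<lambda>x. f x - g x) \<in> compact_L2"
  using fourier_add_cmult[OF assms, of "- 1"] compact_L2_add_cmult[OF assms, of "- 1"] by auto

lemma fourier_translate: "fourier (translate t f) \<gamma> = cis (- 2 * pi * t * \<gamma>) * fourier f \<gamma>"
proof -
  have "fourier (translate t f) \<gamma> = (LINT x|lborel. f x * cis (- 2 * pi * \<gamma> * (t + x)))"
    unfolding fourier_def translate_def by (subst lborel_integral_real_affine[of 1 _ t]) simp_all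
  also have "(\<lambda>x. f x * cis (- 2 * pi * \<gamma> * (t + x))) = (\<lambda>x. cis (- 2 * pi * t * \<gamma>) * (f x * cis (- 2 * pi * \<gamma> * x)))"
  proof
    fix x
    have "- 2 * pi * \<gamma> * (t + x) = - 2 * pi * t * \<gamma> + - 2 * pi * \<gamma> * x"
      by (simp add: algebra_simps)
    then have "cis (- 2 * pi * \<gamma> * (t + x)) = cis (- 2 * pi * t * \<gamma>) * cis (- 2 * pi * \<gamma> * x)"
      by (simp only: cis_mult)
    then show "f x * cis (- 2 * pi * \<gamma> * (t + x)) = cis (- 2 * pi * t * \<gamma>) * (f x * cis (- 2 * pi * \<gamma> * x))"
      by simp
  qed
  also have "(LINT x|lborel. cis (- 2 * pi * t * \<gamma>) * (f x * cis (- 2 * pi * \<gamma> * x))) = cis (- 2 * pi * t * \<gamma>) * fourier f \<gamma>"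
    unfolding fourier_def by (rule integral_mult_right_zero)
  finally show ?thesis .
qed

lemma translate_compact_L2: "f \<in> compact_L2 \<Longrightarrow> translate t f \<in> compact_L2"
proof -
  assume f: "f \<in> compact_L2"
  then obtain R where R: "\<And>x. x \<notin> {-R..R} \<Longrightarrow> f x = 0" by (auto simp: compact_L2_def)
  have "translate t f x = 0" if "x \<notin> {- (\<bar>R\<bar> + \<bar>t\<bar>)..\<bar>R\<bar> + \<bar>t\<bar>}" for x
    unfolding translate_def using that by (intro R) auto
  then show ?thesis
    unfolding compact_L2_def using translate_in_L2[OF compact_L2_D[OF f]] by blast
qed

text \<open>Exactly the truncations that occur in the definition of
  \<open>fourier_L2\<close>.\<close>

definition cutoff :: "nat \<Rightarrow> (real \<Rightarrow> complex) \<Rightarrow> real \<Rightarrow> complex" where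
  "cutoff n f = (\<lambda>x. indicator {- real n..real n} x * f x)"

lemma cutoff_compact_L2: "f \<in> L2 \<Longrightarrow> cutoff n f \<in> compact_L2"
  unfolding cutoff_def compact_L2_def by (auto intro!: L2_indicator exI[of _ "real n"] split: split_indicator)

lemma cutoff_L2: "f \<in> L2 \<Longrightarrow> cutoff n f \<in> L2"
  by (rule compact_L2_D[OF cutoff_compact_L2])

lemma cutoff_tendsto:
  assumes "f \<in> L2" shows "(\<lambda>n. L2_norm (\<lambda>x. f x - cutoff n f x)) \<longlonglongrightarrow> 0"
proof (rule L2_norm_tendsto_dominated[OF _ assms])
  have [measurable]: "f \<in> borel_measurable borel" using assms by (rule L2_measurable)
  show "(\<lambda>x. f x - cutoff n f x) \<in> borel_measurable borel" for n
    unfolding cutoff_def by measurable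
  show "AE x in lborel. (\<lambda>n. f x - cutoff n f x) \<longlonglongrightarrow> 0"
  proof (rule AE_I2)
    fix x
    obtain m :: nat where "\<bar>x\<bar> \<le> real m" using real_arch_simple by blast
    then have "f x - cutoff n f x = 0" if "n \<ge> m" for n
      using that by (auto simp: cutoff_def split: split_indicator)
    then show "(\<lambda>n. f x - cutoff n f x) \<longlonglongrightarrow> 0"
      by (intro tendsto_eventually eventually_sequentiallyI)
  qed
  show "AE x in lborel. norm (f x - cutoff n f x) \<le> norm (f x)" for n
    by (auto simp: cutoff_def split: split_indicator)
qed

text \<open>The truncations form a Cauchy sequence and the transform is isometric on them, so their
  transforms converge by completeness. This justifies the choice made in
  \<open>fourier_L2\<close>.\<close>

lemma fourier_L2_spec:
  assumes f: "f \<in> L2"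
  shows fourier_L2_in_L2: "fourier_L2 f \<in> L2"
    and fourier_L2_tendsto: "(\<lambda>n. L2_norm (\<lambda>\<gamma>. fourier_L2 f \<gamma> - fourier (cutoff n f) \<gamma>)) \<longlonglongrightarrow> 0"
proof -
  have "\<exists>F. F \<in> L2 \<and> (\<lambda>n. L2_norm (\<lambda>\<gamma>. F \<gamma> - fourier (cutoff n f) \<gamma>)) \<longlonglongrightarrow> 0"
  proof (rule L2_complete)
    show "fourier (cutoff n f) \<in> L2" for n
      by (intro fourier_compact_L2 cutoff_compact_L2 f)
    fix e :: real assume "e > 0"
    then have "\<forall>\<^sub>F n in sequentially. L2_norm (\<lambda>x. f x - cutoff n f x) < e / 2"
      by (intro order_tendstoD[OF cutoff_tendsto[OF f]]) simp
    then obtain M where M: "\<And>n. n \<ge> M \<Longrightarrow> L2_norm (\<lambda>x. f x - cutoff n f x) < e / 2"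
      by (auto simp: eventually_sequentially)
    have "L2_norm (\<lambda>x. fourier (cutoff m f) x - fourier (cutoff n f) x) < e" if "m \<ge> M" "n \<ge> M" for m n
    proof -
      have "L2_norm (\<lambda>x. fourier (cutoff m f) x - fourier (cutoff n f) x) = L2_norm (\<lambda>x. cutoff m f x - cutoff n f x)"
        using fourier_diff[OF cutoff_compact_L2[OF f] cutoff_compact_L2[OF f]] fourier_compact_L2(2) by simp
      also have "\<dots> \<le> L2_norm (\<lambda>x. cutoff m f x - f x) + L2_norm (\<lambda>x. f x - cutoff n f x)"
        by (intro L2_triangle_diff cutoff_L2 f)
      also have "L2_norm (\<lambda>x. cutoff m f x - f x) = L2_norm (\<lambda>x. f x - cutoff m f x)"
        by (rule L2_norm_minus_commute)
      finally show ?thesis using M[OF that(1)] M[OF that(2)] by linarith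
    qed
    then show "\<exists>M. \<forall>m\<ge>M. \<forall>n\<ge>M. L2_norm (\<lambda>x. fourier (cutoff m f) x - fourier (cutoff n f) x) < e"
      by blast
  qed blast
  then have "fourier_L2 f \<in> L2 \<and> (\<lambda>n. L2_norm (\<lambda>\<gamma>. fourier_L2 f \<gamma> - fourier (cutoff n f) \<gamma>)) \<longlonglongrightarrow> 0"
    unfolding fourier_L2_def cutoff_def by (rule someI_ex)
  then show "fourier_L2 f \<in> L2"
    "(\<lambda>n. L2_norm (\<lambda>\<gamma>. fourier_L2 f \<gamma> - fourier (cutoff n f) \<gamma>)) \<longlonglongrightarrow> 0" by auto
qed

lemma fourier_L2_measurable [measurable (raw)]: "f \<in> L2 \<Longrightarrow> fourier_L2 f \<in> borel_measurable borel"
  by (intro L2_measurable fourier_L2_in_L2)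

lemma L2_norm_fourier_L2:
  assumes f: "f \<in> L2" shows "L2_norm (fourier_L2 f) = L2_norm f"
proof -
  have "(\<lambda>n. L2_norm (cutoff n f)) \<longlonglongrightarrow> L2_norm f"
    by (rule L2_norm_tendsto[OF cutoff_L2 _ cutoff_tendsto]) fact+
  moreover have "(\<lambda>n. L2_norm (fourier (cutoff n f))) \<longlonglongrightarrow> L2_norm (fourier_L2 f)"
    by (rule L2_norm_tendsto[OF _ fourier_L2_spec]) (intro f fourier_compact_L2 cutoff_compact_L2)+
  ultimately show ?thesis
    using fourier_compact_L2(2)[OF cutoff_compact_L2[OF f]] by (simp add: LIMSEQ_unique)
qed

text \<open>By isometry, two compactly supported approximations of \<open>f\<close> have transforms
  with the same limit. The freedom beyond truncations is what translation requires, as a translated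
  truncation is in general not a truncation of the translate.\<close>

lemma fourier_L2_unique:
  assumes f: "f \<in> L2" and F: "F \<in> L2" and g: "\<And>n. g n \<in> compact_L2"
    and lim: "(\<lambda>n. L2_norm (\<lambda>x. f x - g n x)) \<longlonglongrightarrow> 0" "(\<lambda>n. L2_norm (\<lambda>\<gamma>. F \<gamma> - fourier (g n) \<gamma>)) \<longlonglongrightarrow> 0"
  shows "AE \<gamma> in lborel. fourier_L2 f \<gamma> = F \<gamma>"
proof -
  have cf: "cutoff n f \<in> compact_L2" for n by (intro cutoff_compact_L2 f)
  have bound: "L2_norm (\<lambda>\<gamma>. fourier_L2 f \<gamma> - F \<gamma>)
    \<le> L2_norm (\<lambda>\<gamma>. fourier_L2 f \<gamma> - fourier (cutoff n f) \<gamma>)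
      + (L2_norm (\<lambda>x. f x - cutoff n f x) + L2_norm (\<lambda>x. f x - g n x))
      + L2_norm (\<lambda>\<gamma>. F \<gamma> - fourier (g n) \<gamma>)" for n
  proof -
    have "L2_norm (\<lambda>\<gamma>. fourier_L2 f \<gamma> - F \<gamma>) \<le> L2_norm (\<lambda>\<gamma>. fourier_L2 f \<gamma> - fourier (cutoff n f) \<gamma>)
      + L2_norm (\<lambda>\<gamma>. fourier (cutoff n f) \<gamma> - F \<gamma>)"
      by (intro L2_triangle_diff fourier_L2_in_L2 fourier_compact_L2 cf f F)
    moreover have "L2_norm (\<lambda>\<gamma>. fourier (cutoff n f) \<gamma> - F \<gamma>)
      \<le> L2_norm (\<lambda>\<gamma>. fourier (cutoff n f) \<gamma> - fourier (g n) \<gamma>) + L2_norm (\<lambda>\<gamma>. fourier (g n) \<gamma> - F \<gamma>)"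
      by (intro L2_triangle_diff fourier_compact_L2 cf g F)
    moreover have "L2_norm (\<lambda>\<gamma>. fourier (cutoff n f) \<gamma> - fourier (g n) \<gamma>) = L2_norm (\<lambda>x. cutoff n f x - g n x)"
      using fourier_diff[OF cf g] fourier_compact_L2(2) by simp
    moreover have "\<dots> \<le> L2_norm (\<lambda>x. cutoff n f x - f x) + L2_norm (\<lambda>x. f x - g n x)"
      by (intro L2_triangle_diff compact_L2_D cf g f)
    moreover have "L2_norm (\<lambda>x. cutoff n f x - f x) = L2_norm (\<lambda>x. f x - cutoff n f x)"
      "L2_norm (\<lambda>\<gamma>. fourier (g n) \<gamma> - F \<gamma>) = L2_norm (\<lambda>\<gamma>. F \<gamma> - fourier (g n) \<gamma>)"
      by (rule L2_norm_minus_commute)+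
    ultimately show ?thesis by linarith
  qed
  have "(\<lambda>n. L2_norm (\<lambda>\<gamma>. fourier_L2 f \<gamma> - fourier (cutoff n f) \<gamma>)
      + (L2_norm (\<lambda>x. f x - cutoff n f x) + L2_norm (\<lambda>x. f x - g n x))
      + L2_norm (\<lambda>\<gamma>. F \<gamma> - fourier (g n) \<gamma>)) \<longlonglongrightarrow> 0 + (0 + 0) + 0"
    by (intro tendsto_add fourier_L2_tendsto cutoff_tendsto f lim)
  then have "L2_norm (\<lambda>\<gamma>. fourier_L2 f \<gamma> - F \<gamma>) \<le> 0"
    using bound by (intro Lim_bounded2[of _ 0]) auto
  then have "L2_norm (\<lambda>\<gamma>. fourier_L2 f \<gamma> - F \<gamma>) = 0"
    using L2_norm_nonneg[of "\<lambda>\<gamma>. fourier_L2 f \<gamma> - F \<gamma>"] by linarith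
  then show ?thesis
    using L2_norm_eq_0_iff[OF L2_diff[OF fourier_L2_in_L2[OF f] F]] by simp
qed

lemma fourier_L2_add_cmult:
  assumes f: "f \<in> L2" and g: "g \<in> L2"
  shows "AE \<gamma> in lborel. fourier_L2 (\<lambda>x. f x + z * g x) \<gamma> = fourier_L2 f \<gamma> + z * fourier_L2 g \<gamma>"
proof (rule fourier_L2_unique)
  \<comment> \<open>Stated for arbitrary sequences because it serves both for the functions and for
    their transforms.\<close>
  have lim: "(\<lambda>n. L2_norm (\<lambda>x. (u x + z * v x) - (u' n x + z * v' n x))) \<longlonglongrightarrow> 0"
    if "u \<in> L2" "v \<in> L2" "\<And>n. u' n \<in> L2" "\<And>n. v' n \<in> L2"
      "(\<lambda>n. L2_norm (\<lambda>x. u x - u' n x)) \<longlonglongrightarrow> 0" "(\<lambda>n. L2_norm (\<lambda>x. v x - v' n x)) \<longlonglongrightarrow> 0"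
    for u v :: "real \<Rightarrow> complex" and u' v' :: "nat \<Rightarrow> real \<Rightarrow> complex"
  proof (rule tendsto_sandwich[OF _ _ tendsto_const])
    show "\<forall>\<^sub>F n in sequentially. L2_norm (\<lambda>x. (u x + z * v x) - (u' n x + z * v' n x))
      \<le> L2_norm (\<lambda>x. u x - u' n x) + norm z * L2_norm (\<lambda>x. v x - v' n x)"
    proof (rule always_eventually, rule allI)
      fix n
      have "L2_norm (\<lambda>x. (u x - u' n x) + z * (v x - v' n x))
        \<le> L2_norm (\<lambda>x. u x - u' n x) + L2_norm (\<lambda>x. z * (v x - v' n x))"
        by (intro L2_triangle L2_diff L2_cmult that)
      moreover have "(u x - u' n x) + z * (v x - v' n x) = (u x + z * v x) - (u' n x + z * v' n x)" for x
        by (simp add: algebra_simps)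
      ultimately show "L2_norm (\<lambda>x. (u x + z * v x) - (u' n x + z * v' n x))
      \<le> L2_norm (\<lambda>x. u x - u' n x) + norm z * L2_norm (\<lambda>x. v x - v' n x)"
        by (simp add: L2_norm_cmult)
    qed
    have "(\<lambda>n. L2_norm (\<lambda>x. u x - u' n x) + norm z * L2_norm (\<lambda>x. v x - v' n x)) \<longlonglongrightarrow> 0 + norm z * 0"
      by (intro tendsto_intros that)
    then show "(\<lambda>n. L2_norm (\<lambda>x. u x - u' n x) + norm z * L2_norm (\<lambda>x. v x - v' n x)) \<longlonglongrightarrow> 0"
      by simp
  qed auto
  show "(\<lambda>n. L2_norm (\<lambda>x. (f x + z * g x) - (cutoff n f x + z * cutoff n g x))) \<longlonglongrightarrow> 0"
    by (intro lim f g cutoff_L2 cutoff_tendsto)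
  have "(\<lambda>n. L2_norm (\<lambda>\<gamma>. (fourier_L2 f \<gamma> + z * fourier_L2 g \<gamma>)
      - (fourier (cutoff n f) \<gamma> + z * fourier (cutoff n g) \<gamma>))) \<longlonglongrightarrow> 0"
    by (intro lim f g fourier_L2_spec fourier_compact_L2 cutoff_compact_L2)
  then show "(\<lambda>n. L2_norm (\<lambda>\<gamma>. (fourier_L2 f \<gamma> + z * fourier_L2 g \<gamma>)
      - fourier (\<lambda>x. cutoff n f x + z * cutoff n g x) \<gamma>)) \<longlonglongrightarrow> 0"
    using f g by (simp add: fourier_add_cmult cutoff_compact_L2)
qed (intro L2_add L2_cmult fourier_L2_in_L2 compact_L2_add_cmult cutoff_compact_L2 f g)+

lemma fourier_L2_translate:
  assumes f: "f \<in> L2"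
  shows "AE \<gamma> in lborel. fourier_L2 (translate t f) \<gamma> = cis (- 2 * pi * t * \<gamma>) * fourier_L2 f \<gamma>"
proof (rule fourier_L2_unique)
  show "(\<lambda>\<gamma>. cis (- 2 * pi * t * \<gamma>) * fourier_L2 f \<gamma>) \<in> L2"
    by (rule L2_mult_bounded[where C = 1]) (auto intro: fourier_L2_in_L2 f)
  have "L2_norm (\<lambda>x. translate t f x - translate t (cutoff n f) x) = L2_norm (\<lambda>x. f x - cutoff n f x)" for n
    using L2_norm_translate[of t "\<lambda>x. f x - cutoff n f x"] by (simp add: translate_def)
  then show "(\<lambda>n. L2_norm (\<lambda>x. translate t f x - translate t (cutoff n f) x)) \<longlonglongrightarrow> 0"
    using cutoff_tendsto[OF f] by simp
  have "L2_norm (\<lambda>\<gamma>. cis (- 2 * pi * t * \<gamma>) * fourier_L2 f \<gamma> - fourier (translate t (cutoff n f)) \<gamma>)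
    = L2_norm (\<lambda>\<gamma>. fourier_L2 f \<gamma> - fourier (cutoff n f) \<gamma>)" for n
    by (simp add: L2_norm_def fourier_translate norm_mult flip: right_diff_distrib)
  then show "(\<lambda>n. L2_norm (\<lambda>\<gamma>. cis (- 2 * pi * t * \<gamma>) * fourier_L2 f \<gamma> - fourier (translate t (cutoff n f)) \<gamma>)) \<longlonglongrightarrow> 0"
    using fourier_L2_tendsto[OF f] by simp
qed (intro translate_in_L2 translate_compact_L2 cutoff_compact_L2 f)+

text \<open>Linearity and isometry give the norms of all \<open>f + z * g\<close>; polarization does
  the rest.\<close>

lemma L2_inner_fourier_L2:
  assumes f: "f \<in> L2" and g: "g \<in> L2"
  shows "L2_inner (fourier_L2 f) (fourier_L2 g) = L2_inner f g"
proof -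
  have *: "L2_norm (\<lambda>x. fourier_L2 f x + z * fourier_L2 g x) = L2_norm (\<lambda>x. f x + z * g x)" for z
  proof -
    have "L2_norm (\<lambda>x. fourier_L2 f x + z * fourier_L2 g x) = L2_norm (fourier_L2 (\<lambda>x. f x + z * g x))"
      by (rule L2_norm_cong_AE)
        (use fourier_L2_add_cmult[OF f g, of z] in \<open>auto intro!: L2_measurable L2_add L2_cmult fourier_L2_in_L2 f g\<close>)
    also have "\<dots> = L2_norm (\<lambda>x. f x + z * g x)"
      by (intro L2_norm_fourier_L2 L2_add L2_cmult f g)
    finally show ?thesis .
  qed
  have "4 * L2_inner (fourier_L2 f) (fourier_L2 g) = 4 * L2_inner f g"
    unfolding L2_polarization[OF f g] L2_polarization[OF fourier_L2_in_L2[OF f] fourier_L2_in_L2[OF g]] *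
    using *[of 1] by simp
  then show ?thesis by simp
qed

lemma L2_check_add_cmult:
  assumes "f \<in> L2_check S" "g \<in> L2_check S" shows "(\<lambda>x. f x + z * g x) \<in> L2_check S"
proof -
  have fg: "f \<in> L2" "g \<in> L2" using assms by (auto simp: L2_check_def)
  have "AE \<gamma> in lborel. \<gamma> \<in> - S \<longrightarrow> fourier_L2 f \<gamma> = 0" "AE \<gamma> in lborel. \<gamma> \<in> - S \<longrightarrow> fourier_L2 g \<gamma> = 0"
    using assms by (auto simp: L2_check_def vanishes_on_def)
  with fourier_L2_add_cmult[OF fg, of z]
  have "AE \<gamma> in lborel. \<gamma> \<in> - S \<longrightarrow> fourier_L2 (\<lambda>x. f x + z * g x) \<gamma> = 0"
    by eventually_elim auto
  then show ?thesis
    using fg by (auto simp: L2_check_def vanishes_on_def intro!: L2_add L2_cmult)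
qed

text \<open>Keeps the remainder of a partial expansion inside the space, where the weak expansion
  can be tested against it.\<close>

lemma L2_check_diff_sum:
  assumes "f \<in> L2_check S" "\<And>k. k \<in> F \<Longrightarrow> u k \<in> L2_check S"
  shows "(\<lambda>x. f x - (\<Sum>k\<in>F. z k * u k x)) \<in> L2_check S"
  using assms(2)
proof (induction F rule: infinite_finite_induct)
  case (insert k F)
  then have "(\<lambda>x. (f x - (\<Sum>k\<in>F. z k * u k x)) + (- z k) * u k x) \<in> L2_check S"
    by (intro L2_check_add_cmult) auto
  with insert show ?case by (simp add: algebra_simps)
qed (use assms(1) in auto)

lemma translate_L2_check:
  assumes "f \<in> L2_check S" shows "translate t f \<in> L2_check S"
proof -
  have f: "f \<in> L2" using assms by (auto simp: L2_check_def)
  have "AE \<gamma> in lborel. \<gamma> \<in> - S \<longrightarrow> fourier_L2 f \<gamma> = 0"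
    using assms by (auto simp: L2_check_def vanishes_on_def)
  with fourier_L2_translate[OF f, of t] have "AE \<gamma> in lborel. \<gamma> \<in> - S \<longrightarrow> fourier_L2 (translate t f) \<gamma> = 0"
    by eventually_elim auto
  then show ?thesis
    using translate_in_L2[OF f] by (auto simp: L2_check_def vanishes_on_def)
qed

section \<open>Dual frames of translates\<close>

lemma sum_mult_le_Cauchy_Schwarz:
  fixes a b :: "'k \<Rightarrow> 'c :: real_normed_field"
  assumes "(\<Sum>k\<in>F. (norm (a k))\<^sup>2) \<le> P\<^sup>2" "(\<Sum>k\<in>F. (norm (b k))\<^sup>2) \<le> Q\<^sup>2" "0 \<le> P" "0 \<le> Q"
  shows "(\<Sum>k\<in>F. norm (a k * b k)) \<le> P * Q"
proof -
  have "(\<Sum>k\<in>F. norm (a k * b k)) \<le> L2_set (\<lambda>k. norm (a k)) F * L2_set (\<lambda>k. norm (b k)) F"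
    using L2_set_mult_ineq[of "\<lambda>k. norm (a k)" "\<lambda>k. norm (b k)" F] by (simp add: norm_mult)
  also have "\<dots> \<le> P * Q"
    using assms by (intro mult_mono) (auto simp: L2_set_def intro!: real_le_lsqrt sum_nonneg)
  finally show ?thesis .
qed

text \<open>The hypotheses are bounds on finite partial sums, the form in which Bessel inequalities
  and tail estimates are at hand.\<close>

lemma has_sum_mult_le_Cauchy_Schwarz:
  fixes a b :: "'k \<Rightarrow> 'c :: {real_normed_field}"
  assumes "((\<lambda>k. a k * b k) has_sum s) A"
    and "\<And>F. finite F \<Longrightarrow> F \<subseteq> A \<Longrightarrow> (\<Sum>k\<in>F. (norm (a k))\<^sup>2) \<le> P\<^sup>2"
    and "\<And>F. finite F \<Longrightarrow> F \<subseteq> A \<Longrightarrow> (\<Sum>k\<in>F. (norm (b k))\<^sup>2) \<le> Q\<^sup>2"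
    and "0 \<le> P" "0 \<le> Q"
  shows "norm s \<le> P * Q"
proof (rule tendsto_upperbound)
  show "((\<lambda>F. norm (\<Sum>k\<in>F. a k * b k)) \<longlongrightarrow> norm s) (finite_subsets_at_top A)"
    using assms(1) unfolding has_sum_def by (rule tendsto_norm)
  show "\<forall>\<^sub>F F in finite_subsets_at_top A. norm (\<Sum>k\<in>F. a k * b k) \<le> P * Q"
  proof (rule eventually_finite_subsets_at_top_weakI)
    fix F assume F: "finite F" "F \<subseteq> A"
    have "norm (\<Sum>k\<in>F. a k * b k) \<le> (\<Sum>k\<in>F. norm (a k * b k))" by (rule norm_sum)
    also have "\<dots> \<le> P * Q"
      by (intro sum_mult_le_Cauchy_Schwarz assms F)
    finally show "norm (\<Sum>k\<in>F. a k * b k) \<le> P * Q" .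
  qed
qed simp

lemma norm_L2_inner_commute: "norm (L2_inner f g) = norm (L2_inner g f)"
  using L2_inner_cnj[of f g] by simp

text \<open>The remainder of the expansion of \<open>f\<close> is tested against itself; this gives convergence in norm
  without completeness.\<close>

lemma dual_framesI:
  assumes H: "H \<subseteq> L2"
    and H_diff: "\<And>f F z. f \<in> H \<Longrightarrow> finite F \<Longrightarrow> F \<subseteq> K \<Longrightarrow> (\<lambda>x. f x - (\<Sum>k\<in>F. z k * u k x)) \<in> H"
    and u: "\<And>k. k \<in> K \<Longrightarrow> u k \<in> H" and v: "\<And>k. k \<in> K \<Longrightarrow> v k \<in> H"
    and B: "B > 0"
    and u_Bessel: "\<And>f F. f \<in> H \<Longrightarrow> finite F \<Longrightarrow> F \<subseteq> K \<Longrightarrow> (\<Sum>k\<in>F. (norm (L2_inner f (u k)))\<^sup>2) \<le> B * (L2_norm f)\<^sup>2"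
    and v_Bessel: "\<And>f F. f \<in> H \<Longrightarrow> finite F \<Longrightarrow> F \<subseteq> K \<Longrightarrow> (\<Sum>k\<in>F. (norm (L2_inner f (v k)))\<^sup>2) \<le> B * (L2_norm f)\<^sup>2"
    and weak: "\<And>f \<phi>. f \<in> H \<Longrightarrow> \<phi> \<in> H \<Longrightarrow> ((\<lambda>k. L2_inner f (v k) * L2_inner (u k) \<phi>) has_sum L2_inner f \<phi>) K"
  shows "dual_frames H K u v"
proof -
  have B_sqrt: "B * (L2_norm f)\<^sup>2 = (sqrt B * L2_norm f)\<^sup>2" for f
    using B by (simp add: power_mult_distrib)
  have summable: "(\<lambda>k. (norm (L2_inner f (w k)))\<^sup>2) summable_on K"
    if "\<And>F. finite F \<Longrightarrow> F \<subseteq> K \<Longrightarrow> (\<Sum>k\<in>F. (norm (L2_inner f (w k)))\<^sup>2) \<le> B * (L2_norm f)\<^sup>2" for f w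
    by (rule nonneg_bounded_partial_sums_imp_summable_on[where C = "B * (L2_norm f)\<^sup>2"])
      (use that in \<open>auto intro!: eventually_finite_subsets_at_top_weakI\<close>)
  define U where "U f = (\<Sum>\<^sub>\<infinity>k\<in>K. (norm (L2_inner f (u k)))\<^sup>2)" for f
  define V where "V f = (\<Sum>\<^sub>\<infinity>k\<in>K. (norm (L2_inner f (v k)))\<^sup>2)" for f
  have U: "(\<lambda>k. (norm (L2_inner f (u k)))\<^sup>2) summable_on K" "U f \<le> B * (L2_norm f)\<^sup>2"
    "0 \<le> U f" "\<And>F. finite F \<Longrightarrow> F \<subseteq> K \<Longrightarrow> (\<Sum>k\<in>F. (norm (L2_inner f (u k)))\<^sup>2) \<le> U f" if "f \<in> H" for f
    unfolding U_def using summable[of f u] u_Bessel[OF that]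
    by (auto intro!: infsum_le_finite_sums infsum_nonneg finite_sum_le_infsum)
  have V: "(\<lambda>k. (norm (L2_inner f (v k)))\<^sup>2) summable_on K" "V f \<le> B * (L2_norm f)\<^sup>2"
    "0 \<le> V f" "\<And>F. finite F \<Longrightarrow> F \<subseteq> K \<Longrightarrow> (\<Sum>k\<in>F. (norm (L2_inner f (v k)))\<^sup>2) \<le> V f" if "f \<in> H" for f
    unfolding V_def using summable[of f v] v_Bessel[OF that]
    by (auto intro!: infsum_le_finite_sums infsum_nonneg finite_sum_le_infsum)
  \<comment> \<open>The weak expansion of \<open>f\<close> tested against \<open>f\<close>, followed
    by Cauchy-Schwarz for the two coefficient families.\<close>
  have UV: "((L2_norm f)\<^sup>2)\<^sup>2 \<le> V f * U f" if f: "f \<in> H" for f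
  proof -
    have "norm (L2_inner f f) \<le> sqrt (V f) * sqrt (U f)"
      by (rule has_sum_mult_le_Cauchy_Schwarz[OF weak[OF f f]])
        (use U[OF f] V[OF f] in \<open>auto simp: norm_L2_inner_commute[of "u _" f]\<close>)
    then have "(L2_norm f)\<^sup>2 \<le> sqrt (V f) * sqrt (U f)"
      unfolding L2_inner_self norm_of_real by simp
    then have "((L2_norm f)\<^sup>2)\<^sup>2 \<le> (sqrt (V f) * sqrt (U f))\<^sup>2"
      by (intro power_mono) auto
    then show ?thesis
      using U(3)[OF f] V(3)[OF f] by (simp add: power_mult_distrib)
  qed
  \<comment> \<open>Inserting the upper bound for the other family and cancelling one factor
    \<open>(L2_norm f)\<^sup>2\<close> leaves the lower frame bound \<open>1 / B\<close>.\<close>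
  have lower: "1 / B * (L2_norm f)\<^sup>2 \<le> X" if le: "((L2_norm f)\<^sup>2)\<^sup>2 \<le> X * Y" and Y: "Y \<le> B * (L2_norm f)\<^sup>2" and X: "0 \<le> X" for f X Y
  proof (cases "L2_norm f = 0")
    case False
    have "(L2_norm f)\<^sup>2 * (L2_norm f)\<^sup>2 \<le> X * (B * (L2_norm f)\<^sup>2)"
      using le mult_left_mono[OF Y X] by (simp add: power2_eq_square)
    then have "(L2_norm f)\<^sup>2 * (L2_norm f)\<^sup>2 \<le> (X * B) * (L2_norm f)\<^sup>2"
      by (simp add: mult.assoc)
    then have "(L2_norm f)\<^sup>2 \<le> X * B"
      by (rule mult_right_le_imp_le) (use False in simp)
    then show ?thesis
      using B by (simp add: field_simps)
  qed (use X in simp)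
  have frame: "is_frame H K w" if w: "\<And>k. k \<in> K \<Longrightarrow> w k \<in> H"
    and W: "\<And>f. f \<in> H \<Longrightarrow> (\<lambda>k. (norm (L2_inner f (w k)))\<^sup>2) summable_on K"
      "\<And>f. f \<in> H \<Longrightarrow> 1 / B * (L2_norm f)\<^sup>2 \<le> (\<Sum>\<^sub>\<infinity>k\<in>K. (norm (L2_inner f (w k)))\<^sup>2)"
      "\<And>f. f \<in> H \<Longrightarrow> (\<Sum>\<^sub>\<infinity>k\<in>K. (norm (L2_inner f (w k)))\<^sup>2) \<le> B * (L2_norm f)\<^sup>2" for w
    unfolding is_frame_def
  proof (intro conjI ballI w)
    show "\<exists>A>0. \<exists>B>0. \<forall>f\<in>H. (\<lambda>k. (norm (L2_inner f (w k)))\<^sup>2) summable_on K \<and>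
        A * (L2_norm f)\<^sup>2 \<le> (\<Sum>\<^sub>\<infinity>k\<in>K. (norm (L2_inner f (w k)))\<^sup>2) \<and>
        (\<Sum>\<^sub>\<infinity>k\<in>K. (norm (L2_inner f (w k)))\<^sup>2) \<le> B * (L2_norm f)\<^sup>2"
      by (rule exI[of _ "1 / B"], rule conjI, use B in simp, rule exI[of _ B]) (use B W in blast)
  qed
  have "is_frame H K u"
  proof (rule frame)
    show "1 / B * (L2_norm f)\<^sup>2 \<le> (\<Sum>\<^sub>\<infinity>k\<in>K. (norm (L2_inner f (u k)))\<^sup>2)" if "f \<in> H" for f
      unfolding U_def[symmetric]
      by (rule lower[of f "U f" "V f"]) (use UV[OF that] U(3)[OF that] V(2)[OF that] in \<open>simp_all add: mult.commute\<close>)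
  qed (use u U(1,2) in \<open>simp_all add: U_def\<close>)
  moreover have "is_frame H K v"
  proof (rule frame)
    show "1 / B * (L2_norm f)\<^sup>2 \<le> (\<Sum>\<^sub>\<infinity>k\<in>K. (norm (L2_inner f (v k)))\<^sup>2)" if "f \<in> H" for f
      unfolding V_def[symmetric]
      by (rule lower[of f "V f" "U f"]) (use UV[OF that] V(3)[OF that] U(2)[OF that] in simp_all)
  qed (use v V(1,2) in \<open>simp_all add: V_def\<close>)
  moreover have "has_L2_sum (\<lambda>k x. L2_inner f (v k) * u k x) K f" if f: "f \<in> H" for f
    unfolding has_L2_sum_def tendsto_iff
  proof (intro allI impI)
    fix e :: real assume e: "e > 0"
    \<comment> \<open>Chosen so that \<open>sqrt \<delta> * sqrt B = e / 2\<close>: the tail of one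
      coefficient family times the Bessel factor of the other.\<close>
    define \<delta> where "\<delta> = e\<^sup>2 / (4 * B)"
    have \<delta>: "\<delta> > 0" using e B by (simp add: \<delta>_def)
    have "((\<lambda>k. (norm (L2_inner f (v k)))\<^sup>2) has_sum V f) K"
      unfolding V_def using V(1)[OF f] by (rule has_sum_infsum)
    then have "\<forall>\<^sub>F Y in finite_subsets_at_top K. dist (\<Sum>k\<in>Y. (norm (L2_inner f (v k)))\<^sup>2) (V f) < \<delta>"
      unfolding has_sum_def tendsto_iff using \<delta> by blast
    moreover have "\<forall>\<^sub>F Y in finite_subsets_at_top K. finite Y \<and> Y \<subseteq> K"
      by (rule eventually_finite_subsets_at_top_weakI) simp
    ultimately show "\<forall>\<^sub>F Y in finite_subsets_at_top K. dist (L2_norm (\<lambda>x. f x - (\<Sum>k\<in>Y. L2_inner f (v k) * u k x))) 0 < e"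
    proof eventually_elim
      case (elim Y)
      then have Y: "finite Y" "Y \<subseteq> K" by auto
      let ?r = "\<lambda>x. f x - (\<Sum>k\<in>Y. L2_inner f (v k) * u k x)"
      have r: "?r \<in> H" by (rule H_diff[OF f Y])
      have tail: "(\<Sum>k\<in>F. (norm (L2_inner f (v k)))\<^sup>2) \<le> (sqrt \<delta>)\<^sup>2" if F: "finite F" "F \<subseteq> K - Y" for F
      proof -
        have "(\<Sum>k\<in>F. (norm (L2_inner f (v k)))\<^sup>2) + (\<Sum>k\<in>Y. (norm (L2_inner f (v k)))\<^sup>2)
          = (\<Sum>k\<in>F \<union> Y. (norm (L2_inner f (v k)))\<^sup>2)"
          using F Y by (intro sum.union_disjoint[symmetric]) auto
        also have "\<dots> \<le> V f"
          using F Y by (intro V(4)[OF f]) auto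
        finally show ?thesis using elim \<delta> by (simp add: dist_real_def)
      qed
      \<comment> \<open>The terms with index in \<open>Y\<close> are what the partial sum removes
        from \<open>f\<close>. Over \<open>K - Y\<close> the total is therefore the squared norm of
        the remainder, while the coefficients of \<open>f\<close> there form a small tail.\<close>
      have "((\<lambda>k. L2_inner f (v k) * L2_inner (u k) ?r) has_sum
        (L2_inner f ?r - (\<Sum>k\<in>Y. L2_inner f (v k) * L2_inner (u k) ?r))) (K - Y)"
        by (rule has_sum_Diff[OF weak[OF f r] has_sum_finite]) (use Y in auto)
      also have "L2_inner f ?r - (\<Sum>k\<in>Y. L2_inner f (v k) * L2_inner (u k) ?r) = L2_inner ?r ?r"
      proof -
        have uY: "u k \<in> L2" if "k \<in> Y" for k using that Y u H by blast
        have fL2: "f \<in> L2" using f H by blast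
        have "L2_inner ?r g = L2_inner f g - (\<Sum>k\<in>Y. L2_inner f (v k) * L2_inner (u k) g)" if "g \<in> L2" for g
        proof -
          have "L2_inner ?r g = L2_inner f g - L2_inner (\<lambda>x. \<Sum>k\<in>Y. L2_inner f (v k) * u k x) g"
            by (rule L2_inner_diff_left[OF fL2 _ that], rule L2_sum, rule uY)
          also have "L2_inner (\<lambda>x. \<Sum>k\<in>Y. L2_inner f (v k) * u k x) g = (\<Sum>k\<in>Y. L2_inner f (v k) * L2_inner (u k) g)"
            by (rule L2_inner_sum_left[OF uY that])
          finally show ?thesis .
        qed
        from this[OF subsetD[OF H r]] show ?thesis by (rule sym)
      qed
      finally have "norm (L2_inner ?r ?r) \<le> sqrt \<delta> * (sqrt B * L2_norm ?r)"
      proof (rule has_sum_mult_le_Cauchy_Schwarz)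
        show "(\<Sum>k\<in>F. (norm (L2_inner (u k) ?r))\<^sup>2) \<le> (sqrt B * L2_norm ?r)\<^sup>2"
          if "finite F" "F \<subseteq> K - Y" for F
          using u_Bessel[OF r, of F] that unfolding B_sqrt by (auto simp: norm_L2_inner_commute[of "u _"])
      qed (use tail \<delta> B in auto)
      then have "L2_norm ?r * L2_norm ?r \<le> (sqrt \<delta> * sqrt B) * L2_norm ?r"
        unfolding L2_inner_self norm_of_real by (simp add: power2_eq_square)
      moreover have "sqrt \<delta> * sqrt B = e / 2"
        using B e by (simp add: \<delta>_def real_sqrt_divide real_sqrt_mult)
      ultimately have "L2_norm ?r * L2_norm ?r \<le> (e / 2) * L2_norm ?r"
        by simp
      then have "L2_norm ?r \<le> e / 2"
        using e by (cases "L2_norm ?r = 0") (simp, rule mult_right_le_imp_le, simp_all add: less_le)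
      then show ?case using e by simp
    qed
  qed
  ultimately show ?thesis
    unfolding dual_frames_def by blast
qed

section \<open>Coefficients against translates, for spectra longer than one period\<close>

lemma L2_inner_translate:
  assumes "f \<in> L2" "g \<in> L2"
  shows "L2_inner f (translate (c * of_int k) g) = exp_coeff c (\<lambda>\<gamma>. fourier_L2 f \<gamma> * cnj (fourier_L2 g \<gamma>)) k"
proof -
  have [measurable]: "fourier_L2 f \<in> borel_measurable borel" "fourier_L2 g \<in> borel_measurable borel"
    "fourier_L2 (translate (c * of_int k) g) \<in> borel_measurable borel"
    using assms translate_in_L2 by auto
  have "L2_inner f (translate (c * of_int k) g) = L2_inner (fourier_L2 f) (fourier_L2 (translate (c * of_int k) g))"
    by (rule L2_inner_fourier_L2[symmetric]) (intro assms translate_in_L2)+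
  also have "\<dots> = exp_coeff c (\<lambda>\<gamma>. fourier_L2 f \<gamma> * cnj (fourier_L2 g \<gamma>)) k"
    unfolding L2_inner_def exp_coeff_def
  proof (rule integral_cong_AE)
    show "AE \<gamma> in lborel. fourier_L2 f \<gamma> * cnj (fourier_L2 (translate (c * of_int k) g) \<gamma>)
      = fourier_L2 f \<gamma> * cnj (fourier_L2 g \<gamma>) * cis (2 * pi * c * of_int k * \<gamma>)"
      using fourier_L2_translate[OF assms(2), of "c * of_int k"]
      by eventually_elim (simp add: cis_cnj mult_ac)
  qed measurable
  finally show ?thesis .
qed

lemma exp_coeff_cong_AE:
  assumes [measurable]: "f \<in> borel_measurable borel" "g \<in> borel_measurable borel" and "AE x in lborel. f x = g x"
  shows "exp_coeff c f k = exp_coeff c g k"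
  unfolding exp_coeff_def
  by (rule integral_cong_AE) (use assms(3) in auto)

text \<open>The second piece is open at \<open>m\<close>, so that the two indicators add up to that
  of the whole interval.\<close>

lemma exp_coeff_split:
  assumes f: "f \<in> L2" and supp: "AE x in lborel. x \<notin> {p..p'} \<longrightarrow> f x = 0" and "p \<le> m" "m \<le> p'"
  shows "exp_coeff c f k = exp_coeff c (\<lambda>x. indicator {p..m} x * f x) k + exp_coeff c (\<lambda>x. indicator {m<..p'} x * f x) k"
proof -
  have [measurable]: "f \<in> borel_measurable borel" using f by (rule L2_measurable)
  have "exp_coeff c f k = exp_coeff c (\<lambda>x. indicator {p..m} x * f x + 1 * (indicator {m<..p'} x * f x)) k"
    by (rule exp_coeff_cong_AE) (use supp assms(3,4) in \<open>auto split: split_indicator\<close>)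
  also have "\<dots> = exp_coeff c (\<lambda>x. indicator {p..m} x * f x) k + 1 * exp_coeff c (\<lambda>x. indicator {m<..p'} x * f x) k"
    by (rule exp_coeff_linear[of _ _ p p']) (use assms in \<open>auto intro!: L2_indicator split: split_indicator\<close>)
  finally show ?thesis by simp
qed

text \<open>The support may fill two periods \<open>1 / c\<close>, where Parseval can fail because
  different periods overlap after periodization. Each piece obeys Parseval, and squaring a sum of
  two terms costs the factor 2.\<close>

lemma exp_coeff_Bessel:
  assumes c: "c > 0" and f: "f \<in> L2" and supp: "AE x in lborel. x \<notin> {p..p'} \<longrightarrow> f x = 0"
    and m: "p \<le> m" "m \<le> p'" "m - p \<le> 1 / c" "p' - m \<le> 1 / c" and F: "finite F"
  shows "(\<Sum>k\<in>F. (norm (exp_coeff c f k))\<^sup>2) \<le> 2 * (L2_norm f)\<^sup>2 / c"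
proof -
  let ?f1 = "\<lambda>x. indicator {p..m} x * f x" and ?f2 = "\<lambda>x. indicator {m<..p'} x * f x"
  have f1: "?f1 \<in> L2" and f2: "?f2 \<in> L2"
    by (auto intro: L2_indicator f)
  have P1: "((\<lambda>k. (norm (exp_coeff c ?f1 k))\<^sup>2) has_sum (L2_norm ?f1)\<^sup>2 / c) UNIV"
    by (rule Parseval_exp_coeff[OF c f1, of p]) (use m in \<open>auto split: split_indicator\<close>)
  have P2: "((\<lambda>k. (norm (exp_coeff c ?f2 k))\<^sup>2) has_sum (L2_norm ?f2)\<^sup>2 / c) UNIV"
    by (rule Parseval_exp_coeff[OF c f2, of m]) (use m in \<open>auto split: split_indicator\<close>)
  have *: "(norm (exp_coeff c f k))\<^sup>2 \<le> 2 * (norm (exp_coeff c ?f1 k))\<^sup>2 + 2 * (norm (exp_coeff c ?f2 k))\<^sup>2" for k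
  proof -
    let ?a = "exp_coeff c ?f1 k" and ?b = "exp_coeff c ?f2 k"
    have "(norm (exp_coeff c f k))\<^sup>2 \<le> (norm ?a + norm ?b)\<^sup>2"
      unfolding exp_coeff_split[OF f supp m(1,2)] by (intro power_mono norm_triangle_ineq) auto
    also have "\<dots> \<le> 2 * (norm ?a)\<^sup>2 + 2 * (norm ?b)\<^sup>2"
      using sum_squares_bound[of "norm ?a" "norm ?b"] by (simp add: power2_sum)
    finally show ?thesis .
  qed
  have "(\<Sum>k\<in>F. (norm (exp_coeff c f k))\<^sup>2)
    \<le> 2 * (\<Sum>k\<in>F. (norm (exp_coeff c ?f1 k))\<^sup>2) + 2 * (\<Sum>k\<in>F. (norm (exp_coeff c ?f2 k))\<^sup>2)"
    using sum_mono[of F, OF *] by (simp add: sum.distrib sum_distrib_left)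
  also have "\<dots> \<le> 2 * ((L2_norm ?f1)\<^sup>2 / c) + 2 * ((L2_norm ?f2)\<^sup>2 / c)"
    by (intro add_mono mult_left_mono finite_sum_le_has_sum[OF P1] finite_sum_le_has_sum[OF P2]) (use F in auto)
  also have "\<dots> = 2 * ((L2_norm ?f1)\<^sup>2 + (L2_norm ?f2)\<^sup>2) / c"
    by (simp add: distrib_left add_divide_distrib)
  also have "(L2_norm ?f1)\<^sup>2 + (L2_norm ?f2)\<^sup>2 = (LINT x|lborel. (norm (?f1 x))\<^sup>2 + (norm (?f2 x))\<^sup>2)"
    unfolding L2_norm_square using L2_integrable[OF f1] L2_integrable[OF f2] by simp
  also have "\<dots> \<le> (L2_norm f)\<^sup>2"
    unfolding L2_norm_square
  proof (rule integral_mono)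
    show "integrable lborel (\<lambda>x. (norm (?f1 x))\<^sup>2 + (norm (?f2 x))\<^sup>2)"
      using L2_integrable[OF f1] L2_integrable[OF f2] by (rule Bochner_Integration.integrable_add)
    show "(norm (?f1 x))\<^sup>2 + (norm (?f2 x))\<^sup>2 \<le> (norm (f x))\<^sup>2" for x
      by (auto split: split_indicator)
  qed (rule L2_integrable[OF f])
  finally show ?thesis using c by (simp add: divide_right_mono)
qed

text \<open>Only the part of \<open>f\<close> on \<open>{p..q'}\<close> interacts with \<open>g\<close>: the part on \<open>{q'<..p'}\<close> shares with \<open>g\<close> an interval of
  length at most \<open>1 / c\<close>, on which Parseval applies and the two have disjoint supports.\<close>

lemma exp_coeff_inner_has_sum:
  assumes c: "c > 0" and f: "f \<in> L2" and g: "g \<in> L2"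
    and supp: "AE x in lborel. x \<notin> {p..p'} \<longrightarrow> f x = 0" "AE x in lborel. x \<notin> {q..q'} \<longrightarrow> g x = 0"
    and order: "p \<le> q" "q \<le> q'" "q' \<le> p'" "q' - p \<le> 1 / c" "p' - q \<le> 1 / c"
  shows "((\<lambda>k. exp_coeff c f k * cnj (exp_coeff c g k)) has_sum L2_inner f g / of_real c) UNIV"
proof -
  let ?f1 = "\<lambda>x. indicator {p..q'} x * f x" and ?f2 = "\<lambda>x. indicator {q'<..p'} x * f x"
  let ?g = "\<lambda>x. indicator {q..q'} x * g x"
  have [measurable]: "f \<in> borel_measurable borel" "g \<in> borel_measurable borel"
    using f g by (auto intro: L2_measurable)
  have L2: "?f1 \<in> L2" "?f2 \<in> L2" "?g \<in> L2"
    by (auto intro: L2_indicator f g)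
  have g_eq: "exp_coeff c g k = exp_coeff c ?g k" for k
    by (rule exp_coeff_cong_AE) (use supp(2) in \<open>auto split: split_indicator\<close>)
  have "((\<lambda>k. exp_coeff c ?f1 k * cnj (exp_coeff c ?g k)) has_sum L2_inner ?f1 ?g / of_real c) UNIV"
    by (rule Parseval_exp_coeff_polarized[OF c L2(1,3), of p]) (use order in \<open>auto split: split_indicator\<close>)
  moreover have "((\<lambda>k. exp_coeff c ?f2 k * cnj (exp_coeff c ?g k)) has_sum L2_inner ?f2 ?g / of_real c) UNIV"
    by (rule Parseval_exp_coeff_polarized[OF c L2(2,3), of q]) (use order in \<open>auto split: split_indicator\<close>)
  ultimately have "((\<lambda>k. exp_coeff c ?f1 k * cnj (exp_coeff c ?g k) + exp_coeff c ?f2 k * cnj (exp_coeff c ?g k))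
      has_sum (L2_inner ?f1 ?g / of_real c + L2_inner ?f2 ?g / of_real c)) UNIV"
    by (rule has_sum_add)
  also have "L2_inner ?f1 ?g = L2_inner f g"
    unfolding L2_inner_def
    by (rule integral_cong_AE) (use supp order in \<open>auto split: split_indicator\<close>)
  also have "L2_inner ?f2 ?g = 0"
    unfolding L2_inner_def
    by (rule integral_eq_zero_AE) (use order in \<open>auto split: split_indicator\<close>)
  finally show ?thesis
    using order unfolding exp_coeff_split[OF f supp(1) order_trans[OF order(1,2)] order(3)] g_eq
    by (simp add: distrib_right)
qed

text \<open>Dominated convergence is used along sequences, while sums over \<open>J\<close> are
  limits along finite subsets; countability supplies a sequence cofinal among these.\<close>

lemma countable_exhausting_finite:
  assumes "countable J"
  obtains F :: "nat \<Rightarrow> 'a set" where "\<And>n. finite (F n)" "\<And>n. F n \<subseteq> J" "filterlim F (finite_subsets_at_top J) sequentially"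
proof -
  define F where "F n = {j \<in> J. to_nat_on J j < n}" for n
  have inj: "inj_on (to_nat_on J) J" using assms by (rule inj_on_to_nat_on)
  have fin: "finite (F n)" for n
    by (rule inj_on_finite[OF inj_on_subset[OF inj], of _ "{..<n}"]) (auto simp: F_def)
  have sub: "F n \<subseteq> J" for n by (auto simp: F_def)
  have lim: "filterlim F (finite_subsets_at_top J) sequentially"
    unfolding filterlim_finite_subsets_at_top
  proof (intro allI impI)
    fix X assume X: "finite X \<and> X \<subseteq> J"
    define M where "M = Max (insert 0 (to_nat_on J ` X))"
    have M: "to_nat_on J j \<le> M" if "j \<in> X" for j
      unfolding M_def using X that by (intro Max_ge) auto
    show "\<forall>\<^sub>F n in sequentially. finite (F n) \<and> X \<subseteq> F n \<and> F n \<subseteq> J"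
      using eventually_gt_at_top[of M]
    proof eventually_elim
      case (elim n)
      have "j \<in> F n" if "j \<in> X" for j
        using M[OF that] elim X that by (auto simp: F_def)
      then show ?case using fin sub by auto
    qed
  qed
  from fin sub lim show thesis by (rule that)
qed

lemma AE_norm_le_of_sum_square:
  assumes "c > 0" "AE \<gamma> in lborel. (norm (W \<gamma> :: complex))\<^sup>2 / c \<le> B"
  shows "AE \<gamma> in lborel. norm (cnj (W \<gamma>)) \<le> sqrt (B * c)"
  using assms(2)
proof eventually_elim
  case (elim \<gamma>)
  then have "(norm (W \<gamma>))\<^sup>2 \<le> B * c"
    using assms(1) by (simp add: field_simps)
  then show ?case by (simp add: real_le_rsqrt)
qed

text \<open>The bound makes the transform of \<open>w\<close> an essentially bounded multiplier, so
  the product stays square integrable.\<close>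

lemma L2_mult_cnj_fourier:
  assumes "f \<in> L2" "w \<in> L2" "c > 0" "AE \<gamma> in lborel. (norm (fourier_L2 w \<gamma>))\<^sup>2 / c \<le> B"
  shows "(\<lambda>\<gamma>. fourier_L2 f \<gamma> * cnj (fourier_L2 w \<gamma>)) \<in> L2"
proof -
  have [measurable]: "fourier_L2 w \<in> borel_measurable borel"
    using assms(2) by (rule fourier_L2_measurable)
  have "(\<lambda>\<gamma>. cnj (fourier_L2 w \<gamma>) * fourier_L2 f \<gamma>) \<in> L2"
    by (rule L2_mult_bounded[OF _ _ AE_norm_le_of_sum_square[OF assms(3,4)]])
      (auto intro: fourier_L2_in_L2 assms)
  then show ?thesis by (simp add: mult.commute)
qed

text \<open>For one generator the squared coefficients sum to at most twice the squared norm of the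
  product of the transforms, divided by \<open>c j\<close>. Summed over \<open>j\<close>, these
  products amount to a multiplier bounded by \<open>B\<close>.\<close>

lemma translates_Bessel:
  fixes c :: "'j \<Rightarrow> real"
  assumes c: "\<And>j. j \<in> J \<Longrightarrow> c j > 0" and w: "\<And>j. j \<in> J \<Longrightarrow> w j \<in> L2"
    and supp: "\<And>j. j \<in> J \<Longrightarrow> AE \<gamma> in lborel. \<gamma> \<notin> {p j..p' j} \<longrightarrow> fourier_L2 (w j) \<gamma> = 0"
    and order: "\<And>j. j \<in> J \<Longrightarrow> p j \<le> m j \<and> m j \<le> p' j \<and> m j - p j \<le> 1 / c j \<and> p' j - m j \<le> 1 / c j"
    and B: "\<And>F. finite F \<Longrightarrow> F \<subseteq> J \<Longrightarrow> AE \<gamma> in lborel. (\<Sum>j\<in>F. (norm (fourier_L2 (w j) \<gamma>))\<^sup>2 / c j) \<le> B"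
    and f: "f \<in> L2" and F: "finite F" "F \<subseteq> UNIV \<times> J"
  shows "(\<Sum>x\<in>F. (norm (L2_inner f (case x of (k :: int, j) \<Rightarrow> translate (c j * of_int k) (w j))))\<^sup>2) \<le> 2 * B * (L2_norm f)\<^sup>2"
proof -
  \<comment> \<open>Enlarging \<open>F\<close> to the rectangle \<open>A \<times> X\<close>
    separates translation index and generator; the added terms are nonnegative.\<close>
  define X where "X = snd ` F"
  define A where "A = fst ` F"
  have X: "finite X" "X \<subseteq> J" and A: "finite A" and FAX: "F \<subseteq> A \<times> X"
    using F by (force simp: X_def A_def)+
  let ?\<Phi> = "\<lambda>j \<gamma>. fourier_L2 f \<gamma> * cnj (fourier_L2 (w j) \<gamma>)"
  have Bj: "AE \<gamma> in lborel. (norm (fourier_L2 (w j) \<gamma>))\<^sup>2 / c j \<le> B" if "j \<in> J" for j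
    using B[of "{j}"] that by simp
  have \<Phi>: "?\<Phi> j \<in> L2" if "j \<in> J" for j
    using that by (intro L2_mult_cnj_fourier[where c = "c j" and B = B] f w c Bj)
  have "(\<Sum>x\<in>F. (norm (L2_inner f (case x of (k, j) \<Rightarrow> translate (c j * of_int k) (w j))))\<^sup>2)
    \<le> (\<Sum>x\<in>A \<times> X. (norm (L2_inner f (case x of (k, j) \<Rightarrow> translate (c j * of_int k) (w j))))\<^sup>2)"
    using FAX A X by (intro sum_mono2) auto
  also have "\<dots> = (\<Sum>k\<in>A. \<Sum>j\<in>X. (norm (L2_inner f (translate (c j * of_int k) (w j))))\<^sup>2)"
    by (simp add: sum.cartesian_product case_prod_unfold)
  also have "\<dots> = (\<Sum>j\<in>X. \<Sum>k\<in>A. (norm (L2_inner f (translate (c j * of_int k) (w j))))\<^sup>2)"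
    by (rule sum.swap)
  also have "\<dots> = (\<Sum>j\<in>X. \<Sum>k\<in>A. (norm (exp_coeff (c j) (?\<Phi> j) k))\<^sup>2)"
    using X f w by (intro sum.cong refl) (auto simp: L2_inner_translate)
  also have "\<dots> \<le> (\<Sum>j\<in>X. 2 * (L2_norm (?\<Phi> j))\<^sup>2 / c j)"
  proof (rule sum_mono)
    fix j assume "j \<in> X"
    then have j: "j \<in> J" using X by auto
    show "(\<Sum>k\<in>A. (norm (exp_coeff (c j) (?\<Phi> j) k))\<^sup>2) \<le> 2 * (L2_norm (?\<Phi> j))\<^sup>2 / c j"
      by (rule exp_coeff_Bessel[OF c[OF j] \<Phi>[OF j], of "p j" "p' j" "m j"]) (use supp[OF j] order[OF j] A in auto)
  qed
  also have "\<dots> = 2 * (\<Sum>j\<in>X. LINT \<gamma>|lborel. (norm (?\<Phi> j \<gamma>))\<^sup>2 / c j)"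
    by (simp add: L2_norm_square sum_distrib_left)
  also have "\<dots> = 2 * (LINT \<gamma>|lborel. (\<Sum>j\<in>X. (norm (?\<Phi> j \<gamma>))\<^sup>2 / c j))"
    using X \<Phi> L2_integrable by (subst Bochner_Integration.integral_sum) auto
  also have "\<dots> \<le> 2 * (LINT \<gamma>|lborel. B * (norm (fourier_L2 f \<gamma>))\<^sup>2)"
  proof (intro mult_left_mono integral_mono_AE)
    show "integrable lborel (\<lambda>\<gamma>. \<Sum>j\<in>X. (norm (?\<Phi> j \<gamma>))\<^sup>2 / c j)"
      using X \<Phi> L2_integrable by (intro Bochner_Integration.integrable_sum) auto
    show "integrable lborel (\<lambda>\<gamma>. B * (norm (fourier_L2 f \<gamma>))\<^sup>2)"
      using L2_integrable[OF fourier_L2_in_L2[OF f]] by simp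
    show "AE \<gamma> in lborel. (\<Sum>j\<in>X. (norm (?\<Phi> j \<gamma>))\<^sup>2 / c j) \<le> B * (norm (fourier_L2 f \<gamma>))\<^sup>2"
      using B[OF X]
    proof eventually_elim
      case (elim \<gamma>)
      have "(\<Sum>j\<in>X. (norm (?\<Phi> j \<gamma>))\<^sup>2 / c j) = (\<Sum>j\<in>X. (norm (fourier_L2 (w j) \<gamma>))\<^sup>2 / c j) * (norm (fourier_L2 f \<gamma>))\<^sup>2"
        unfolding sum_distrib_right norm_mult power_mult_distrib complex_mod_cnj by (rule sum.cong[OF refl]) simp
      also have "\<dots> \<le> B * (norm (fourier_L2 f \<gamma>))\<^sup>2"
        by (rule mult_right_mono[OF elim]) simp
      finally show ?case .
    qed
  qed simp
  also have "\<dots> = 2 * B * (L2_norm f)\<^sup>2"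
    using L2_norm_fourier_L2[OF f] by (simp flip: L2_norm_square)
  finally show ?thesis .
qed

text \<open>The intervals from \<open>q j\<close> to \<open>q' j\<close> and from \<open>p j\<close>
  to \<open>p' j\<close> carry the spectra of \<open>g j\<close> and \<open>h j\<close>. The length
  conditions concern the two mixed intervals, so the spectrum of \<open>h j\<close> may itself be
  longer than \<open>1 / c j\<close>.\<close>

lemma dual_frames_translates:
  fixes J :: "'j set" and c :: "'j \<Rightarrow> real" and p q q' p' :: "'j \<Rightarrow> real"
  assumes J: "countable J" and c: "\<And>j. j \<in> J \<Longrightarrow> c j > 0"
    and g: "\<And>j. j \<in> J \<Longrightarrow> g j \<in> L2_check S" and h: "\<And>j. j \<in> J \<Longrightarrow> h j \<in> L2_check S"
    and g_supp: "\<And>j. j \<in> J \<Longrightarrow> AE \<gamma> in lborel. \<gamma> \<notin> {q j..q' j} \<longrightarrow> fourier_L2 (g j) \<gamma> = 0"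
    and h_supp: "\<And>j. j \<in> J \<Longrightarrow> AE \<gamma> in lborel. \<gamma> \<notin> {p j..p' j} \<longrightarrow> fourier_L2 (h j) \<gamma> = 0"
    and order: "\<And>j. j \<in> J \<Longrightarrow> p j \<le> q j \<and> q j \<le> q' j \<and> q' j \<le> p' j"
    and lengths: "\<And>j. j \<in> J \<Longrightarrow> q' j - p j \<le> 1 / c j \<and> p' j - q j \<le> 1 / c j"
    and B0: "0 \<le> B"
    and g_bound: "\<And>F. finite F \<Longrightarrow> F \<subseteq> J \<Longrightarrow> AE \<gamma> in lborel. (\<Sum>j\<in>F. (norm (fourier_L2 (g j) \<gamma>))\<^sup>2 / c j) \<le> B"
    and h_bound: "\<And>F. finite F \<Longrightarrow> F \<subseteq> J \<Longrightarrow> AE \<gamma> in lborel. (\<Sum>j\<in>F. (norm (fourier_L2 (h j) \<gamma>))\<^sup>2 / c j) \<le> B"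
    and dual: "AE \<gamma> in lborel. \<gamma> \<in> S \<longrightarrow>
      ((\<lambda>j. fourier_L2 (g j) \<gamma> * cnj (fourier_L2 (h j) \<gamma>) / of_real (c j)) has_sum 1) J"
  shows "dual_frames (L2_check S) (UNIV \<times> J)
           (\<lambda>(k::int, j). translate (c j * of_int k) (g j))
           (\<lambda>(k::int, j). translate (c j * of_int k) (h j))"
proof -
  have H: "L2_check S \<subseteq> L2" by (auto simp: L2_check_def)
  have gL2: "g j \<in> L2" and hL2: "h j \<in> L2" if "j \<in> J" for j
    using g[OF that] h[OF that] H by auto
  have [measurable]: "f \<in> L2 \<Longrightarrow> fourier_L2 f \<in> borel_measurable borel" for f
    by (rule fourier_L2_measurable)
  define B' where "B' = 2 * B + 1"
  have B': "B' > 0" using B0 by (simp add: B'_def)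
  let ?u = "\<lambda>(k::int, j). translate (c j * of_int k) (g j)" and ?v = "\<lambda>(k::int, j). translate (c j * of_int k) (h j)"
  have le_B': "2 * B * (L2_norm f)\<^sup>2 \<le> B' * (L2_norm f)\<^sup>2" for f
    by (rule mult_right_mono) (auto simp: B'_def)
  have g_Bessel: "(\<Sum>x\<in>F. (norm (L2_inner f (?u x)))\<^sup>2) \<le> B' * (L2_norm f)\<^sup>2"
    if "f \<in> L2" "finite F" "F \<subseteq> UNIV \<times> J" for f F
  proof -
    have "(\<Sum>x\<in>F. (norm (L2_inner f (?u x)))\<^sup>2) \<le> 2 * B * (L2_norm f)\<^sup>2"
    proof (rule translates_Bessel[OF c gL2 g_supp _ g_bound that])
      \<comment> \<open>The spectrum of \<open>g j\<close> fits one period, so it is split at its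
        right end and the second piece is void.\<close>
      show "q j \<le> q' j \<and> q' j \<le> q' j \<and> q' j - q j \<le> 1 / c j \<and> q' j - q' j \<le> 1 / c j" if "j \<in> J" for j
        using order[OF that] lengths[OF that] c[OF that] by (smt (verit) zero_le_divide_1_iff)
    qed
    with le_B'[of f] show ?thesis by linarith
  qed
  have h_Bessel: "(\<Sum>x\<in>F. (norm (L2_inner f (?v x)))\<^sup>2) \<le> B' * (L2_norm f)\<^sup>2"
    if "f \<in> L2" "finite F" "F \<subseteq> UNIV \<times> J" for f F
  proof -
    have "(\<Sum>x\<in>F. (norm (L2_inner f (?v x)))\<^sup>2) \<le> 2 * B * (L2_norm f)\<^sup>2"
    proof (rule translates_Bessel[OF c hL2 h_supp _ h_bound that])
      \<comment> \<open>The spectrum of \<open>h j\<close> is cut at the right end of that of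
        \<open>g j\<close>; each piece lies in one of the two mixed intervals.\<close>
      show "p j \<le> q' j \<and> q' j \<le> p' j \<and> q' j - p j \<le> 1 / c j \<and> p' j - q' j \<le> 1 / c j" if "j \<in> J" for j
        using order[OF that] lengths[OF that] by linarith
    qed
    with le_B'[of f] show ?thesis by linarith
  qed
  show ?thesis
  proof (rule dual_framesI[OF H _ _ _ B'])
    show u: "?u x \<in> L2_check S" if "x \<in> UNIV \<times> J" for x
      using that by (auto intro: translate_L2_check g)
    show v: "?v x \<in> L2_check S" if "x \<in> UNIV \<times> J" for x
      using that by (auto intro: translate_L2_check h)
    show "(\<lambda>x. f x - (\<Sum>k\<in>F. z k * ?u k x)) \<in> L2_check S"
      if "f \<in> L2_check S" "finite F" "F \<subseteq> UNIV \<times> J" for f F z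
      by (rule L2_check_diff_sum[OF that(1)]) (use u that(3) in blast)
    show "(\<Sum>x\<in>F. (norm (L2_inner f (?u x)))\<^sup>2) \<le> B' * (L2_norm f)\<^sup>2"
      "(\<Sum>x\<in>F. (norm (L2_inner f (?v x)))\<^sup>2) \<le> B' * (L2_norm f)\<^sup>2"
      if "f \<in> L2_check S" "finite F" "F \<subseteq> UNIV \<times> J" for f F
      using g_Bessel[of f F] h_Bessel[of f F] that H by auto
    fix f \<phi> assume "f \<in> L2_check S" "\<phi> \<in> L2_check S"
    then have f: "f \<in> L2" and \<phi>: "\<phi> \<in> L2" and f_S: "AE \<gamma> in lborel. \<gamma> \<in> - S \<longrightarrow> fourier_L2 f \<gamma> = 0"
      by (auto simp: L2_check_def vanishes_on_def)
    note [measurable] = fourier_L2_measurable[OF f] fourier_L2_measurable[OF \<phi>]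
    let ?a = "\<lambda>x. L2_inner f (?v x) * L2_inner (?u x) \<phi>"
    \<comment> \<open>Absolute summability over all pairs, from Cauchy-Schwarz and the two Bessel
      bounds, permits summation over the translates of one generator at a time.\<close>
    have "?a summable_on (UNIV \<times> J)"
    proof (rule abs_summable_summable, rule nonneg_bounded_partial_sums_imp_summable_on)
      show "\<forall>\<^sub>F X in finite_subsets_at_top (UNIV \<times> J). (\<Sum>x\<in>X. norm (?a x)) \<le> (sqrt B' * L2_norm f) * (sqrt B' * L2_norm \<phi>)"
      proof (rule eventually_finite_subsets_at_top_weakI, rule sum_mult_le_Cauchy_Schwarz)
        fix F :: "(int \<times> 'j) set" assume F: "finite F" "F \<subseteq> UNIV \<times> J"
        show "(\<Sum>x\<in>F. (norm (L2_inner f (?v x)))\<^sup>2) \<le> (sqrt B' * L2_norm f)\<^sup>2"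
          using h_Bessel[OF f F] B' by (simp add: power_mult_distrib)
        show "(\<Sum>x\<in>F. (norm (L2_inner (?u x) \<phi>))\<^sup>2) \<le> (sqrt B' * L2_norm \<phi>)\<^sup>2"
          using g_Bessel[OF \<phi> F] B' by (simp add: power_mult_distrib norm_L2_inner_commute[of _ \<phi>])
      qed (use B' in auto)
    qed auto
    then have sum: "(?a has_sum infsum ?a (UNIV \<times> J)) (UNIV \<times> J)"
      by (rule has_sum_infsum)
    define s where "s = infsum ?a (UNIV \<times> J)"
    define t where "t j = L2_inner (\<lambda>\<gamma>. fourier_L2 f \<gamma> * cnj (fourier_L2 (h j) \<gamma>))
        (\<lambda>\<gamma>. fourier_L2 \<phi> \<gamma> * cnj (fourier_L2 (g j) \<gamma>)) / of_real (c j)" for j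
    have gj: "AE \<gamma> in lborel. (norm (fourier_L2 (g j) \<gamma>))\<^sup>2 / c j \<le> B"
      and hj: "AE \<gamma> in lborel. (norm (fourier_L2 (h j) \<gamma>))\<^sup>2 / c j \<le> B" if "j \<in> J" for j
      using g_bound[of "{j}"] h_bound[of "{j}"] that by auto
    have inner: "((\<lambda>k. ?a (k, j)) has_sum t j) UNIV" if j: "j \<in> J" for j
    proof -
      have "((\<lambda>k. exp_coeff (c j) (\<lambda>\<gamma>. fourier_L2 f \<gamma> * cnj (fourier_L2 (h j) \<gamma>)) k
          * cnj (exp_coeff (c j) (\<lambda>\<gamma>. fourier_L2 \<phi> \<gamma> * cnj (fourier_L2 (g j) \<gamma>)) k)) has_sum t j) UNIV"
        unfolding t_def
        by (rule exp_coeff_inner_has_sum[where p = "p j" and p' = "p' j" and q = "q j" and q' = "q' j"])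
          (use g_supp[OF j] h_supp[OF j] order[OF j] lengths[OF j] in
            \<open>auto intro!: L2_mult_cnj_fourier[where c = "c j" and B = B] f \<phi> gL2 hL2 c gj hj j\<close>)
      moreover have "?a (k, j) = exp_coeff (c j) (\<lambda>\<gamma>. fourier_L2 f \<gamma> * cnj (fourier_L2 (h j) \<gamma>)) k
          * cnj (exp_coeff (c j) (\<lambda>\<gamma>. fourier_L2 \<phi> \<gamma> * cnj (fourier_L2 (g j) \<gamma>)) k)" for k
        using L2_inner_translate[OF f hL2[OF j], of "c j" k] L2_inner_translate[OF \<phi> gL2[OF j], of "c j" k]
        by (simp add: L2_inner_cnj[of "translate _ _" \<phi>])
      ultimately show ?thesis by simp
    qed
    have "((\<lambda>x. ?a (snd x, fst x)) has_sum s) (J \<times> UNIV)"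
      using sum[folded s_def] has_sum_swap[where f = ?a and S = s and A = UNIV and B = J] by (simp add: case_prod_unfold)
    then have t_sum: "(t has_sum s) J"
      by (rule has_sum_SigmaD) (use inner in simp)
    obtain F :: "nat \<Rightarrow> 'j set" where F: "\<And>n. finite (F n)" "\<And>n. F n \<subseteq> J" "filterlim F (finite_subsets_at_top J) sequentially"
      using countable_exhausting_finite[OF J] by blast
    let ?w = "\<lambda>j \<gamma>. fourier_L2 (g j) \<gamma> * cnj (fourier_L2 (h j) \<gamma>) / of_real (c j)"
    let ?\<Phi> = "\<lambda>\<gamma>. fourier_L2 f \<gamma> * cnj (fourier_L2 \<phi> \<gamma>)"
    have t_eq: "t j = (LINT \<gamma>|lborel. ?\<Phi> \<gamma> * ?w j \<gamma>)" and t_int: "integrable lborel (\<lambda>\<gamma>. ?\<Phi> \<gamma> * ?w j \<gamma>)" if j: "j \<in> J" for j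
    proof -
      have "integrable lborel (\<lambda>\<gamma>. fourier_L2 f \<gamma> * cnj (fourier_L2 (h j) \<gamma>) * cnj (fourier_L2 \<phi> \<gamma> * cnj (fourier_L2 (g j) \<gamma>)) / of_real (c j))"
        by (intro integrable_divide L2_inner_integrable L2_mult_cnj_fourier[where c = "c j" and B = B] f \<phi> gL2 hL2 c gj hj j)
      then show "integrable lborel (\<lambda>\<gamma>. ?\<Phi> \<gamma> * ?w j \<gamma>)"
        by (simp add: mult_ac)
      show "t j = (LINT \<gamma>|lborel. ?\<Phi> \<gamma> * ?w j \<gamma>)"
        unfolding t_def L2_inner_def integral_divide_zero[symmetric]
        by (rule Bochner_Integration.integral_cong) (auto simp: mult_ac)
    qed
    have "(\<lambda>n. \<Sum>j\<in>F n. t j) \<longlonglongrightarrow> s"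
      using t_sum F(3) unfolding has_sum_def by (rule filterlim_compose)
    moreover have "(\<lambda>n. \<Sum>j\<in>F n. t j) \<longlonglongrightarrow> (LINT \<gamma>|lborel. ?\<Phi> \<gamma>)"
    proof -
      have "(\<Sum>j\<in>F n. t j) = (LINT \<gamma>|lborel. (\<Sum>j\<in>F n. ?\<Phi> \<gamma> * ?w j \<gamma>))" for n
        using F(2)[of n] t_int by (subst Bochner_Integration.integral_sum) (auto simp: t_eq intro!: sum.cong)
      moreover have "(\<lambda>n. LINT \<gamma>|lborel. (\<Sum>j\<in>F n. ?\<Phi> \<gamma> * ?w j \<gamma>)) \<longlonglongrightarrow> (LINT \<gamma>|lborel. ?\<Phi> \<gamma>)"
      proof (rule integral_dominated_convergence)
        show "integrable lborel (\<lambda>\<gamma>. B * norm (?\<Phi> \<gamma>))"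
          by (intro integrable_mult_right integrable_norm L2_inner_integrable fourier_L2_in_L2 f \<phi>)
        show "?\<Phi> \<in> borel_measurable lborel" by measurable
        show "(\<lambda>\<gamma>. \<Sum>j\<in>F n. ?\<Phi> \<gamma> * ?w j \<gamma>) \<in> borel_measurable lborel" for n
          by (intro borel_measurable_sum borel_measurable_integrable t_int) (use F(2) in blast)
        \<comment> \<open>On \<open>S\<close> the multipliers sum to 1; off \<open>S\<close> both
          sides vanish together with the transform of \<open>f\<close>.\<close>
        show "AE \<gamma> in lborel. (\<lambda>n. \<Sum>j\<in>F n. ?\<Phi> \<gamma> * ?w j \<gamma>) \<longlonglongrightarrow> ?\<Phi> \<gamma>"
          using dual f_S
        proof eventually_elim
          case (elim \<gamma>)
          show ?case
          proof (cases "\<gamma> \<in> S")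
            case True
            with elim have "((\<lambda>j. ?w j \<gamma>) has_sum 1) J" by blast
            then have "((\<lambda>j. ?\<Phi> \<gamma> * ?w j \<gamma>) has_sum (?\<Phi> \<gamma> * 1)) J"
              by (rule has_sum_cmult_right)
            then show ?thesis
              using F(3) unfolding has_sum_def mult_1_right by (rule filterlim_compose)
          next
            case False
            with elim show ?thesis by simp
          qed
        qed
        \<comment> \<open>The absolute values of the multipliers sum to at most the mean of the two
          square sums, hence to at most \<open>B\<close>, for each \<open>F n\<close>.\<close>
        show "AE \<gamma> in lborel. norm (\<Sum>j\<in>F n. ?\<Phi> \<gamma> * ?w j \<gamma>) \<le> B * norm (?\<Phi> \<gamma>)" for n
          using g_bound[OF F(1)[of n] F(2)] h_bound[OF F(1)[of n] F(2)]
        proof eventually_elim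
          case (elim \<gamma>)
          have "(\<Sum>j\<in>F n. norm (?w j \<gamma>))
            \<le> (\<Sum>j\<in>F n. ((norm (fourier_L2 (g j) \<gamma>))\<^sup>2 / c j + (norm (fourier_L2 (h j) \<gamma>))\<^sup>2 / c j) / 2)"
          proof (rule sum_mono)
            fix j assume "j \<in> F n"
            then have cj: "c j > 0" using c F(2) by blast
            have "2 * norm (fourier_L2 (g j) \<gamma>) * norm (fourier_L2 (h j) \<gamma>)
              \<le> (norm (fourier_L2 (g j) \<gamma>))\<^sup>2 + (norm (fourier_L2 (h j) \<gamma>))\<^sup>2"
              by (rule sum_squares_bound)
            then have "norm (fourier_L2 (g j) \<gamma>) * norm (fourier_L2 (h j) \<gamma>) / c j
              \<le> ((norm (fourier_L2 (g j) \<gamma>))\<^sup>2 + (norm (fourier_L2 (h j) \<gamma>))\<^sup>2) / 2 / c j"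
              using cj by (intro divide_right_mono) auto
            with cj show "norm (?w j \<gamma>) \<le> ((norm (fourier_L2 (g j) \<gamma>))\<^sup>2 / c j + (norm (fourier_L2 (h j) \<gamma>))\<^sup>2 / c j) / 2"
              by (simp add: norm_mult norm_divide add_divide_distrib)
          qed
          also have "\<dots> = ((\<Sum>j\<in>F n. (norm (fourier_L2 (g j) \<gamma>))\<^sup>2 / c j) + (\<Sum>j\<in>F n. (norm (fourier_L2 (h j) \<gamma>))\<^sup>2 / c j)) / 2"
            by (simp only: sum.distrib sum_divide_distrib[symmetric])
          also have "\<dots> \<le> B"
            using add_mono[OF elim] by simp
          finally have w_le: "(\<Sum>j\<in>F n. norm (?w j \<gamma>)) \<le> B" .
          have "norm (\<Sum>j\<in>F n. ?\<Phi> \<gamma> * ?w j \<gamma>) = norm (?\<Phi> \<gamma>) * norm (\<Sum>j\<in>F n. ?w j \<gamma>)"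
            unfolding sum_distrib_left[symmetric] by (rule norm_mult)
          also have "\<dots> \<le> norm (?\<Phi> \<gamma>) * B"
            by (rule mult_left_mono[OF order_trans[OF norm_sum w_le] norm_ge_zero])
          finally show ?case
            by (simp only: mult.commute)
        qed
      qed
      ultimately show ?thesis by (simp only:)
    qed
    ultimately have "s = L2_inner (fourier_L2 f) (fourier_L2 \<phi>)"
      unfolding L2_inner_def by (rule LIMSEQ_unique)
    then have "s = L2_inner f \<phi>"
      using L2_inner_fourier_L2[OF f \<phi>] by simp
    with sum[folded s_def] show "(?a has_sum L2_inner f \<phi>) (UNIV \<times> J)"
      by (simp only:)
  qed
qed

section \<open>Partitions of unity with a bounded overlap\<close>

lemma int_mono_of_step:
  fixes x :: "int \<Rightarrow> 'a :: order"
  assumes "\<And>k. x k \<le> x (k + 1)" "k \<le> l"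
  shows "x k \<le> x l"
  using assms(2)
proof (induction l rule: int_ge_induct)
  case (step l)
  show ?case by (rule order_trans[OF step.IH assms(1)])
qed simp

text \<open>Some knots lie below \<open>\<gamma>\<close> and some above, so by monotonicity the
  indices of those below form a half-line with a last element. Strictness at \<open>\<beta>\<close>
  matters: no knot exceeds the right end.\<close>

lemma knot_window:
  fixes x :: "int \<Rightarrow> real"
  assumes mono: "\<And>k. x k \<le> x (k + 1)"
    and lim: "((\<lambda>k. ereal (x k)) \<longlongrightarrow> \<alpha>) at_bot" "((\<lambda>k. ereal (x k)) \<longlongrightarrow> \<beta>) at_top"
    and \<gamma>: "\<alpha> < ereal \<gamma>" "ereal \<gamma> < \<beta>"
  obtains k0 where "\<And>k. x k < \<gamma> \<longleftrightarrow> k \<le> k0"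
proof -
  have "\<forall>\<^sub>F k in at_bot. ereal (x k) < ereal \<gamma>"
    by (rule order_tendstoD(2)[OF lim(1) \<gamma>(1)])
  then obtain l where l: "x l < \<gamma>"
    by (auto simp: eventually_at_bot_linorder)
  have "\<forall>\<^sub>F k in at_top. ereal \<gamma> < ereal (x k)"
    by (rule order_tendstoD(1)[OF lim(2) \<gamma>(2)])
  then obtain m where m: "\<gamma> < x m"
    by (auto simp: eventually_at_top_linorder)
  let ?K = "{k \<in> {l..m}. x k < \<gamma>}"
  have below_m: "k < m" if "x k < \<gamma>" for k
    using int_mono_of_step[of x m k, OF mono] m that by (cases "m \<le> k") auto
  have K: "finite ?K" "l \<in> ?K"
  proof -
    show "finite ?K" by (rule finite_subset[of _ "{l..m}"]) auto
    show "l \<in> ?K" using l below_m[OF l] by simp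
  qed
  have "x k < \<gamma> \<longleftrightarrow> k \<le> Max ?K" for k
  proof
    assume k: "x k < \<gamma>"
    show "k \<le> Max ?K"
    proof (cases "l \<le> k")
      case True
      then show ?thesis using k below_m[OF k] K by (intro Max_ge) auto
    next
      case False
      then show ?thesis using Max_ge[OF K] by linarith
    qed
  next
    assume "k \<le> Max ?K"
    then have "x k \<le> x (Max ?K)" by (rule int_mono_of_step[of x, OF mono])
    also have "\<dots> < \<gamma>" using Max_in[of ?K] K by blast
    finally show "x k < \<gamma>" .
  qed
  then show thesis by (rule that)
qed

text \<open>Adding the double sum to its transpose pairs the weights, so twice the sum is the double
  sum with constant weight 2. The case \<open>k = l\<close> of the hypothesis says that
  \<open>b k 0\<close> is 1.\<close>

lemma symmetric_weights_sum:
  fixes u :: "int \<Rightarrow> complex" and b :: "int \<Rightarrow> int \<Rightarrow> complex"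
  assumes "\<And>k l. k \<in> W \<Longrightarrow> l \<in> W \<Longrightarrow> b k (l - k) + b l (k - l) = 2"
  shows "(\<Sum>k\<in>W. \<Sum>l\<in>W. u k * (u l * b k (l - k))) = (\<Sum>k\<in>W. u k)\<^sup>2"
proof -
  let ?L = "\<Sum>k\<in>W. \<Sum>l\<in>W. u k * (u l * b k (l - k))"
  have "2 * ?L = ?L + (\<Sum>k\<in>W. \<Sum>l\<in>W. u l * (u k * b l (k - l)))"
    by (subst (2) sum.swap) simp
  also have "\<dots> = (\<Sum>k\<in>W. \<Sum>l\<in>W. u k * u l * (b k (l - k) + b l (k - l)))"
    by (simp add: algebra_simps sum.distrib)
  also have "\<dots> = (\<Sum>k\<in>W. \<Sum>l\<in>W. 2 * (u k * u l))"
    by (intro sum.cong refl) (simp add: assms)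
  also have "\<dots> = 2 * (\<Sum>k\<in>W. u k)\<^sup>2"
    unfolding power2_eq_square sum_product by (simp add: sum_distrib_left)
  finally show ?thesis by simp
qed

text \<open>If \<open>r \<le> 1\<close>, multiplying by \<open>r\<close> is harmless; otherwise
  \<open>1 / r\<close> is below 1 and the first term is 2 minus a bounded one. The bound is
  independent of \<open>r\<close>.\<close>

lemma paired_weight_bound:
  fixes x y :: complex
  assumes "r > 0" "of_real r * x + of_real (1 / r) * y = 2" "norm x \<le> A" "norm y \<le> A"
  shows "norm (of_real r * x) \<le> 2 + A"
proof (cases "r \<le> 1")
  case True
  have "norm (of_real r * x) = r * norm x" using assms(1) by (simp add: norm_mult)
  also have "\<dots> \<le> 1 * A" using True assms by (intro mult_mono) auto
  finally show ?thesis by simp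
next
  case False
  have "norm (of_real (1 / r) * y) = 1 / r * norm y" using assms(1) by (simp add: norm_mult norm_divide)
  also have "\<dots> \<le> 1 * A" using False assms by (intro mult_mono) auto
  finally have "norm (of_real (1 / r) * y) \<le> A" by simp
  moreover have "of_real r * x = 2 - of_real (1 / r) * y"
    using assms(2) by (simp add: eq_diff_eq)
  then have "norm (of_real r * x) \<le> norm (2 :: complex) + norm (of_real (1 / r) * y)"
    by (metis norm_triangle_ineq4)
  ultimately show ?thesis by simp
qed

text \<open>At a fixed frequency the nonzero terms are indexed by a finite window \<open>W\<close>,
  whatever \<open>F\<close> is; this makes the bound uniform in \<open>F\<close>.\<close>

lemma sum_le_card_mult:
  fixes f :: "'j \<Rightarrow> real"
  assumes "finite F" "finite W" "\<And>j. j \<in> F \<Longrightarrow> f j \<le> M" "0 \<le> M" "\<And>j. j \<in> F \<Longrightarrow> f j \<noteq> 0 \<Longrightarrow> j \<in> \<psi> ` W"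
  shows "sum f F \<le> of_nat (card W) * M"
proof -
  have "sum f F = sum f (F \<inter> \<psi> ` W)"
    by (rule sum.mono_neutral_right) (use assms in auto)
  also have "\<dots> \<le> of_nat (card (F \<inter> \<psi> ` W)) * M"
    by (rule sum_bounded_above) (use assms in auto)
  also have "\<dots> \<le> of_nat (card W) * M"
  proof (rule mult_right_mono)
    have "card (F \<inter> \<psi> ` W) \<le> card (\<psi> ` W)" using assms by (intro card_mono) auto
    also have "\<dots> \<le> card W" using assms by (intro card_image_le) auto
    finally show "of_nat (card (F \<inter> \<psi> ` W)) \<le> (of_nat (card W) :: real)" by simp
  qed fact
  finally show ?thesis .
qed

text \<open>The situation at a fixed frequency: \<open>G j\<close> and \<open>h j\<close> are the values of the two transforms there.\<close>

locale frequency_window =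
  fixes J JJ :: "'j set" and c :: "'j \<Rightarrow> real" and \<phi> :: "'j \<Rightarrow> int" and \<psi> :: "int \<Rightarrow> 'j"
    and N :: nat and k0 :: int and G h :: "'j \<Rightarrow> complex" and a :: "int \<Rightarrow> int \<Rightarrow> complex" and A C :: real
  assumes JJ: "JJ \<subseteq> J" and c: "\<And>j. j \<in> J \<Longrightarrow> c j > 0"
    and bij: "bij_betw \<phi> JJ UNIV" and \<psi>: "\<psi> = the_inv_into JJ \<phi>"
    and window: "\<And>j. j \<in> J \<Longrightarrow> G j \<noteq> 0 \<Longrightarrow> j \<in> JJ \<and> \<phi> j \<le> k0 \<and> k0 < \<phi> j + int N"
    and real: "\<And>j. j \<in> J \<Longrightarrow> G j \<in> \<real>"
    and bound: "\<And>j. j \<in> J \<Longrightarrow> norm (of_real (c j powr (- 1 / 2)) * G j) \<le> C"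
    and h: "\<And>j. j \<in> J \<Longrightarrow> G j \<noteq> 0 \<or> h j \<noteq> 0 \<Longrightarrow>
      j \<in> JJ \<and> h j = (\<Sum>n\<in>{- int N + 1..int N - 1}. a (\<phi> j) n * G (\<psi> (\<phi> j + n)))"
    and partition: "((\<lambda>j. of_real (c j powr (- 1 / 2)) * G j) has_sum 1) J"
    and a_bound: "\<And>k n. n \<in> {- int N + 1..int N - 1} \<Longrightarrow> norm (a k n) \<le> A"
    and a_zero: "\<And>j. j \<in> JJ \<Longrightarrow> a (\<phi> j) 0 = 1"
    and a_pair: "\<And>j n. j \<in> JJ \<Longrightarrow> n \<in> {1..int N - 1} \<Longrightarrow>
      of_real ((c (\<psi> (\<phi> j + n)) / c j) powr (1/2)) * a (\<phi> j) n
      + of_real ((c j / c (\<psi> (\<phi> j + n))) powr (1/2)) * a (\<phi> j + n) (- n) = 2"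
begin

lemma \<psi>_in: "\<psi> k \<in> JJ" and \<psi>_in_J: "\<psi> k \<in> J" and \<phi>_\<psi>: "\<phi> (\<psi> k) = k"
  and \<psi>_\<phi>: "j \<in> JJ \<Longrightarrow> \<psi> (\<phi> j) = j"
proof -
  have inj: "inj_on \<phi> JJ" and img: "\<phi> ` JJ = UNIV"
    using bij by (auto simp: bij_betw_def)
  show in_JJ: "\<psi> k \<in> JJ"
    unfolding \<psi> by (rule the_inv_into_into[OF inj]) (auto simp: img)
  then show "\<psi> k \<in> J" using JJ by blast
  show "\<phi> (\<psi> k) = k"
    unfolding \<psi> by (rule f_the_inv_into_f[OF inj]) (simp add: img)
  show "\<psi> (\<phi> j) = j" if "j \<in> JJ"
    unfolding \<psi> by (rule the_inv_into_f_f[OF inj that])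
qed

lemma inj_\<psi>: "inj_on \<psi> W"
  by (rule inj_on_inverseI[of _ \<phi>]) (rule \<phi>_\<psi>)

definition u :: "int \<Rightarrow> complex" where
  "u k = of_real (c (\<psi> k) powr (- 1 / 2)) * G (\<psi> k)"

text \<open>With the ratio absorbed, the pairing condition reads
  \<open>b k n + b (k + n) (- n) = 2\<close>, and the normalised \<open>h\<close> becomes a
  combination of the normalised values \<open>u\<close>.\<close>

definition b :: "int \<Rightarrow> int \<Rightarrow> complex" where
  "b k n = of_real ((c (\<psi> (k + n)) / c (\<psi> k)) powr (1/2)) * a k n"

text \<open>The indices with \<open>k \<le> k0 < k + int N\<close>, that is, those of the generators
  that can be nonzero at this frequency.\<close>

definition W :: "int set" where
  "W = {k0 - int N + 1..k0}"

lemma c_\<psi>: "c (\<psi> k) > 0"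
  by (intro c \<psi>_in_J)

lemma norm_u: "norm (u k) \<le> C"
  unfolding u_def by (intro bound \<psi>_in_J)

lemma C_nonneg: "0 \<le> C"
  using norm_u[of 0] norm_ge_zero order_trans by blast

lemma A_nonneg: "N > 0 \<Longrightarrow> 0 \<le> A"
  using order_trans[OF norm_ge_zero a_bound[of 0 0]] by simp

lemma u_outside: "k \<notin> W \<Longrightarrow> u k = 0"
  using window[OF \<psi>_in_J, of k] by (auto simp: u_def W_def \<phi>_\<psi>)

text \<open>Here real-valuedness enters: it turns products of \<open>u k\<close> with conjugates of
  \<open>u l\<close> into symmetric ones, to which \<open>symmetric_weights_sum\<close>
  applies.\<close>

lemma cnj_u: "cnj (u k) = u k"
  using real[OF \<psi>_in_J, of k] by (simp add: u_def Reals_cnj_iff)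

text \<open>The hypothesis covers positive \<open>n\<close>; for negative \<open>n\<close> it is the
  same identity based at \<open>k + n\<close>, and for \<open>n = 0\<close> it is twice the
  normalisation \<open>a_zero\<close>.\<close>

lemma b_pair:
  assumes "\<bar>n\<bar> < int N" shows "b k n + b (k + n) (- n) = 2"
proof -
  have pos: "b k n + b (k + n) (- n) = 2" if "n \<in> {1..int N - 1}" for k n
    using a_pair[OF \<psi>_in that, of k] by (simp add: b_def \<phi>_\<psi>)
  consider "n = 0" | "n > 0" | "n < 0" by linarith
  then show ?thesis
  proof cases
    case 1
    then show ?thesis
      using a_zero[OF \<psi>_in, of k] c_\<psi>[of k] by (simp add: b_def \<phi>_\<psi>)
  next
    case 2
    then show ?thesis using assms by (intro pos) auto
  next
    case 3
    then have "b (k + n) (- n) + b (k + n + - n) (- (- n)) = 2"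
      using assms by (intro pos) auto
    then show ?thesis by (simp add: add.commute)
  qed
qed

lemma norm_b:
  assumes "\<bar>n\<bar> < int N" shows "norm (b k n) \<le> 2 + A"
proof -
  let ?r = "(c (\<psi> (k + n)) / c (\<psi> k)) powr (1/2)"
  have r: "?r > 0" using c_\<psi>[of k] c_\<psi>[of "k + n"] by simp
  have "(c (\<psi> k) / c (\<psi> (k + n))) powr (1/2) = 1 / ?r"
    using c_\<psi> by (simp add: powr_divide less_imp_le)
  then have "of_real ?r * a k n + of_real (1 / ?r) * a (k + n) (- n) = 2"
    using b_pair[OF assms, of k] by (simp add: b_def)
  then show ?thesis
    unfolding b_def by (rule paired_weight_bound[OF r]) (use assms in \<open>auto intro!: a_bound\<close>)
qed

text \<open>The ratio inside \<open>b\<close> exchanges the normalising factor of generator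
  \<open>k + n\<close> for that of generator \<open>k\<close>. The premise secures that the formula
  for \<open>h\<close> applies at this frequency.\<close>

lemma scaled_h:
  assumes "G (\<psi> k) \<noteq> 0 \<or> h (\<psi> k) \<noteq> 0"
  shows "of_real (c (\<psi> k) powr (- 1 / 2)) * h (\<psi> k) = (\<Sum>n\<in>{- int N + 1..int N - 1}. u (k + n) * b k n)"
proof -
  have "of_real (c (\<psi> k) powr (- 1 / 2)) * h (\<psi> k)
    = (\<Sum>n\<in>{- int N + 1..int N - 1}. of_real (c (\<psi> k) powr (- 1 / 2)) * (a k n * G (\<psi> (k + n))))"
    using h[OF \<psi>_in_J assms] by (simp add: \<phi>_\<psi> sum_distrib_left)
  also have "\<dots> = (\<Sum>n\<in>{- int N + 1..int N - 1}. u (k + n) * b k n)"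
  proof (rule sum.cong[OF refl])
    fix n
    let ?x = "c (\<psi> (k + n))" and ?y = "c (\<psi> k)"
    have "?x powr (- 1 / 2) * (?x / ?y) powr (1/2) = ?y powr (- 1 / 2)"
      using c_\<psi>[of k] c_\<psi>[of "k + n"] by (simp add: powr_divide powr_minus field_simps)
    then have "of_real (?y powr (- 1 / 2)) = (of_real (?x powr (- 1 / 2)) * of_real ((?x / ?y) powr (1/2)) :: complex)"
      by (simp flip: of_real_mult)
    then show "of_real (?y powr (- 1 / 2)) * (a k n * G (\<psi> (k + n))) = u (k + n) * b k n"
      by (simp add: u_def b_def)
  qed
  finally show ?thesis .
qed

lemma sum_u: "(\<Sum>k\<in>W. u k) = 1"
proof -
  have "((\<lambda>j. of_real (c j powr (- 1 / 2)) * G j) has_sum (\<Sum>j\<in>\<psi> ` W. of_real (c j powr (- 1 / 2)) * G j)) J"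
  proof (rule has_sum_finite_neutralI)
    fix j assume j: "j \<in> J - \<psi> ` W"
    have "G j = 0"
    proof (rule ccontr)
      assume "G j \<noteq> 0"
      then have "j \<in> JJ" "\<phi> j \<in> W" using window[of j] j by (auto simp: W_def)
      then show False using j \<psi>_\<phi>[of j] by force
    qed
    then show "of_real (c j powr (- 1 / 2)) * G j = 0" by simp
  qed (use \<psi>_in_J in \<open>auto simp: W_def\<close>)
  then have "(\<Sum>j\<in>\<psi> ` W. of_real (c j powr (- 1 / 2)) * G j) = 1"
    using partition by (rule has_sum_unique)
  then show ?thesis
    by (simp add: sum.reindex[OF inj_\<psi>] u_def)
qed

lemma square_scaled:
  assumes "j \<in> J" shows "(norm (of_real (c j powr (- 1 / 2)) * z :: complex))\<^sup>2 = (norm z)\<^sup>2 / c j"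
proof -
  have "(c j powr (- 1 / 2))\<^sup>2 = c j powr (- 1)"
    by (simp add: power2_eq_square flip: powr_add)
  also have "\<dots> = 1 / c j"
    using c[OF assms] by (simp add: powr_minus_divide)
  finally show ?thesis
    unfolding norm_mult norm_of_real power_mult_distrib power2_abs by simp
qed

lemma G_square_sum:
  assumes "finite F" "F \<subseteq> J"
  shows "(\<Sum>j\<in>F. (norm (G j))\<^sup>2 / c j) \<le> real N * C\<^sup>2"
proof -
  have "(\<Sum>j\<in>F. (norm (G j))\<^sup>2 / c j) \<le> real (card W) * C\<^sup>2"
  proof (rule sum_le_card_mult[where \<psi> = \<psi>])
    fix j assume j: "j \<in> F"
    then have jJ: "j \<in> J" using assms by auto
    show "(norm (G j))\<^sup>2 / c j \<le> C\<^sup>2"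
      unfolding square_scaled[OF jJ, symmetric] by (intro power_mono bound jJ) auto
    assume "(norm (G j))\<^sup>2 / c j \<noteq> 0"
    then have "j \<in> JJ" "\<phi> j \<in> W" using window[OF jJ] by (auto simp: W_def)
    then show "j \<in> \<psi> ` W" using \<psi>_\<phi>[of j] by force
  qed (use assms in \<open>auto simp: W_def\<close>)
  then show ?thesis by (simp add: W_def)
qed

text \<open>If \<open>h j\<close> is nonzero, the index of \<open>j\<close> lies within
  \<open>N - 1\<close> of the window \<open>W\<close>, which leaves at most \<open>3 * N\<close>
  generators. The normalised value has fewer than \<open>2 * N\<close> terms, each of size at most
  \<open>C * (2 + A)\<close>. For \<open>N = 0\<close> the sums are empty and nothing forces
  \<open>A\<close> to be nonnegative, hence the separate case.\<close>

lemma h_square_sum: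
  assumes "finite F" "F \<subseteq> J"
  shows "(\<Sum>j\<in>F. (norm (h j))\<^sup>2 / c j) \<le> real (3 * N) * (2 * real N * (C * (2 + A)))\<^sup>2"
proof (cases "N = 0")
  case True
  have "h j = 0" if "j \<in> F" for j
    using h[of j] True assms that by auto
  then show ?thesis by simp
next
  case False
  let ?n = "{- int N + 1..int N - 1}" and ?W = "{k0 - 2 * int N + 1..k0 + int N}"
  have "(\<Sum>j\<in>F. (norm (h j))\<^sup>2 / c j) \<le> real (card ?W) * (2 * real N * (C * (2 + A)))\<^sup>2"
  proof (rule sum_le_card_mult[where \<psi> = \<psi>])
    fix j assume j: "j \<in> F"
    then have jJ: "j \<in> J" using assms by auto
    have hj: "j \<in> JJ" "of_real (c j powr (- 1 / 2)) * h j = (\<Sum>n\<in>?n. u (\<phi> j + n) * b (\<phi> j) n)" if "h j \<noteq> 0"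
    proof -
      show "j \<in> JJ" using h[OF jJ] that by auto
      then show "of_real (c j powr (- 1 / 2)) * h j = (\<Sum>n\<in>?n. u (\<phi> j + n) * b (\<phi> j) n)"
        using scaled_h[of "\<phi> j"] that by (simp add: \<psi>_\<phi>)
    qed
    show "(norm (h j))\<^sup>2 / c j \<le> (2 * real N * (C * (2 + A)))\<^sup>2"
    proof (cases "h j = 0")
      case False
      have "norm (\<Sum>n\<in>?n. u (\<phi> j + n) * b (\<phi> j) n) \<le> real (card ?n) * (C * (2 + A))"
      proof (rule order_trans[OF norm_sum sum_bounded_above])
        fix n assume "n \<in> ?n"
        then show "norm (u (\<phi> j + n) * b (\<phi> j) n) \<le> C * (2 + A)"
          unfolding norm_mult by (intro mult_mono norm_u norm_b C_nonneg) auto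
      qed
      also have "\<dots> \<le> 2 * real N * (C * (2 + A))"
        using \<open>N \<noteq> 0\<close> C_nonneg A_nonneg by (intro mult_right_mono) auto
      finally show ?thesis
        unfolding square_scaled[OF jJ, symmetric] hj(2)[OF False] by (intro power_mono) auto
    qed simp
    assume "(norm (h j))\<^sup>2 / c j \<noteq> 0"
    then have h0: "h j \<noteq> 0" by auto
    have "\<exists>n\<in>?n. u (\<phi> j + n) \<noteq> 0"
    proof (rule ccontr)
      assume "\<not> ?thesis"
      then have "of_real (c j powr (- 1 / 2)) * h j = 0" unfolding hj(2)[OF h0] by simp
      then show False using h0 c[OF jJ] by simp
    qed
    then obtain n where "n \<in> ?n" "\<phi> j + n \<in> W" using u_outside by blast
    then have "\<phi> j \<in> ?W" by (auto simp: W_def)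
    then show "j \<in> \<psi> ` ?W" using \<psi>_\<phi>[OF hj(1)[OF h0]] by force
  qed (use assms in auto)
  then show ?thesis by simp
qed

lemma dual_sum: "((\<lambda>j. G j * cnj (h j) / of_real (c j)) has_sum 1) J"
proof -
  \<comment> \<open>If \<open>G (\<psi> k)\<close> vanishes, so does \<open>u k\<close>; otherwise
    the formula for \<open>h\<close> is available.\<close>
  have summand: "G (\<psi> k) * cnj (h (\<psi> k)) / of_real (c (\<psi> k)) = (\<Sum>l\<in>W. u k * (u l * cnj (b k (l - k))))"
    if k: "k \<in> W" for k
  proof (cases "G (\<psi> k) = 0")
    case False
    have "(\<Sum>n\<in>{- int N + 1..int N - 1}. u (k + n) * b k n) = (\<Sum>l\<in>{k - int N + 1..k + int N - 1}. u l * b k (l - k))"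
      by (rule sum.reindex_bij_witness[of _ "\<lambda>l. l - k" "\<lambda>n. k + n"]) auto
    \<comment> \<open>For \<open>k \<in> W\<close> the whole window lies within distance
      \<open>N - 1\<close> of \<open>k\<close>, and \<open>u\<close> vanishes outside it.\<close>
    also have "\<dots> = (\<Sum>l\<in>W. u l * b k (l - k))"
      by (rule sum.mono_neutral_right) (use k u_outside in \<open>auto simp: W_def\<close>)
    finally have hk: "of_real (c (\<psi> k) powr (- 1 / 2)) * h (\<psi> k) = (\<Sum>l\<in>W. u l * b k (l - k))"
      using scaled_h[of k] False by simp
    have "c (\<psi> k) powr (- 1 / 2) * c (\<psi> k) powr (- 1 / 2) = 1 / c (\<psi> k)"
      using c_\<psi>[of k] by (simp add: powr_minus_divide flip: powr_add)
    then have "of_real (c (\<psi> k) powr (- 1 / 2)) * of_real (c (\<psi> k) powr (- 1 / 2)) = (1 / of_real (c (\<psi> k)) :: complex)"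
      by (metis of_real_mult of_real_divide of_real_1)
    then have "G (\<psi> k) * cnj (h (\<psi> k)) / of_real (c (\<psi> k)) = u k * cnj (of_real (c (\<psi> k) powr (- 1 / 2)) * h (\<psi> k))"
      by (simp add: u_def mult.assoc mult.left_commute[of _ "G (\<psi> k)"] flip: mult.assoc[of "of_real _" "of_real _"])
    also have "\<dots> = (\<Sum>l\<in>W. u k * (u l * cnj (b k (l - k))))"
      unfolding hk by (simp add: cnj_u sum_distrib_left)
    finally show ?thesis .
  qed (simp add: u_def)
  have "((\<lambda>j. G j * cnj (h j) / of_real (c j)) has_sum (\<Sum>j\<in>\<psi> ` W. G j * cnj (h j) / of_real (c j))) J"
  proof (rule has_sum_finite_neutralI)
    fix j assume j: "j \<in> J - \<psi> ` W"
    have "G j = 0"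
    proof (rule ccontr)
      assume "G j \<noteq> 0"
      then have "j \<in> JJ" "\<phi> j \<in> W" using window[of j] j by (auto simp: W_def)
      then show False using j \<psi>_\<phi>[of j] by force
    qed
    then show "G j * cnj (h j) / of_real (c j) = 0" by simp
  qed (use \<psi>_in_J in \<open>auto simp: W_def\<close>)
  also have "(\<Sum>j\<in>\<psi> ` W. G j * cnj (h j) / of_real (c j)) = (\<Sum>k\<in>W. \<Sum>l\<in>W. u k * (u l * cnj (b k (l - k))))"
    using summand by (simp add: sum.reindex[OF inj_\<psi>])
  also have "\<dots> = (\<Sum>k\<in>W. u k)\<^sup>2"
  proof (rule symmetric_weights_sum)
    fix k l assume "k \<in> W" "l \<in> W"
    then have "b k (l - k) + b (k + (l - k)) (- (l - k)) = 2"
      by (intro b_pair) (auto simp: W_def)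
    then have "cnj (b k (l - k) + b l (k - l)) = cnj 2" by simp
    then show "cnj (b k (l - k)) + cnj (b l (k - l)) = 2" by simp
  qed
  finally show ?thesis by (simp add: sum_u)
qed

end

section \<open>The main theorem\<close>

theorem theorem5p1:
  fixes I :: "int set" and J :: "'j set"
    and \<alpha> \<beta> :: "int \<Rightarrow> ereal" and P :: "int \<Rightarrow> real set" and S :: "real set"
    and \<xi> :: "int \<Rightarrow> int \<Rightarrow> real"
    and c :: "'j \<Rightarrow> real" and g h :: "'j \<Rightarrow> real \<Rightarrow> complex"
    and G :: "'j \<Rightarrow> real \<Rightarrow> complex" and IJ :: "'j \<Rightarrow> int set"
    and JI :: "int \<Rightarrow> 'j set" and \<phi> :: "int \<Rightarrow> 'j \<Rightarrow> int" and \<psi> :: "int \<Rightarrow> int \<Rightarrow> 'j"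
    and N :: nat and a :: "int \<Rightarrow> int \<Rightarrow> int \<Rightarrow> complex"
  defines "P \<equiv> \<lambda>i. half_open (\<alpha> i) (\<beta> i)"
    and "S \<equiv> (\<Union>i\<in>I. P i)"
    and "G \<equiv> \<lambda>j. fourier_L2 (g j)"
    and "IJ \<equiv> \<lambda>j. active I P (G j)"
    and "\<psi> \<equiv> \<lambda>i. the_inv_into (JI i) (\<phi> i)"
  assumes J_countable: "countable J"
    \<comment> \<open>(I)\<close>
    and ordered: "\<And>i i'. i \<in> I \<Longrightarrow> i' \<in> I \<Longrightarrow> i < i' \<Longrightarrow> \<beta> i \<le> \<alpha> i'"
    and knots_in: "\<And>i k. i \<in> I \<Longrightarrow> \<xi> i k \<in> P i"
    and knots_mono: "\<And>i k. i \<in> I \<Longrightarrow> \<xi> i k \<le> \<xi> i (k + 1)"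
    and knots_bot: "\<And>i. i \<in> I \<Longrightarrow> ((\<lambda>k. ereal (\<xi> i k)) \<longlongrightarrow> \<alpha> i) at_bot"
    and knots_top: "\<And>i. i \<in> I \<Longrightarrow> ((\<lambda>k. ereal (\<xi> i k)) \<longlongrightarrow> \<beta> i) at_top"
    \<comment> \<open>(II)\<close>
    and c_pos: "\<And>j. j \<in> J \<Longrightarrow> c j > 0"
    and g_L2: "\<And>j. j \<in> J \<Longrightarrow> g j \<in> L2"
    and G_bounded: "\<And>j. j \<in> J \<Longrightarrow> \<exists>C. AE \<gamma> in lborel. norm (G j \<gamma>) \<le> C"
    and G_real: "\<And>j. j \<in> J \<Longrightarrow> AE \<gamma> in lborel. G j \<gamma> \<in> \<real>"
    and G_compact: "\<And>j. j \<in> J \<Longrightarrow>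
          \<exists>F K. finite F \<and> F \<subseteq> I \<and> compact K \<and> K \<subseteq> (\<Union>i\<in>F. P i) \<and> vanishes_on (G j) (- K)"
    and G_uniform: "\<exists>C. \<forall>j\<in>J. AE \<gamma> in lborel. norm (of_real (c j powr (-1/2)) * G j \<gamma>) \<le> C"
    \<comment> \<open>(III)\<close>
    and JI: "\<And>i. i \<in> I \<Longrightarrow> {j \<in> J. i \<in> IJ j} \<subseteq> JI i \<and> JI i \<subseteq> J"
    and \<phi>_bij: "\<And>i. i \<in> I \<Longrightarrow> bij_betw (\<phi> i) (JI i) (UNIV :: int set)"
    and G_supp: "\<And>j. j \<in> J \<Longrightarrow>
          vanishes_on (G j) (- (\<Union>i\<in>IJ j. {\<xi> i (\<phi> i j)..\<xi> i (\<phi> i j + int N)}))"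
    \<comment> \<open>(IV)\<close>
    and h_space: "\<And>j. j \<in> J \<Longrightarrow> h j \<in> L2_check S"
    and h_on: "\<And>j. j \<in> J \<Longrightarrow> AE \<gamma> in lborel. \<forall>i\<in>IJ j. \<gamma> \<in> P i \<longrightarrow>
          fourier_L2 (h j) \<gamma> = (\<Sum>n\<in>{- int N + 1..int N - 1}.
             a i (\<phi> i j) n * G (\<psi> i (\<phi> i j + n)) \<gamma>)"
    and h_off: "\<And>j i. j \<in> J \<Longrightarrow> i \<in> I - IJ j \<Longrightarrow> vanishes_on (fourier_L2 (h j)) (P i)"
    \<comment> \<open>hypotheses of the theorem\<close>
    and partition: "AE \<gamma> in lborel.
          ((\<lambda>j. of_real (c j powr (-1/2)) * G j \<gamma>) has_sum indicator S \<gamma>) J"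
    and c_small: "\<And>j. j \<in> J \<Longrightarrow> IJ j \<noteq> {} \<Longrightarrow> c j \<le> 1 / knot_span \<xi> N (IJ j) (\<lambda>i. \<phi> i j)"
    and a_bounded: "\<exists>C. \<forall>i\<in>I. \<forall>k. \<forall>n\<in>{- int N + 1..int N - 1}. norm (a i k n) \<le> C"
    and a_zero: "\<And>i j. i \<in> I \<Longrightarrow> j \<in> JI i \<Longrightarrow> a i (\<phi> i j) 0 = 1"
    and a_pair: "\<And>i j n. i \<in> I \<Longrightarrow> j \<in> JI i \<Longrightarrow> n \<in> {1..int N - 1} \<Longrightarrow>
          of_real ((c (\<psi> i (\<phi> i j + n)) / c j) powr (1/2)) * a i (\<phi> i j) n
          + of_real ((c j / c (\<psi> i (\<phi> i j + n))) powr (1/2)) * a i (\<phi> i j + n) (- n) = 2"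
  shows "dual_frames (L2_check S) (UNIV \<times> J)
           (\<lambda>(k::int, j). translate (c j * of_int k) (g j))
           (\<lambda>(k::int, j). translate (c j * of_int k) (h j))"
proof -
  have P_iff: "\<gamma> \<in> P i \<longleftrightarrow> \<alpha> i < ereal \<gamma> \<and> ereal \<gamma> \<le> \<beta> i" for \<gamma> i
    by (simp add: P_def half_open_def)
  have P_less: "x < y" if "i \<in> I" "i' \<in> I" "i < i'" "x \<in> P i" "y \<in> P i'" for i i' x y
  proof -
    have "ereal x \<le> \<beta> i" "\<beta> i \<le> \<alpha> i'" "\<alpha> i' < ereal y"
      using that ordered by (auto simp: P_iff)
    then have "ereal x < ereal y" by (meson order_le_less_trans order_trans)
    then show ?thesis by simp
  qed
  have P_disj: "i = i'" if "i \<in> I" "i' \<in> I" "\<gamma> \<in> P i" "\<gamma> \<in> P i'" for i i' \<gamma>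
    using P_less[of i i' \<gamma> \<gamma>] P_less[of i' i \<gamma> \<gamma>] that by (metis less_irrefl linorder_less_linear)
  have \<xi>_mono: "\<xi> i k \<le> \<xi> i l" if "i \<in> I" "k \<le> l" for i k l
    by (rule int_mono_of_step[of "\<xi> i", OF knots_mono[OF that(1)] that(2)])
  have P_between: "\<gamma> \<in> P i" if "i \<in> I" "\<xi> i k \<le> \<gamma>" "\<gamma> \<le> \<xi> i l" for i k l \<gamma>
  proof -
    have "\<alpha> i < ereal (\<xi> i k)" "ereal (\<xi> i l) \<le> \<beta> i"
      using knots_in[OF that(1)] by (auto simp: P_iff)
    with that show ?thesis
      unfolding P_iff by (meson ereal_less_eq(3) less_le_trans order_trans)
  qed
  have IJ_iff: "i \<in> IJ j \<longleftrightarrow> i \<in> I \<and> \<not> vanishes_on (G j) (P i)" for i j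
    by (auto simp: IJ_def active_def)
  have IJ_JI: "j \<in> JI i" if "j \<in> J" "i \<in> IJ j" for i j
    using JI[of i] that by (auto simp: IJ_iff)
  \<comment> \<open>Finiteness gives the maximum and minimum in \<open>knot_span\<close> their
    meaning. The compact support lies in finitely many of the intervals, and disjointness makes the
    transform vanish on all others.\<close>
  have IJ_finite: "finite (IJ j)" if j: "j \<in> J" for j
  proof -
    obtain F K where F: "finite F" "F \<subseteq> I" "K \<subseteq> (\<Union>i\<in>F. P i)" "vanishes_on (G j) (- K)"
      using G_compact[OF j] by (elim exE conjE) (rule that)
    have "i \<in> F" if i: "i \<in> IJ j" for i
    proof (rule ccontr)
      assume "i \<notin> F"
      have "\<gamma> \<in> - K" if "\<gamma> \<in> P i" for \<gamma>
      proof
        assume "\<gamma> \<in> K"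
        then obtain i' where "i' \<in> F" "\<gamma> \<in> P i'" using F(3) by blast
        with P_disj[of i i' \<gamma>] that i F(2) \<open>i \<notin> F\<close> show False unfolding IJ_iff by blast
      qed
      then have "vanishes_on (G j) (P i)"
        using F(4) unfolding vanishes_on_def by (elim eventually_mono) blast
      with i show False by (simp add: IJ_iff)
    qed
    then have "IJ j \<subseteq> F" by (rule subsetI)
    then show ?thesis using F(1) by (rule finite_subset)
  qed
  obtain C where C: "\<And>j. j \<in> J \<Longrightarrow> AE \<gamma> in lborel. norm (of_real (c j powr (-1/2)) * G j \<gamma>) \<le> C"
    using G_uniform by blast
  obtain A where A: "\<And>i k n. i \<in> I \<Longrightarrow> n \<in> {- int N + 1..int N - 1} \<Longrightarrow> norm (a i k n) \<le> A"
    using a_bounded by blast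

  \<comment> \<open>At a knot the closed supports may meet, which would make more than
    \<open>N\<close> consecutive indices active; a right end may belong to \<open>P i\<close>
    although no knot exceeds it. An infinite \<open>\<beta> i\<close> contributes the point 0, which
    is harmless.\<close>
  have "countable ((\<Union>i. range (\<xi> i)) \<union> range (\<lambda>i. real_of_ereal (\<beta> i)))"
    by auto
  from AE_not_in[OF countable_imp_null_set_lborel[OF this]]
  have good1: "AE \<gamma> in lborel. \<forall>i k. \<gamma> \<noteq> \<xi> i k \<and> ereal \<gamma> \<noteq> \<beta> i"
  proof eventually_elim
    case (elim \<gamma>)
    then show ?case
      by (auto, metis rangeI real_of_ereal.simps(1))
  qed
  have good2: "AE \<gamma> in lborel. \<forall>j\<in>J. \<forall>i\<in>I - IJ j. \<gamma> \<in> P i \<longrightarrow> G j \<gamma> = 0"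
    unfolding AE_ball_countable[OF J_countable] AE_ball_countable[OF countableI_type]
    by (auto simp: IJ_iff vanishes_on_def)
  have good3: "AE \<gamma> in lborel. \<forall>j\<in>J. \<gamma> \<in> - (\<Union>i\<in>IJ j. {\<xi> i (\<phi> i j)..\<xi> i (\<phi> i j + int N)}) \<longrightarrow> G j \<gamma> = 0"
    unfolding AE_ball_countable[OF J_countable] using G_supp by (auto simp: vanishes_on_def)
  have good4: "AE \<gamma> in lborel. \<forall>j\<in>J. \<forall>i\<in>IJ j. \<gamma> \<in> P i \<longrightarrow>
          fourier_L2 (h j) \<gamma> = (\<Sum>n\<in>{- int N + 1..int N - 1}. a i (\<phi> i j) n * G (\<psi> i (\<phi> i j + n)) \<gamma>)"
    unfolding AE_ball_countable[OF J_countable] using h_on by blast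
  have good5: "AE \<gamma> in lborel. \<forall>j\<in>J. \<forall>i\<in>I - IJ j. \<gamma> \<in> P i \<longrightarrow> fourier_L2 (h j) \<gamma> = 0"
    unfolding AE_ball_countable[OF J_countable] AE_ball_countable[OF countableI_type]
    using h_off by (auto simp: vanishes_on_def)
  have good6: "AE \<gamma> in lborel. \<forall>j\<in>J. \<gamma> \<in> - S \<longrightarrow> fourier_L2 (h j) \<gamma> = 0"
    unfolding AE_ball_countable[OF J_countable] using h_space by (auto simp: L2_check_def vanishes_on_def)
  have good7: "AE \<gamma> in lborel. \<forall>j\<in>J. norm (of_real (c j powr (-1/2)) * G j \<gamma>) \<le> C"
    unfolding AE_ball_countable[OF J_countable] using C by blast
  have good8: "AE \<gamma> in lborel. \<forall>j\<in>J. G j \<gamma> \<in> \<real>"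
    unfolding AE_ball_countable[OF J_countable] using G_real by blast
  \<comment> \<open>Countability of \<open>J\<close> and of the integers collects all exceptional
    sets into one null set, so that the remaining local arguments are pointwise.\<close>
  define good where "good \<gamma> \<longleftrightarrow>
    (\<forall>i k. \<gamma> \<noteq> \<xi> i k \<and> ereal \<gamma> \<noteq> \<beta> i) \<and>
    (\<forall>j\<in>J. \<forall>i\<in>I - IJ j. \<gamma> \<in> P i \<longrightarrow> G j \<gamma> = 0) \<and>
    (\<forall>j\<in>J. \<gamma> \<in> - (\<Union>i\<in>IJ j. {\<xi> i (\<phi> i j)..\<xi> i (\<phi> i j + int N)}) \<longrightarrow> G j \<gamma> = 0) \<and>
    (\<forall>j\<in>J. \<forall>i\<in>IJ j. \<gamma> \<in> P i \<longrightarrow>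
          fourier_L2 (h j) \<gamma> = (\<Sum>n\<in>{- int N + 1..int N - 1}. a i (\<phi> i j) n * G (\<psi> i (\<phi> i j + n)) \<gamma>)) \<and>
    (\<forall>j\<in>J. \<forall>i\<in>I - IJ j. \<gamma> \<in> P i \<longrightarrow> fourier_L2 (h j) \<gamma> = 0) \<and>
    (\<forall>j\<in>J. \<gamma> \<in> - S \<longrightarrow> fourier_L2 (h j) \<gamma> = 0) \<and>
    (\<forall>j\<in>J. norm (of_real (c j powr (-1/2)) * G j \<gamma>) \<le> C) \<and>
    (\<forall>j\<in>J. G j \<gamma> \<in> \<real>) \<and>
    ((\<lambda>j. of_real (c j powr (-1/2)) * G j \<gamma>) has_sum indicator S \<gamma>) J" for \<gamma>
  have AE_good: "AE \<gamma> in lborel. good \<gamma>"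
    using good1 good2 good3 good4 good5 good6 good7 good8 partition
    by eventually_elim (simp only: good_def simp_thms)

  have G_nz: "\<exists>i. i \<in> IJ j \<and> \<gamma> \<in> P i \<and> \<xi> i (\<phi> i j) < \<gamma> \<and> \<gamma> < \<xi> i (\<phi> i j + int N)"
    if "good \<gamma>" "j \<in> J" "G j \<gamma> \<noteq> 0" for \<gamma> j
  proof -
    have "\<gamma> \<in> (\<Union>i\<in>IJ j. {\<xi> i (\<phi> i j)..\<xi> i (\<phi> i j + int N)})"
      using that unfolding good_def by blast
    then obtain i where i: "i \<in> IJ j" "\<xi> i (\<phi> i j) \<le> \<gamma>" "\<gamma> \<le> \<xi> i (\<phi> i j + int N)"
      by auto
    moreover have "\<gamma> \<noteq> \<xi> i k" for k
      using that(1) unfolding good_def by blast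
    moreover have "\<gamma> \<in> P i"
      using i by (intro P_between[of i]) (auto simp: IJ_iff)
    ultimately show ?thesis by (metis less_le)
  qed
  \<comment> \<open>By disjointness the interval found in \<open>G_nz\<close> is the prescribed
    one.\<close>
  have G_nz_P: "i \<in> IJ j \<and> \<xi> i (\<phi> i j) < \<gamma> \<and> \<gamma> < \<xi> i (\<phi> i j + int N)"
    if "good \<gamma>" "j \<in> J" "G j \<gamma> \<noteq> 0" "i \<in> I" "\<gamma> \<in> P i" for \<gamma> j i
    using G_nz[OF that(1-3)] P_disj[OF that(4) _ that(5)] by (metis IJ_iff)
  have G_out: "G j \<gamma> = 0" if "good \<gamma>" "j \<in> J" "\<gamma> \<notin> S" for \<gamma> j
    using G_nz[OF that(1,2)] that(3) by (auto simp: S_def IJ_iff)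
  have h_out: "fourier_L2 (h j) \<gamma> = 0" if "good \<gamma>" "j \<in> J" "\<gamma> \<notin> S" for \<gamma> j
    using that unfolding good_def by blast
  have h_nz: "i \<in> IJ j" if "good \<gamma>" "j \<in> J" "fourier_L2 (h j) \<gamma> \<noteq> 0" "i \<in> I" "\<gamma> \<in> P i" for \<gamma> j i
    using that unfolding good_def by blast
  have h_eq: "fourier_L2 (h j) \<gamma> = (\<Sum>n\<in>{- int N + 1..int N - 1}. a i (\<phi> i j) n * G (\<psi> i (\<phi> i j + n)) \<gamma>)"
    if "good \<gamma>" "j \<in> J" "i \<in> IJ j" "\<gamma> \<in> P i" for \<gamma> j i
    using that unfolding good_def by blast

  have window: "\<exists>k0. frequency_window J (JI i) c (\<phi> i) (\<psi> i) N k0 (\<lambda>j. G j \<gamma>) (\<lambda>j. fourier_L2 (h j) \<gamma>) (a i) A C"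
    if \<gamma>: "good \<gamma>" and i: "i \<in> I" "\<gamma> \<in> P i" for \<gamma> i
  proof -
    have no_knot: "\<gamma> \<noteq> \<xi> i k" "ereal \<gamma> \<noteq> \<beta> i" for k
      using \<gamma> unfolding good_def by blast+
    have "\<alpha> i < ereal \<gamma>" "ereal \<gamma> < \<beta> i"
      using i no_knot by (auto simp: P_iff less_le)
    then obtain k0 where k0: "\<And>k. \<xi> i k < \<gamma> \<longleftrightarrow> k \<le> k0"
      using knot_window[of "\<xi> i" "\<alpha> i" "\<beta> i" \<gamma>, OF knots_mono[OF i(1)] knots_bot[OF i(1)] knots_top[OF i(1)]] by metis
    have "frequency_window J (JI i) c (\<phi> i) (\<psi> i) N k0 (\<lambda>j. G j \<gamma>) (\<lambda>j. fourier_L2 (h j) \<gamma>) (a i) A C"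
    proof
      show "JI i \<subseteq> J" using JI[OF i(1)] by blast
      show "bij_betw (\<phi> i) (JI i) UNIV" by (rule \<phi>_bij[OF i(1)])
      show "\<psi> i = the_inv_into (JI i) (\<phi> i)" by (simp add: \<psi>_def)
      \<comment> \<open>A nonzero value puts \<open>\<gamma>\<close> strictly between the knots
        \<open>\<phi> i j\<close> and \<open>\<phi> i j + int N\<close>; read through
        \<open>k0\<close>, this is the window condition.\<close>
      show "j \<in> JI i \<and> \<phi> i j \<le> k0 \<and> k0 < \<phi> i j + int N" if j: "j \<in> J" "G j \<gamma> \<noteq> 0" for j
      proof -
        have *: "i \<in> IJ j" "\<xi> i (\<phi> i j) < \<gamma>" "\<not> \<xi> i (\<phi> i j + int N) < \<gamma>"
          using G_nz_P[OF \<gamma> j i] by auto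
        then show ?thesis
          using IJ_JI[OF j(1)] unfolding k0 by auto
      qed
      show "G j \<gamma> \<in> \<real>" "norm (of_real (c j powr (- 1 / 2)) * G j \<gamma>) \<le> C" if "j \<in> J" for j
        using \<gamma> that unfolding good_def by blast+
      show "j \<in> JI i \<and> fourier_L2 (h j) \<gamma> = (\<Sum>n\<in>{- int N + 1..int N - 1}. a i (\<phi> i j) n * G (\<psi> i (\<phi> i j + n)) \<gamma>)"
        if j: "j \<in> J" "G j \<gamma> \<noteq> 0 \<or> fourier_L2 (h j) \<gamma> \<noteq> 0" for j
      proof -
        have "i \<in> IJ j" using j G_nz_P[OF \<gamma> j(1) _ i] h_nz[OF \<gamma> j(1) _ i] by blast
        then show ?thesis using IJ_JI[OF j(1)] h_eq[OF \<gamma> j(1) _ i(2)] by blast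
      qed
      have "\<gamma> \<in> S" using i by (auto simp: S_def)
      then show "((\<lambda>j. of_real (c j powr (- 1 / 2)) * G j \<gamma>) has_sum 1) J"
        using \<gamma> unfolding good_def by simp
    qed (use c_pos A a_zero a_pair i(1) in blast)+
    then show ?thesis by blast
  qed

  define i_min where "i_min j = Min (IJ j)" for j
  define i_max where "i_max j = Max (IJ j)" for j
  \<comment> \<open>\<open>g j\<close> reaches from knot \<open>\<phi> i j\<close> to
    \<open>\<phi> i j + int N\<close>, and \<open>h j\<close> combines generators shifted by fewer
    than \<open>N\<close> places; hence the offsets \<open>- int N\<close> and
    \<open>2 * int N\<close>. The differences \<open>q' j - p j\<close> and
    \<open>p' j - q j\<close> are the entries of \<open>knot_span\<close>. If \<open>IJ j\<close> is
    empty, both transforms vanish almost everywhere and the degenerate interval at 0 serves.\<close>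
  define p where "p j = (if IJ j = {} then 0 else \<xi> (i_min j) (\<phi> (i_min j) j - int N))" for j
  define q where "q j = (if IJ j = {} then 0 else \<xi> (i_min j) (\<phi> (i_min j) j))" for j
  define q' where "q' j = (if IJ j = {} then 0 else \<xi> (i_max j) (\<phi> (i_max j) j + int N))" for j
  define p' where "p' j = (if IJ j = {} then 0 else \<xi> (i_max j) (\<phi> (i_max j) j + 2 * int N))" for j
  have i_min_max: "i_min j \<in> IJ j" "i_max j \<in> IJ j" "i \<in> IJ j \<Longrightarrow> i_min j \<le> i \<and> i \<le> i_max j"
    if "j \<in> J" "IJ j \<noteq> {}" for j i
    using IJ_finite[OF that(1)] that(2) by (auto simp: i_min_def i_max_def)
  \<comment> \<open>Knots of different intervals compare by the order of the intervals, whatever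
    their indices.\<close>
  have \<xi>_le: "\<xi> i k \<le> \<xi> i' l" if "i \<in> I" "i' \<in> I" "i \<le> i'" "i = i' \<Longrightarrow> k \<le> l" for i i' k l
    using P_less[OF that(1,2) _ knots_in[OF that(1)] knots_in[OF that(2)], of k l] \<xi>_mono[OF that(1), of k l] that(3,4)
    by (cases "i = i'") (auto simp: less_imp_le)
  have IJ_I: "i \<in> IJ j \<Longrightarrow> i \<in> I" for i j
    by (simp add: IJ_iff)
  have \<psi>: "\<psi> i k \<in> J" "\<phi> i (\<psi> i k) = k" if "i \<in> I" for i k
  proof -
    have "inj_on (\<phi> i) (JI i)" "\<phi> i ` JI i = UNIV"
      using \<phi>_bij[OF that] by (auto simp: bij_betw_def)
    then show "\<phi> i (\<psi> i k) = k" "\<psi> i k \<in> J"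
      unfolding \<psi>_def using JI[OF that] f_the_inv_into_f[of "\<phi> i" "JI i" k] the_inv_into_into[of "\<phi> i" "JI i" k "JI i"] by auto
  qed
  \<comment> \<open>The two square-sum bounds are added so that one constant serves both
    families.\<close>
  define B where "B = real N * C\<^sup>2 + real (3 * N) * (2 * real N * (C * (2 + A)))\<^sup>2"
  have B_ge: "0 \<le> B" "real N * C\<^sup>2 \<le> B" "real (3 * N) * (2 * real N * (C * (2 + A)))\<^sup>2 \<le> B"
    unfolding B_def by auto

  show ?thesis
  proof (rule dual_frames_translates[where p = p and q = q and q' = q' and p' = p' and B = B])
    show "g j \<in> L2_check S" if j: "j \<in> J" for j
      unfolding L2_check_def vanishes_on_def
      using g_L2[OF j] AE_good G_out[OF _ j] by (auto simp: G_def elim!: eventually_mono)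
    show "AE \<gamma> in lborel. \<gamma> \<notin> {q j..q' j} \<longrightarrow> fourier_L2 (g j) \<gamma> = 0" if j: "j \<in> J" for j
      using AE_good
    proof eventually_elim
      case (elim \<gamma>)
      have "\<gamma> \<in> {q j..q' j}" if nz: "G j \<gamma> \<noteq> 0"
      proof -
        obtain i where i: "i \<in> IJ j" "\<xi> i (\<phi> i j) < \<gamma>" "\<gamma> < \<xi> i (\<phi> i j + int N)"
          using G_nz[OF elim j nz] by blast
        then have ne: "IJ j \<noteq> {}" by blast
        note m = i_min_max(1,2)[OF j ne] i_min_max(3)[OF j ne i(1)]
        have "\<xi> (i_min j) (\<phi> (i_min j) j) \<le> \<xi> i (\<phi> i j)"
          by (rule \<xi>_le[OF IJ_I[OF m(1)] IJ_I[OF i(1)]]) (use m(3) in auto)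
        moreover have "\<xi> i (\<phi> i j + int N) \<le> \<xi> (i_max j) (\<phi> (i_max j) j + int N)"
          by (rule \<xi>_le[OF IJ_I[OF i(1)] IJ_I[OF m(2)]]) (use m(3) in auto)
        ultimately show ?thesis using i ne by (simp add: q_def q'_def)
      qed
      then show ?case by (auto simp: G_def)
    qed
    show "AE \<gamma> in lborel. \<gamma> \<notin> {p j..p' j} \<longrightarrow> fourier_L2 (h j) \<gamma> = 0" if j: "j \<in> J" for j
      using AE_good
    proof eventually_elim
      case (elim \<gamma>)
      have "\<gamma> \<in> {p j..p' j}" if nz: "fourier_L2 (h j) \<gamma> \<noteq> 0"
      proof -
        obtain i where i: "i \<in> I" "\<gamma> \<in> P i"
          using h_out[OF elim j] nz by (auto simp: S_def)
        have iIJ: "i \<in> IJ j" by (rule h_nz[OF elim j nz i])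
        then have ne: "IJ j \<noteq> {}" by blast
        \<comment> \<open>A nonzero value of \<open>h j\<close> needs a neighbour that is nonzero at
          \<open>\<gamma>\<close>; the support of that neighbour confines
          \<open>\<gamma>\<close>.\<close>
        obtain n where n: "n \<in> {- int N + 1..int N - 1}" "G (\<psi> i (\<phi> i j + n)) \<gamma> \<noteq> 0"
          using nz unfolding h_eq[OF elim j iIJ i(2)] by (metis (no_types, lifting) mult_zero_right sum.neutral)
        note m = i_min_max(1,2)[OF j ne] i_min_max(3)[OF j ne iIJ]
        have "\<xi> i (\<phi> i j + n) < \<gamma>" "\<gamma> < \<xi> i (\<phi> i j + n + int N)"
          using G_nz_P[OF elim \<psi>(1)[OF i(1)] n(2) i] by (auto simp: \<psi>(2)[OF i(1)])
        moreover have "\<xi> (i_min j) (\<phi> (i_min j) j - int N) \<le> \<xi> i (\<phi> i j + n)"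
          by (rule \<xi>_le[OF IJ_I[OF m(1)] i(1)]) (use m(3) n(1) in auto)
        moreover have "\<xi> i (\<phi> i j + n + int N) \<le> \<xi> (i_max j) (\<phi> (i_max j) j + 2 * int N)"
          by (rule \<xi>_le[OF i(1) IJ_I[OF m(2)]]) (use m(3) n(1) in auto)
        ultimately show ?thesis using ne by (simp add: p_def p'_def)
      qed
      then show ?case by blast
    qed
    show "p j \<le> q j \<and> q j \<le> q' j \<and> q' j \<le> p' j" if j: "j \<in> J" for j
    proof (cases "IJ j = {}")
      case False
      note m = i_min_max(1,2)[OF j False] i_min_max(3)[OF j False i_min_max(1)[OF j False]]
      have "\<xi> (i_min j) (\<phi> (i_min j) j - int N) \<le> \<xi> (i_min j) (\<phi> (i_min j) j)"
        by (rule \<xi>_mono[OF IJ_I[OF m(1)]]) simp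
      moreover have "\<xi> (i_min j) (\<phi> (i_min j) j) \<le> \<xi> (i_max j) (\<phi> (i_max j) j + int N)"
        by (rule \<xi>_le[OF IJ_I[OF m(1)] IJ_I[OF m(2)]]) (use m(3) in auto)
      moreover have "\<xi> (i_max j) (\<phi> (i_max j) j + int N) \<le> \<xi> (i_max j) (\<phi> (i_max j) j + 2 * int N)"
        by (rule \<xi>_mono[OF IJ_I[OF m(2)]]) simp
      ultimately show ?thesis
        using False by (simp add: p_def q_def q'_def p'_def)
    qed (simp add: p_def q_def q'_def p'_def)
    show "q' j - p j \<le> 1 / c j \<and> p' j - q j \<le> 1 / c j" if j: "j \<in> J" for j
    proof (cases "IJ j = {}")
      case True
      then show ?thesis using c_pos[OF j] by (simp add: p_def q_def q'_def p'_def)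
    next
      case False
      let ?M = "knot_span \<xi> N (IJ j) (\<lambda>i. \<phi> i j)"
      \<comment> \<open>Since \<open>1 / 0 = 0\<close>, a nonpositive \<open>?M\<close> would give
        \<open>1 / ?M \<le> 0\<close>, contrary to \<open>c j > 0\<close>.\<close>
      have "?M > 0"
        using c_small[OF j False] c_pos[OF j] by (meson less_le_trans zero_less_divide_1_iff)
      then have "?M \<le> 1 / c j"
        using c_small[OF j False] c_pos[OF j] by (simp add: field_simps)
      moreover have "q' j - p j \<le> ?M" "p' j - q j \<le> ?M"
        using False by (auto simp: knot_span_def p_def q_def q'_def p'_def i_min_def i_max_def)
      ultimately show ?thesis by linarith
    qed
    show "AE \<gamma> in lborel. (\<Sum>j\<in>F. (norm (fourier_L2 (g j) \<gamma>))\<^sup>2 / c j) \<le> B"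
      "AE \<gamma> in lborel. (\<Sum>j\<in>F. (norm (fourier_L2 (h j) \<gamma>))\<^sup>2 / c j) \<le> B"
      if F: "finite F" "F \<subseteq> J" for F
    proof -
      have "(\<Sum>j\<in>F. (norm (G j \<gamma>))\<^sup>2 / c j) \<le> B \<and> (\<Sum>j\<in>F. (norm (fourier_L2 (h j) \<gamma>))\<^sup>2 / c j) \<le> B"
        if \<gamma>: "good \<gamma>" for \<gamma>
      proof (cases "\<gamma> \<in> S")
        case True
        then obtain i where i: "i \<in> I" "\<gamma> \<in> P i" by (auto simp: S_def)
        obtain k0 where "frequency_window J (JI i) c (\<phi> i) (\<psi> i) N k0 (\<lambda>j. G j \<gamma>) (\<lambda>j. fourier_L2 (h j) \<gamma>) (a i) A C"
          using window[OF \<gamma> i] by blast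
        then interpret frequency_window J "JI i" c "\<phi> i" "\<psi> i" N k0 "\<lambda>j. G j \<gamma>" "\<lambda>j. fourier_L2 (h j) \<gamma>" "a i" A C .
        show ?thesis
          using G_square_sum[OF F] h_square_sum[OF F] B_ge by linarith
      next
        case False
        have "(\<Sum>j\<in>F. (norm (G j \<gamma>))\<^sup>2 / c j) = 0" "(\<Sum>j\<in>F. (norm (fourier_L2 (h j) \<gamma>))\<^sup>2 / c j) = 0"
          using F G_out[OF \<gamma> _ False] h_out[OF \<gamma> _ False] by (auto intro!: sum.neutral)
        then show ?thesis using B_ge(1) by simp
      qed
      with AE_good show "AE \<gamma> in lborel. (\<Sum>j\<in>F. (norm (fourier_L2 (g j) \<gamma>))\<^sup>2 / c j) \<le> B"
        "AE \<gamma> in lborel. (\<Sum>j\<in>F. (norm (fourier_L2 (h j) \<gamma>))\<^sup>2 / c j) \<le> B"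
        by (auto simp: G_def elim!: eventually_mono)
    qed
    show "AE \<gamma> in lborel. \<gamma> \<in> S \<longrightarrow>
      ((\<lambda>j. fourier_L2 (g j) \<gamma> * cnj (fourier_L2 (h j) \<gamma>) / of_real (c j)) has_sum 1) J"
      using AE_good
    proof (eventually_elim, intro impI)
      fix \<gamma> assume \<gamma>: "good \<gamma>" "\<gamma> \<in> S"
      then obtain i where i: "i \<in> I" "\<gamma> \<in> P i" by (auto simp: S_def)
      obtain k0 where "frequency_window J (JI i) c (\<phi> i) (\<psi> i) N k0 (\<lambda>j. G j \<gamma>) (\<lambda>j. fourier_L2 (h j) \<gamma>) (a i) A C"
        using window[OF \<gamma>(1) i] by blast
      from frequency_window.dual_sum[OF this]
      show "((\<lambda>j. fourier_L2 (g j) \<gamma> * cnj (fourier_L2 (h j) \<gamma>) / of_real (c j)) has_sum 1) J"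
        by (simp add: G_def)
    qed
  qed (use J_countable c_pos h_space B_ge in auto)
qed

end
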